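(* Consider $N$ point agents in $\mathbb{R}^n$ with positions $p=(p_1,\ldots,p_N)\in\mathbb{R}^{nN}$, an undirected graph $G=(V,E)$ with $V=\{1,\ldots,N\}$, and desired distances $d_{ij}\geq 0$ ($ij\in E$) that are realizable, i.e. there exists $p\in\mathbb{R}^{nN}$ with $\|p_j-p_i\|=d_{ij}$ for all $ij\in E$. Let the dynamics be $\dot p_i=\sum_{k=1}^n u_{i,k}\,b_{i,k}$, $i=1,\ldots,N$, under the control law \[ u_{i,k}=\sqrt{\omega_{i,k}}\cos(\omega_{i,k}t+\varphi_{i,k})\,h_1(\psi_i(p))+\sqrt{\omega_{i,k}}\sin(\omega_{i,k}t+\varphi_{i,k})\,h_2(\psi_i(p)), \] where all objects are as described in the context. Suppose that for every point $p$ of the set \[ \psi^{-1}(0)=\{(p_1,\ldots,p_N)\in\mathbb{R}^{nN}\mid \|p_j-p_i\|=d_{ij}\text{ for all }ij\in E\} \] the framework $G(p)$ is infinitesimally rigid. Then there exist constants $c,r>0$ such that for every $t_0\in\mathbb{R}$ and every $p_0\in\mathbb{R}^{nN}$ with $\psi(p_0)\leq r$, the trajectory $\gamma$ of the closed-loop system with $\gamma(t_0)=p_0$ converges (as $t\to\infty$) to some point of $\psi^{-1}(0)$, and \[ \psi(\gamma(t))\leq\frac{2\,\psi(p_0)}{1+c\,\psi(p_0)\,(t-t_0)}\quad\text{for every }t\geq t_0. \]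
   Context: A graph $G=(V,E)$ has $V=\{1,\ldots,N\}$ and a nonempty set $E$ of two-element subsets $\{i,j\}$ of $V$ (written $ij$). For each $i$, $b_{i,1},\ldots,b_{i,n}$ is an orthonormal basis of $\mathbb{R}^n$. Local potentials: $\psi_i(p)=\frac14\sum_{j:\,ij\in E}(\|p_j-p_i\|^2-d_{ij}^2)^2$; global potential: $\psi(p)=\frac14\sum_{ij\in E}(\|p_j-p_i\|^2-d_{ij}^2)^2$. The numbers $\omega_{i,k}$ ($i=1,\ldots,N$, $k=1,\ldots,n$) are $nN$ pairwise distinct positive reals, and $\varphi_{i,k}\in\mathbb{R}$ are arbitrary. The functions $h_1,h_2:\mathbb{R}\to\mathbb{R}$ satisfy, for $\nu=1,2$: (i) $h_\nu(y)=0$ for $y\leq 0$; (ii) $h_\nu$ is bounded and of class $C^2$ on $(0,\infty)$; (iii) $h_\nu(y)/y$ remains bounded as $y\downarrow 0$; (iv) $h_\nu'(y)$ remains bounded as $y\downarrow0$; (v) $h_\nu''(y)\,y$ remains bounded as $y\downarrow 0$; (vi) there exist $r',c'>0$ with $h_2'(y)h_1(y)-h_1'(y)h_2(y)\leq -c'y$ for all $y\in(0,r']$. (Such a closed-loop system has a unique global solution for every initial condition.) A framework $G(p)$ is $G$ together with $p\in\mathbb{R}^{nN}$. The edge map of $G$ is $f_G:\mathbb{R}^{nN}\to\mathbb{R}^{|E|}$, $f_G(p)=(\|p_j-p_i\|^2)_{ij\in E}$. Let $C$ be the complete graph on $N$ vertices; for each $p$, $f_C^{-1}(f_C(p))$ is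 a smooth submanifold of $\mathbb{R}^{nN}$. $G(p)$ is infinitesimally rigid if the tangent space to $f_C^{-1}(f_C(p))$ at $p$ equals the kernel of the derivative $\mathrm{D}f_G(p)$. *)

theory Defs
  imports "HOL-Analysis.Analysis"
begin

(* Vertices: a finite type 'v (playing V = {1..N}); agent positions in R^n = real^'n;
   a configuration p in R^{nN} is p :: real^'n^'v, with p $ i the position of agent i.
   Edges: E :: 'v set set, each edge a two-element subset {i,j}. *)

definition edge_sqlen :: "real^'n^'v \<Rightarrow> 'v set \<Rightarrow> real" where
  "edge_sqlen p e = (THE l. \<exists>i j. e = {i, j} \<and> l = (norm (p $ j - p $ i))\<^sup>2)"

definition edge_map :: "'v set set \<Rightarrow> real^'n^'v \<Rightarrow> 'v set \<Rightarrow> real" where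
  "edge_map E p = (\<lambda>e. if e \<in> E then edge_sqlen p e else 0)"

definition complete_graph :: "'v set set" where
  "complete_graph = {e. card e = 2}"

definition tangent_space :: "('a::real_normed_vector) set \<Rightarrow> 'a \<Rightarrow> 'a set" where
  "tangent_space M p = {v. \<exists>c::real \<Rightarrow> 'a. c 0 = p \<and> (\<forall>t. c t \<in> M) \<and> (c has_vector_derivative v) (at 0)}"

definition inf_rigid :: "'v set set \<Rightarrow> real^'n^'v \<Rightarrow> bool" where
  "inf_rigid E p \<longleftrightarrow>
     tangent_space {q. edge_map complete_graph q = edge_map complete_graph p} p
     = {v. \<forall>e\<in>E. frechet_derivative (\<lambda>q. edge_map E q e) (at p) v = 0}"

definition local_pot :: "'v set set \<Rightarrow> ('v set \<Rightarrow> real) \<Rightarrow> 'v \<Rightarrow> real^'n^'v \<Rightarrow> real" where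
  "local_pot E d i p = (1/4) * (\<Sum>j\<in>{j. {i, j} \<in> E}. ((norm (p $ j - p $ i))\<^sup>2 - (d {i, j})\<^sup>2)\<^sup>2)"

definition global_pot :: "'v set set \<Rightarrow> ('v set \<Rightarrow> real) \<Rightarrow> real^'n^'v \<Rightarrow> real" where
  "global_pot E d p = (1/4) * (\<Sum>e\<in>E. (edge_sqlen p e - (d e)\<^sup>2)\<^sup>2)"

definition realizations :: "'v set set \<Rightarrow> ('v set \<Rightarrow> real) \<Rightarrow> (real^'n^'v) set" where
  "realizations E d = {p. \<forall>i j. {i, j} \<in> E \<longrightarrow> norm (p $ j - p $ i) = d {i, j}}"

definition admissible_h :: "(real \<Rightarrow> real) \<Rightarrow> bool" where
  "admissible_h h \<longleftrightarrow>
     (\<forall>y\<le>0. h y = 0) \<and>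
     bounded (h ` {0<..}) \<and>
     (\<forall>y>0. h field_differentiable (at y)) \<and>
     (\<forall>y>0. deriv h field_differentiable (at y)) \<and>
     continuous_on {0<..} (deriv (deriv h)) \<and>
     Bfun (\<lambda>y. h y / y) (at_right 0) \<and>
     Bfun (deriv h) (at_right 0) \<and>
     Bfun (\<lambda>y. deriv (deriv h) y * y) (at_right 0)"

definition control :: "('v \<Rightarrow> 'n \<Rightarrow> real) \<Rightarrow> ('v \<Rightarrow> 'n \<Rightarrow> real) \<Rightarrow> (real \<Rightarrow> real) \<Rightarrow> (real \<Rightarrow> real)
    \<Rightarrow> 'v set set \<Rightarrow> ('v set \<Rightarrow> real) \<Rightarrow> 'v \<Rightarrow> 'n \<Rightarrow> real \<Rightarrow> real^'n^'v \<Rightarrow> real" where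
  "control \<omega> \<phi> h1 h2 E d i k t p =
     sqrt (\<omega> i k) * cos (\<omega> i k * t + \<phi> i k) * h1 (local_pot E d i p)
   + sqrt (\<omega> i k) * sin (\<omega> i k * t + \<phi> i k) * h2 (local_pot E d i p)"

definition closed_loop :: "('v \<Rightarrow> 'n \<Rightarrow> real^'n) \<Rightarrow> ('v \<Rightarrow> 'n \<Rightarrow> real) \<Rightarrow> ('v \<Rightarrow> 'n \<Rightarrow> real)
    \<Rightarrow> (real \<Rightarrow> real) \<Rightarrow> (real \<Rightarrow> real) \<Rightarrow> 'v set set \<Rightarrow> ('v set \<Rightarrow> real)
    \<Rightarrow> real \<Rightarrow> real^'n^'v \<Rightarrow> real^'n^'v" where
  "closed_loop b \<omega> \<phi> h1 h2 E d t p =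
     (\<chi> i. \<Sum>k\<in>UNIV. control \<omega> \<phi> h1 h2 E d i k t p *\<^sub>R b i k)"

end

theory Submission
  imports Defs
begin

text \<open>Near the realizations the vector fields \<open>h(\<psi>\<^sub>i) b\<^bsub>i,k\<^esub>\<close> are of size \<open>\<delta>\<^sup>2\<close>, with
  \<open>\<delta> = sqrt \<psi>\<close>, and every Lie derivative along one of them gains a factor \<open>\<delta>\<close>. Hence the system is slow
  compared with the fixed frequencies \<open>\<omega>\<^bsub>i,k\<^esub>\<close>, and integrating the oscillating terms of \<open>d\<psi>/dt\<close> by
  parts twice gives a function \<open>V = \<psi> + O(\<delta>\<^sup>3)\<close> whose derivative is, up to \<open>O(\<delta>\<^sup>5)\<close>, the derivative of
  \<open>\<psi>\<close> along the brackets \<open>[h\<^sub>1(\<psi>\<^sub>i) b\<^bsub>i,k\<^esub>, h\<^sub>2(\<psi>\<^sub>i) b\<^bsub>i,k\<^esub>]/2\<close>; only these survive because the frequencies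
  are distinct. By assumption (vi) the averaged term is at most a negative multiple of the sum of the
  \<open>\<psi>\<^sub>i |\<nabla>\<^sub>i \<psi>|\<^sup>2\<close>. Since \<open>|\<nabla>\<^sub>i \<psi>|\<^sup>2 = O(\<psi>\<^sub>i)\<close> and rigidity yields \<open>|\<nabla>\<psi>|\<^sup>2 \<ge> c \<psi>\<close>, this is at most
  \<open>- c \<psi>\<^sup>2\<close>, a term of order \<open>\<delta>\<^sup>4\<close> that dominates the remainder, and a Riccati comparison gives the
  decay. One integration by parts shows that the position equals, up to a term tending to zero, a function
  with derivative \<open>O(\<delta>\<^sup>3)\<close>, which is integrable because \<open>\<delta>\<^sup>2\<close> decays like \<open>1/t\<close>.\<close>

section \<open>Potentials and their derivatives\<close>

text \<open>Two obstacles shape the proof. The admissibility conditions allow the second derivative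
  of \<open>h\<close> to blow up like 1/y, so the vector fields may fail to be twice differentiable
  where a local potential vanishes, and for one agent this can happen while
  \<open>global_pot\<close> is still positive. What rescues the second integration by parts is that
  the gradient of a local potential is of the order of its square root: the singular factor always
  meets three such gradients, and a quantity dominated by a local potential is differentiable at its
  zeros, with derivative 0. The derivatives are therefore written out in closed form, so that these
  orders can be counted term by term. The other obstacle is the lack of compactness, since sublevel
  sets of the potential are invariant under translations. Rigidity makes the graph connected, which
  bounds all differences of positions, and the estimates involve only such differences. The
  potential itself need not decrease along a trajectory. The factor 2 in the final estimate, and
  half of the rate, pay for passing from the potential to the corrected function and back.\<close>

definition length_err :: "('v set \<Rightarrow> real) \<Rightarrow> 'v \<Rightarrow> 'v \<Rightarrow> real^'n^'v \<Rightarrow> real" where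
  "length_err d i j p = (norm (p $ j - p $ i))\<^sup>2 - (d {i, j})\<^sup>2"

definition local_pot_d1 where
  "local_pot_d1 E d i (p::real^'n^'v::finite) v =
     (\<Sum>j\<in>{j. {i, j} \<in> E}. length_err d i j p * ((p $ j - p $ i) \<bullet> (v $ j - v $ i)))"

definition local_pot_d2 where
  "local_pot_d2 E d i (p::real^'n^'v::finite) v w =
     (\<Sum>j\<in>{j. {i, j} \<in> E}. 2 * ((p $ j - p $ i) \<bullet> (w $ j - w $ i)) * ((p $ j - p $ i) \<bullet> (v $ j - v $ i))
        + length_err d i j p * ((w $ j - w $ i) \<bullet> (v $ j - v $ i)))"

text \<open>The desired lengths no longer occur: they enter only through the additive constant of
  \<open>length_err\<close>, and every term of the third derivative has differentiated it
  away.\<close>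

definition local_pot_d3 where
  "local_pot_d3 E i (p::real^'n^'v::finite) v w x =
     (\<Sum>j\<in>{j. {i, j} \<in> E}. 2 * ((x $ j - x $ i) \<bullet> (w $ j - w $ i)) * ((p $ j - p $ i) \<bullet> (v $ j - v $ i))
        + 2 * ((p $ j - p $ i) \<bullet> (w $ j - w $ i)) * ((x $ j - x $ i) \<bullet> (v $ j - v $ i))
        + 2 * ((p $ j - p $ i) \<bullet> (x $ j - x $ i)) * ((w $ j - w $ i) \<bullet> (v $ j - v $ i)))"

lemma has_derivative_vec_nth [derivative_intros]:
  "(f has_derivative f') F \<Longrightarrow> ((\<lambda>x. f x $ i) has_derivative (\<lambda>x. f' x $ i)) F"
  by (rule bounded_linear.has_derivative[OF bounded_linear_vec_nth])

lemma length_err_has_derivative [derivative_intros]: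
  fixes p :: "real^'n^'v::finite"
  shows "(length_err d i j has_derivative (\<lambda>v. 2 * ((p $ j - p $ i) \<bullet> (v $ j - v $ i)))) (at p)"
  unfolding length_err_def[abs_def] power2_norm_eq_inner
  by (auto intro!: derivative_eq_intros simp: inner_commute)

lemma local_pot_eq:
  "local_pot E d i p = (1/4) * (\<Sum>j\<in>{j. {i, j} \<in> E}. (length_err d i j p)\<^sup>2)"
  by (simp add: local_pot_def length_err_def)

lemma local_pot_has_derivative:
  fixes p :: "real^'n^'v::finite"
  shows "(local_pot E d i has_derivative local_pot_d1 E d i p) (at p)"
  unfolding local_pot_eq[abs_def] local_pot_d1_def[abs_def]
  by (auto intro!: derivative_eq_intros sum.cong simp: sum_distrib_left)

lemma local_pot_d1_has_derivative:
  fixes p :: "real^'n^'v::finite"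
  shows "((\<lambda>p. local_pot_d1 E d i p v) has_derivative local_pot_d2 E d i p v) (at p)"
  unfolding local_pot_d1_def[abs_def] local_pot_d2_def[abs_def]
  by (auto intro!: derivative_eq_intros sum.cong simp: algebra_simps inner_commute)

lemma local_pot_d2_has_derivative:
  fixes p :: "real^'n^'v::finite"
  shows "((\<lambda>p. local_pot_d2 E d i p v w) has_derivative local_pot_d3 E i p v w) (at p)"
  unfolding local_pot_d2_def[abs_def] local_pot_d3_def[abs_def]
  by (auto intro!: derivative_eq_intros sum.cong simp: algebra_simps inner_commute)

lemma local_pot_nonneg: "local_pot E d i p \<ge> 0"
  unfolding local_pot_def by (intro mult_nonneg_nonneg sum_nonneg) auto

lemma length_err_commute: "length_err d i j p = length_err d j i p"
  by (simp add: length_err_def insert_commute norm_minus_commute)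

lemma edge_sqlen_doubleton: "edge_sqlen p {i, j} = (norm (p $ j - p $ i))\<^sup>2"
  unfolding edge_sqlen_def
  by (rule the_equality) (auto simp: doubleton_eq_iff norm_minus_commute)

text \<open>Double counting: the fibre of the map from \<open>(i, j)\<close> to
  \<open>{i, j}\<close> over an edge consists of exactly two ordered pairs.\<close>

lemma sum_ordered_edges:
  fixes g :: "'v::finite set \<Rightarrow> real"
  assumes "\<forall>e\<in>E. card e = 2"
  shows "(\<Sum>i\<in>UNIV. \<Sum>j\<in>{j. {i, j} \<in> E}. g {i, j}) = 2 * (\<Sum>e\<in>E. g e)"
proof -
  have "(\<Sum>i\<in>UNIV. \<Sum>j\<in>{j. {i, j} \<in> E}. g {i, j})
      = (\<Sum>(i, j)\<in>(SIGMA i:UNIV. {j. {i, j} \<in> E}). g {i, j})"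
    by (rule sum.Sigma) auto
  also have "\<dots> = (\<Sum>e\<in>E. \<Sum>(i, j)\<in>{x \<in> (SIGMA i:UNIV. {j. {i, j} \<in> E}). (\<lambda>(i, j). {i, j}) x = e}. g {i, j})"
    by (subst sum.group) auto
  also have "\<dots> = (\<Sum>e\<in>E. 2 * g e)"
  proof (rule sum.cong[OF refl])
    fix e assume "e \<in> E"
    then obtain a b where ab: "e = {a, b}" "a \<noteq> b" using assms card_2_iff by metis
    have "{x \<in> (SIGMA i:UNIV. {j. {i, j} \<in> E}). (\<lambda>(i, j). {i, j}) x = e} = {(a, b), (b, a)}"
      using \<open>e \<in> E\<close> ab by (auto simp: doubleton_eq_iff insert_commute)
    then show "(\<Sum>(i, j)\<in>{x \<in> (SIGMA i:UNIV. {j. {i, j} \<in> E}). (\<lambda>(i, j). {i, j}) x = e}. g {i, j}) = 2 * g e"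
      using ab by (simp add: insert_commute)
  qed
  finally show ?thesis by (simp add: sum_distrib_left)
qed

lemma sum_local_pot:
  fixes E :: "'v::finite set set"
  assumes "\<forall>e\<in>E. card e = 2"
  shows "(\<Sum>i\<in>UNIV. local_pot E d i p) = 2 * global_pot E d p"
proof -
  have "(\<Sum>i\<in>UNIV. local_pot E d i p)
     = 1/4 * (\<Sum>i\<in>UNIV. \<Sum>j\<in>{j. {i, j} \<in> E}. (edge_sqlen p {i, j} - (d {i, j})\<^sup>2)\<^sup>2)"
    by (simp add: local_pot_def edge_sqlen_doubleton sum_distrib_left)
  also have "\<dots> = 1/4 * (2 * (\<Sum>e\<in>E. (edge_sqlen p e - (d e)\<^sup>2)\<^sup>2))"
    by (subst sum_ordered_edges[OF assms, where g = "\<lambda>e. (edge_sqlen p e - (d e)\<^sup>2)\<^sup>2"]) simp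
  finally show ?thesis by (simp add: global_pot_def)
qed

lemma global_pot_nonneg: "global_pot E d p \<ge> 0"
  unfolding global_pot_def by (intro mult_nonneg_nonneg sum_nonneg) auto

lemma local_pot_le_global_pot:
  fixes E :: "'v::finite set set"
  assumes "\<forall>e\<in>E. card e = 2"
  shows "local_pot E d i p \<le> 2 * global_pot E d p"
  unfolding sum_local_pot[OF assms, symmetric]
  by (rule member_le_sum) (auto simp: local_pot_nonneg)

text \<open>A single term of a sum of squares. All powers of \<open>sqrt (local_pot E d i p)\<close>
  in the later estimates originate here, because the gradient of the local potential carries the
  factor \<open>length_err\<close>.\<close>

lemma abs_length_err_le:
  fixes E :: "'v::finite set set"
  assumes "{i, j} \<in> E"
  shows "\<bar>length_err d i j p\<bar> \<le> 2 * sqrt (local_pot E d i p)"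
proof -
  have "(length_err d i j p)\<^sup>2 \<le> (\<Sum>j\<in>{j. {i, j} \<in> E}. (length_err d i j p)\<^sup>2)"
    by (rule member_le_sum) (use assms in auto)
  also have "\<dots> = 4 * local_pot E d i p" by (simp add: local_pot_eq)
  finally have "sqrt ((length_err d i j p)\<^sup>2) \<le> sqrt (4 * local_pot E d i p)"
    by (rule real_sqrt_le_mono)
  then show ?thesis by (simp add: real_sqrt_mult)
qed

text \<open>Every summand contains \<open>length_err\<close>, which vanishes with the local
  potential. This covers the points at which a derivative of \<open>h\<close> would be evaluated at
  0, where it carries no information.\<close>

lemma local_pot_d1_eq_0:
  fixes p :: "real^'n^'v::finite"
  assumes "local_pot E d i p = 0"
  shows "local_pot_d1 E d i p v = 0"
  unfolding local_pot_d1_def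
proof (rule sum.neutral, clarify)
  fix j assume "{i, j} \<in> E"
  from abs_length_err_le[OF this, of d p] assms
  show "length_err d i j p * ((p $ j - p $ i) \<bullet> (v $ j - v $ i)) = 0" by simp
qed

lemma global_pot_has_derivative:
  fixes p :: "real^'n^'v::finite"
  assumes "\<forall>e\<in>E. card e = 2"
  shows "(global_pot E d has_derivative (\<lambda>v. (\<Sum>i\<in>UNIV. local_pot_d1 E d i p v) / 2)) (at p)"
proof -
  have "((\<lambda>p. 1/2 * (\<Sum>i\<in>UNIV. local_pot E d i p)) has_derivative
      (\<lambda>v. 1/2 * (\<Sum>i\<in>UNIV. local_pot_d1 E d i p v))) (at p)"
    by (intro has_derivative_mult_right has_derivative_sum local_pot_has_derivative)
  then show ?thesis
    by (simp add: sum_local_pot[OF assms])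
qed

lemma continuous_on_global_pot:
  fixes E :: "'v::finite set set"
  assumes "\<forall>e\<in>E. card e = 2"
  shows "continuous_on S (global_pot E d :: real^'n^'v \<Rightarrow> real)"
  using global_pot_has_derivative[OF assms]
  by (meson continuous_at_imp_continuous_on has_derivative_continuous)

text \<open>Moving only agent \<open>i\<close> changes \<open>local_pot E d i\<close> and \<open>global_pot E d\<close> at the same rate,
  because every edge at \<open>i\<close> is counted once in each of them.\<close>

lemma sum_local_pot_d1_axis:
  fixes p :: "real^'n^'v::finite"
  assumes E: "\<forall>e\<in>E. card e = 2"
  shows "(\<Sum>l\<in>UNIV. local_pot_d1 E d l p (axis i x)) / 2 = local_pot_d1 E d i p (axis i x)"
proof -
  have ne: "{l, j} \<in> E \<Longrightarrow> l \<noteq> j" for l j using E by fastforce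
  have "local_pot_d1 E d l p (axis i x)
      = (if {i, l} \<in> E then length_err d i l p * ((p $ l - p $ i) \<bullet> (- x)) else 0)" if "l \<noteq> i" for l
  proof -
    have "local_pot_d1 E d l p (axis i x)
      = (\<Sum>j\<in>{j. {l, j} \<in> E}. if j = i then length_err d i l p * ((p $ l - p $ i) \<bullet> (- x)) else 0)"
      unfolding local_pot_d1_def using that
      by (intro sum.cong refl) (auto simp: axis_def length_err_commute[of d l i] algebra_simps inner_diff_left)
    then show ?thesis by (simp add: insert_commute)
  qed
  then have "(\<Sum>l\<in>UNIV - {i}. local_pot_d1 E d l p (axis i x))
     = (\<Sum>l\<in>UNIV - {i}. if {i, l} \<in> E then length_err d i l p * ((p $ l - p $ i) \<bullet> (- x)) else 0)"
    by (intro sum.cong) auto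
  also have "\<dots> = (\<Sum>l\<in>{l. {i, l} \<in> E}. length_err d i l p * ((p $ l - p $ i) \<bullet> (- x)))"
  proof -
    have "{l \<in> UNIV - {i}. {i, l} \<in> E} = {l. {i, l} \<in> E}" using ne by auto
    then show ?thesis by (simp add: sum.inter_filter[symmetric])
  qed
  also have "\<dots> = local_pot_d1 E d i p (axis i x)"
    unfolding local_pot_d1_def using ne
    by (intro sum.cong refl) (force simp: axis_def)
  finally have "(\<Sum>l\<in>UNIV - {i}. local_pot_d1 E d l p (axis i x)) = local_pot_d1 E d i p (axis i x)" .
  moreover have "(\<Sum>l\<in>UNIV. local_pot_d1 E d l p (axis i x)) = local_pot_d1 E d i p (axis i x)
     + (\<Sum>l\<in>UNIV - {i}. local_pot_d1 E d l p (axis i x))"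
    by (rule sum.remove) auto
  ultimately show ?thesis by simp
qed

lemma realizations_iff_global_pot:
  fixes p :: "real^'n^'v::finite"
  assumes "\<forall>e\<in>E. card e = 2" "\<forall>e\<in>E. d e \<ge> 0"
  shows "p \<in> realizations E d \<longleftrightarrow> global_pot E d p = 0"
proof -
  have fin: "finite E" by simp
  have "global_pot E d p = 0 \<longleftrightarrow> (\<forall>e\<in>E. edge_sqlen p e = (d e)\<^sup>2)"
    by (simp add: global_pot_def sum_nonneg_eq_0_iff[OF fin])
  also have "\<dots> \<longleftrightarrow> (\<forall>i j. {i, j} \<in> E \<longrightarrow> (norm (p $ j - p $ i))\<^sup>2 = (d {i, j})\<^sup>2)"
    using assms(1) by (metis card_2_iff edge_sqlen_doubleton)
  also have "\<dots> \<longleftrightarrow> (\<forall>i j. {i, j} \<in> E \<longrightarrow> norm (p $ j - p $ i) = d {i, j})"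
    using assms(2) by (simp add: power2_eq_iff_nonneg)
  finally show ?thesis by (simp add: realizations_def)
qed

section \<open>Rigid frameworks\<close>

lemma frechet_derivative_edge_map:
  fixes p :: "real^'n^'v::finite"
  assumes "{i, j} \<in> E"
  shows "frechet_derivative (\<lambda>q. edge_map E q {i, j}) (at p) v = 2 * ((p $ j - p $ i) \<bullet> (v $ j - v $ i))"
proof -
  have "(\<lambda>q. edge_map E q {i, j}) = (\<lambda>q::real^'n^'v. length_err (\<lambda>_. 0) i j q)"
    using assms by (simp add: edge_map_def edge_sqlen_doubleton length_err_def)
  then show ?thesis
    by (simp add: frechet_derivative_at[OF length_err_has_derivative, symmetric])
qed

lemma edge_map_complete_eq_iff:
  fixes p q :: "real^'n^'v::finite"
  shows "edge_map complete_graph q = edge_map complete_graph p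
     \<longleftrightarrow> (\<forall>i j. norm (q $ j - q $ i) = norm (p $ j - p $ i))"
proof
  assume eq: "edge_map complete_graph q = edge_map complete_graph p"
  show "\<forall>i j. norm (q $ j - q $ i) = norm (p $ j - p $ i)"
  proof (intro allI)
    fix i j
    show "norm (q $ j - q $ i) = norm (p $ j - p $ i)"
    proof (cases "i = j")
      case False
      then have "{i, j} \<in> complete_graph" by (simp add: complete_graph_def)
      then show ?thesis
        using fun_cong[OF eq, of "{i, j}"] by (simp add: edge_map_def edge_sqlen_doubleton)
    qed simp
  qed
next
  assume "\<forall>i j. norm (q $ j - q $ i) = norm (p $ j - p $ i)"
  then show "edge_map complete_graph q = edge_map complete_graph p"
    by (intro ext) (auto simp: edge_map_def complete_graph_def card_2_iff edge_sqlen_doubleton)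
qed

text \<open>In blocks relative to \<open>S\<close> and its orthogonal complement, the first column
  is prescribed by \<open>f\<close>. Skewness forces the upper right block to be minus the transpose
  of the lower left one; the lower right block is set to zero.\<close>

lemma skew_extension:
  fixes f :: "'a::euclidean_space \<Rightarrow> 'a"
  assumes f: "linear f" and S: "subspace S" and skew: "\<And>z. z \<in> S \<Longrightarrow> f z \<bullet> z = 0"
  obtains A where "linear A" "\<And>z. A z \<bullet> z = 0" "\<And>z. z \<in> S \<Longrightarrow> A z = f z"
proof -
  obtain U where U: "U \<subseteq> S" "pairwise orthogonal U" "\<And>x. x \<in> U \<Longrightarrow> norm x = 1"
    "independent U" "span U = S"
    using orthonormal_basis_subspace[OF S] by metis
  have fin: "finite U" using U(4) by (rule independent_imp_finite)
  have on: "e \<bullet> e' = (if e = e' then 1 else 0)" if "e \<in> U" "e' \<in> U" for e e'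
    using U(2,3) that by (auto simp: pairwise_def orthogonal_def norm_eq_1)
  define P where "P z = (\<Sum>e\<in>U. (e \<bullet> z) *\<^sub>R e)" for z
  \<comment> \<open>\<open>P\<close> is the orthogonal projection onto \<open>S\<close>. The
    subtracted sum is the transpose of the lower left block, applied to the component of
    \<open>z\<close> orthogonal to \<open>S\<close>.\<close>
  define A where "A z = f (P z) - (\<Sum>e\<in>U. (f e \<bullet> (z - P z)) *\<^sub>R e)" for z
  have linP: "linear P"
    unfolding P_def by (intro linearI) (simp_all add: inner_add_right scaleR_add_left sum.distrib scaleR_sum_right)
  have P_in: "P z \<in> S" for z
    unfolding P_def U(5)[symmetric] by (intro span_sum span_scale span_base)
  have orth: "e \<bullet> (z - P z) = 0" if "e \<in> U" for e z
    using that fin by (simp add: P_def inner_diff_right inner_sum_right on if_distrib cong: if_cong)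
  have P_id: "P z = z" if "z \<in> S" for z
  proof -
    have "z - P z \<in> span U" using that P_in U(5) S subspace_diff by blast
    moreover have "\<forall>e\<in>U. orthogonal (z - P z) e"
      using orth by (simp add: orthogonal_def inner_commute)
    ultimately have "orthogonal (z - P z) (z - P z)"
      using orthogonal_to_span by blast
    then show ?thesis by (simp add: orthogonal_def)
  qed
  have "linear A"
    unfolding A_def
    by (intro linearI) (simp_all add: linear_add[OF linP] linear_scale[OF linP] linear_add[OF f] linear_scale[OF f]
        inner_add_right inner_diff_right algebra_simps sum.distrib sum_subtractf scaleR_sum_right)
  moreover have "A z \<bullet> z = 0" for z
  proof -
    have fP: "f (P z) = (\<Sum>e\<in>U. (e \<bullet> z) *\<^sub>R f e)"
      unfolding P_def by (simp add: linear_sum[OF f] linear_scale[OF f])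
    have "(\<Sum>e\<in>U. (f e \<bullet> (z - P z)) *\<^sub>R e) \<bullet> z = f (P z) \<bullet> (z - P z)"
      unfolding fP inner_sum_left by (intro sum.cong) simp_all
    then have "A z \<bullet> z = f (P z) \<bullet> P z"
      by (simp add: A_def inner_diff_left inner_diff_right)
    then show ?thesis using skew P_in by simp
  qed
  moreover have "A z = f z" if "z \<in> S" for z
    using P_id[OF that] by (simp add: A_def)
  ultimately show thesis using that by blast
qed

text \<open>A linear dependency among the vectors persists along the curves, since it only depends on
  the Gram matrix; this is what makes the velocities a linear function of the positions.\<close>

lemma skew_of_constant_gram:
  fixes X :: "'v::finite \<Rightarrow> real \<Rightarrow> 'a::euclidean_space"
  assumes deriv: "\<And>i. (X i has_vector_derivative y i) (at 0)"
    and gram: "\<And>i j t. X i t \<bullet> X j t = X i 0 \<bullet> X j 0"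
  obtains A where "linear A" "\<And>z. A z \<bullet> z = 0" "\<And>i. A (X i 0) = y i"
proof -
  obtain B where B: "B \<subseteq> range (\<lambda>i. X i 0)" "independent B" "range (\<lambda>i. X i 0) \<subseteq> span B"
    using maximal_independent_subset by blast
  have finB: "finite B" using B(2) by (rule independent_imp_finite)
  have "\<forall>b\<in>B. \<exists>i. X i 0 = b" using B(1) by blast
  then obtain \<iota> where \<iota>: "\<And>b. b \<in> B \<Longrightarrow> X (\<iota> b) 0 = b"
    using bchoice[of B "\<lambda>b i. X i 0 = b"] by blast
  obtain f where f: "linear f" "\<And>b. b \<in> B \<Longrightarrow> f b = y (\<iota> b)"
    using linear_independent_extend[OF B(2), of "\<lambda>b. y (\<iota> b)"] by blast
  have f_X: "f (X i 0) = y i" for i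
  proof -
    obtain r where r: "X i 0 = (\<Sum>b\<in>B. r b *\<^sub>R b)"
      using B(3) span_finite[OF finB] by auto
    \<comment> \<open>\<open>D\<close> vanishes at 0, and the square of its norm is a combination of
      Gram entries, hence constant. So the linear relation holds at all times and can be
      differentiated.\<close>
    define D where "D t = (\<Sum>b\<in>B. r b *\<^sub>R X (\<iota> b) t) - X i t" for t
    have D0: "D 0 = 0" using r \<iota> by (simp add: D_def)
    have "D t \<bullet> D t = D 0 \<bullet> D 0" for t
      unfolding D_def
      by (simp add: inner_diff_left inner_diff_right inner_sum_left inner_sum_right
          gram[where t = t])
    then have "D t = 0" for t using D0 by simp
    then have "D = (\<lambda>_. 0)" by (rule ext)
    then have "(D has_vector_derivative 0) (at 0)" by simp
    moreover have "(D has_vector_derivative (\<Sum>b\<in>B. r b *\<^sub>R y (\<iota> b)) - y i) (at 0)"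
      unfolding D_def by (rule derivative_eq_intros deriv refl | simp)+
    ultimately have "(\<Sum>b\<in>B. r b *\<^sub>R y (\<iota> b)) = y i"
      using vector_derivative_unique_at by fastforce
    then show ?thesis
      unfolding r by (simp add: linear_sum[OF f(1)] linear_scale[OF f(1)] f(2))
  qed
  have skew: "f z \<bullet> z = 0" if "z \<in> span B" for z
  proof -
    have "z \<in> range (\<lambda>r. \<Sum>b\<in>B. r b *\<^sub>R b)"
      using that span_finite[OF finB] by simp
    then obtain r where r: "z = (\<Sum>b\<in>B. r b *\<^sub>R b)" by blast
    \<comment> \<open>Here the norm of \<open>D\<close> is constant but not zero; differentiating
      its square at 0 gives twice \<open>f z \<bullet> z\<close>.\<close>
    define D where "D t = (\<Sum>b\<in>B. r b *\<^sub>R X (\<iota> b) t)" for t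
    have D0: "D 0 = z" using r \<iota> by (simp add: D_def)
    have const: "D t \<bullet> D t = D 0 \<bullet> D 0" for t
      unfolding D_def by (simp add: inner_sum_left inner_sum_right gram[where t = t])
    have fz: "f z = (\<Sum>b\<in>B. r b *\<^sub>R y (\<iota> b))"
      unfolding r by (simp add: linear_sum[OF f(1)] linear_scale[OF f(1)] f(2))
    have "(D has_vector_derivative f z) (at 0)"
      unfolding D_def fz by (rule derivative_eq_intros deriv refl | simp)+
    then have "((\<lambda>t. D t \<bullet> D t) has_vector_derivative (D 0 \<bullet> f z + f z \<bullet> D 0)) (at 0)"
      by (auto intro!: bounded_bilinear.has_vector_derivative[OF bounded_bilinear_inner])
    moreover have "((\<lambda>t. D t \<bullet> D t) has_vector_derivative 0) (at 0)"
      by (subst const) simp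
    ultimately have "D 0 \<bullet> f z + f z \<bullet> D 0 = 0"
      using vector_derivative_unique_at by blast
    then show ?thesis by (simp add: D0 inner_commute)
  qed
  obtain A where A: "linear A" "\<And>z. A z \<bullet> z = 0" "\<And>z. z \<in> span B \<Longrightarrow> A z = f z"
    using skew_extension[OF f(1) subspace_span skew] by metis
  show thesis
  proof (rule that[OF A(1,2)])
    show "A (X i 0) = y i" for i
      using A(3)[of "X i 0"] B(3) f_X by auto
  qed
qed

text \<open>Tangent vectors come from curves that are merely differentiable at one point, so no
  smooth family of isometries is at hand. By polarization the distances determine the Gram matrix of
  the positions relative to one chosen agent \<open>a\<close>, which yields the skew map; the
  velocity of \<open>a\<close> then determines \<open>x\<close>.\<close>

lemma tangent_congruent_skew:
  fixes p v :: "real^'n^'v::finite"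
  assumes "v \<in> tangent_space {q. edge_map complete_graph q = edge_map complete_graph p} p"
  obtains A x where "linear A" "\<And>z. A z \<bullet> z = 0" "\<And>i. v $ i = A (p $ i) + x"
proof -
  obtain c :: "real \<Rightarrow> real^'n^'v" where c: "c 0 = p" "\<And>t i j. norm (c t $ j - c t $ i) = norm (p $ j - p $ i)"
    "(c has_vector_derivative v) (at 0)"
    using assms unfolding tangent_space_def edge_map_complete_eq_iff by blast
  fix a :: 'v
  define X where "X i t = c t $ i - c t $ a" for i t
  have c': "((\<lambda>t. c t $ i) has_vector_derivative v $ i) (at 0)" for i
    using bounded_linear.has_vector_derivative[OF bounded_linear_vec_nth c(3)] .
  have gram: "X i t \<bullet> X j t = X i 0 \<bullet> X j 0" for i j t
  proof -
    have pol: "2 * (x \<bullet> y) = (norm x)\<^sup>2 + (norm y)\<^sup>2 - (norm (y - x))\<^sup>2" for x y :: "real^'n"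
      by (simp add: power2_norm_eq_inner algebra_simps inner_commute)
    have "norm (X j t - X i t) = norm (X j 0 - X i 0)"
      using c(2)[of t j i] by (simp add: X_def c(1))
    moreover have "norm (X i t) = norm (X i 0)" for i
      using c(2)[of t i a] by (simp add: X_def c(1))
    ultimately show ?thesis
      using pol[of "X i t" "X j t"] pol[of "X i 0" "X j 0"] by simp
  qed
  have "(X i has_vector_derivative (v $ i - v $ a)) (at 0)" for i
    unfolding X_def by (intro has_vector_derivative_diff c')
  then obtain A where A: "linear A" "\<And>z. A z \<bullet> z = 0" "\<And>i. A (X i 0) = v $ i - v $ a"
    using skew_of_constant_gram[of X "\<lambda>i. v $ i - v $ a", OF _ gram] by blast
  show thesis
  proof (rule that[OF A(1,2)])
    show "v $ i = A (p $ i) + (v $ a - A (p $ a))" for i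
      using A(3)[of i] by (simp add: X_def c(1) linear_diff[OF A(1)] algebra_simps)
  qed
qed

text \<open>The kernel of the derivative of the edge map is described edge by edge by an
  orthogonality relation. Every use of rigidity below goes through this form.\<close>

lemma inf_rigid_tangentI:
  fixes p v :: "real^'n^'v::finite"
  assumes "\<forall>e\<in>E. card e = 2" "inf_rigid E p"
    and "\<And>i j. {i, j} \<in> E \<Longrightarrow> (p $ j - p $ i) \<bullet> (v $ j - v $ i) = 0"
  shows "v \<in> tangent_space {q. edge_map complete_graph q = edge_map complete_graph p} p"
proof -
  have "frechet_derivative (\<lambda>q. edge_map E q e) (at p) v = 0" if "e \<in> E" for e
  proof -
    have "card e = 2" using assms(1) that by blast
    then obtain i j where "e = {i, j}" by (auto simp: card_2_iff)
    then show ?thesis using that assms(3) by (simp add: frechet_derivative_edge_map)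
  qed
  then show ?thesis using assms(2) by (simp add: inf_rigid_def)
qed

text \<open>If \<open>a\<close> and \<open>b\<close> lay in different components, translating the component of \<open>a\<close> would be an
  infinitesimal flex that no motion preserving the distance from \<open>a\<close> to \<open>b\<close> realizes.\<close>

lemma inf_rigid_connected:
  fixes p :: "real^'n^'v::finite"
  assumes E: "\<forall>e\<in>E. card e = 2" and rigid: "inf_rigid E p"
  shows "(a, b) \<in> {(i, j). {i, j} \<in> E}\<^sup>*"
proof (rule ccontr)
  assume not: "(a, b) \<notin> {(i, j). {i, j} \<in> E}\<^sup>*"
  define C where "C = {i. (a, i) \<in> {(i, j). {i, j} \<in> E}\<^sup>*}"
  have C: "a \<in> C" "b \<notin> C" using not by (auto simp: C_def)
  have step: "i \<in> C \<longleftrightarrow> j \<in> C" if "{i, j} \<in> E" for i j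
    unfolding C_def using that
    by (auto intro: rtrancl_into_rtrancl simp: insert_commute)
  \<comment> \<open>The translation is one that a skew linear map cannot produce from
    \<open>p $ a - p $ b\<close>: that vector itself if it is nonzero, and any nonzero vector
    otherwise.\<close>
  define u :: "real^'n" where "u = (if p $ a = p $ b then (\<chi> _. 1) else p $ a - p $ b)"
  have u0: "u \<noteq> 0" by (auto simp: u_def vec_eq_iff)
  define v :: "real^'n^'v" where "v = (\<chi> i. if i \<in> C then u else 0)"
  have "v \<in> tangent_space {q. edge_map complete_graph q = edge_map complete_graph p} p"
    by (rule inf_rigid_tangentI[OF E rigid]) (use step in \<open>auto simp: v_def\<close>)
  then obtain A x where A: "linear A" "\<And>z. A z \<bullet> z = 0" "\<And>i. v $ i = A (p $ i) + x"
    by (rule tangent_congruent_skew) blast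
  have u: "u = A (p $ a - p $ b)"
    using A(3)[of a] A(3)[of b] C by (simp add: v_def linear_diff[OF A(1)] eq_neg_iff_add_eq_0 add.commute)
  show False
  proof (cases "p $ a = p $ b")
    case True
    then show ?thesis using u u0 linear_0[OF A(1)] by simp
  next
    case False
    then have "u \<bullet> u = 0" using A(2)[of "p $ a - p $ b"] u by (simp add: u_def)
    then show ?thesis using u0 by simp
  qed
qed

text \<open>Differences of positions add up along a path in the graph, and each edge on it
  contributes at most \<open>4 + (d e)\<^sup>2\<close>. This substitutes for boundedness of the
  sublevel set.\<close>

lemma bounded_diff_of_connected:
  fixes E :: "'v::finite set set"
  assumes E: "\<forall>e\<in>E. card e = 2" and con: "\<And>a b. (a, b) \<in> {(i, j). {i, j} \<in> E}\<^sup>*"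
  obtains K where "\<And>(p::real^'n^'v) i j. global_pot E d p \<le> 1 \<Longrightarrow> norm (p $ j - p $ i) \<le> K"
proof -
  have edge: "norm (p $ j - p $ i) \<le> 4 + (d {i, j})\<^sup>2"
    if "{i, j} \<in> E" "global_pot E d p \<le> 1" for i j and p :: "real^'n^'v"
  proof -
    have "local_pot E d i p \<le> 4" using local_pot_le_global_pot[OF E, of d i p] that(2) by linarith
    then have "sqrt (local_pot E d i p) \<le> sqrt 4" by (rule real_sqrt_le_mono)
    then have "\<bar>length_err d i j p\<bar> \<le> 4" using abs_length_err_le[OF that(1), of d p] by simp
    then have "(norm (p $ j - p $ i))\<^sup>2 \<le> 4 + (d {i, j})\<^sup>2" by (simp add: length_err_def)
    moreover have "0 \<le> (norm (p $ j - p $ i) - 1)\<^sup>2" by simp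
    moreover have "(norm (p $ j - p $ i) - 1)\<^sup>2 = (norm (p $ j - p $ i))\<^sup>2 - 2 * norm (p $ j - p $ i) + 1"
      by (simp add: power2_eq_square algebra_simps)
    moreover have "0 \<le> (d {i, j})\<^sup>2" by simp
    ultimately show ?thesis by linarith
  qed
  have "\<exists>K. \<forall>p::real^'n^'v. global_pot E d p \<le> 1 \<longrightarrow> norm (p $ b - p $ a) \<le> K" for a b
    using con[of a b]
  proof (induction rule: rtrancl_induct)
    case base
    show ?case by (intro exI[of _ 0]) simp
  next
    case (step y z)
    then obtain K where K: "\<forall>p::real^'n^'v. global_pot E d p \<le> 1 \<longrightarrow> norm (p $ y - p $ a) \<le> K" by blast
    have "norm (p $ z - p $ a) \<le> K + (4 + (d {y, z})\<^sup>2)" if "global_pot E d p \<le> 1" for p :: "real^'n^'v"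
    proof -
      have "norm (p $ z - p $ a) \<le> norm (p $ y - p $ a) + norm (p $ z - p $ y)"
        using norm_triangle_ineq[of "p $ y - p $ a" "p $ z - p $ y"] by (simp add: algebra_simps)
      then show ?thesis using K edge[of y z p] that step(2) by fastforce
    qed
    then show ?case by blast
  qed
  then have "\<exists>K. \<forall>a b. \<forall>p::real^'n^'v. global_pot E d p \<le> 1 \<longrightarrow> norm (p $ b - p $ a) \<le> K a b"
    by (intro choice allI)
  then obtain K where K: "\<And>(p::real^'n^'v) a b. global_pot E d p \<le> 1 \<Longrightarrow> norm (p $ b - p $ a) \<le> K a b"
    by blast
  have "K i j \<le> Max (range (\<lambda>(i, j). K i j))" for i j
    by (rule Max_ge) auto
  then show thesis
    using K by (intro that) (rule order_trans)
qed

text \<open>A Lojasiewicz inequality with exponent 1/2. In the limit \<open>p \<rightarrow> q\<close>, with \<open>q\<close> the realization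
  nearest to \<open>p\<close>, a failure of the inequality along \<open>p - q\<close> yields an infinitesimal flex \<open>u\<close>; by
  rigidity \<open>u\<close> comes from an affine map with skew linear part, which is also a flex at \<open>q\<close> and hence
  orthogonal to \<open>p - q\<close>.\<close>

lemma global_pot_gradient_lower_bound:
  fixes E :: "'v::finite set set" and d :: "'v set \<Rightarrow> real"
  assumes E: "\<forall>e\<in>E. card e = 2" and d: "\<forall>e\<in>E. d e \<ge> 0"
    and realizable: "realizations E d \<noteq> ({} :: (real^'n^'v) set)"
    and rigid: "\<And>p::real^'n^'v. p \<in> realizations E d \<Longrightarrow> inf_rigid E p"
  obtains c r where "c > 0" "r > 0"
    "\<And>p::real^'n^'v. global_pot E d p \<le> r \<Longrightarrow>
       \<exists>u. norm u = 1 \<and> c * global_pot E d p \<le> ((\<Sum>i\<in>UNIV. local_pot_d1 E d i p u) / 2)\<^sup>2"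
proof (rule ccontr)
  assume neg: "\<not> thesis"
  define N :: "real^'n^'v \<Rightarrow> real^'n^'v \<Rightarrow> real"
    where "N p u = (\<Sum>i\<in>UNIV. local_pot_d1 E d i p u) / 2" for p u
  obtain z :: "real^'n^'v" where z: "z \<in> realizations E d" using realizable by blast
  have con: "(a, b) \<in> {(i, j). {i, j} \<in> E}\<^sup>*" for a b
    by (rule inf_rigid_connected[OF E rigid[OF z]])
  obtain K where K: "\<And>(p::real^'n^'v) i j. global_pot E d p \<le> 1 \<Longrightarrow> norm (p $ j - p $ i) \<le> K"
    using bounded_diff_of_connected[OF E con] by blast
  have closed: "closed (realizations E d :: (real^'n^'v) set)"
  proof -
    have "realizations E d = global_pot E d -` {0} \<inter> (UNIV :: (real^'n^'v) set)"
      using realizations_iff_global_pot[OF E d] by auto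
    then show ?thesis
      using continuous_closed_preimage[OF continuous_on_global_pot[OF E] closed_UNIV, of "{0}" d] by (simp add: Int_commute)
  qed
  fix a :: 'v
  \<comment> \<open>Counterexamples for both constants equal to 1/(m+1). Potential and derivative
    are translation invariant, so agent \<open>a\<close> can be placed at the origin, which makes
    the sequence bounded.\<close>
  have ex: "\<exists>p::real^'n^'v. p $ a = 0 \<and> global_pot E d p \<le> inverse (real (Suc m))
      \<and> (\<forall>u. norm u = 1 \<longrightarrow> (N p u)\<^sup>2 < inverse (real (Suc m)) * global_pot E d p)" for m
  proof -
    have "\<exists>p::real^'n^'v. global_pot E d p \<le> inverse (real (Suc m))
      \<and> (\<forall>u. norm u = 1 \<longrightarrow> (N p u)\<^sup>2 < inverse (real (Suc m)) * global_pot E d p)"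
    proof (rule ccontr)
      assume "\<not> ?thesis"
      then have "\<exists>u. norm u = 1 \<and> inverse (real (Suc m)) * global_pot E d p \<le> (N p u)\<^sup>2"
        if "global_pot E d p \<le> inverse (real (Suc m))" for p
        using that by (meson not_le)
      then show False
        using neg that[of "inverse (real (Suc m))" "inverse (real (Suc m))"]
        unfolding N_def by fastforce
    qed
    then obtain p :: "real^'n^'v" where p: "global_pot E d p \<le> inverse (real (Suc m))"
      "\<And>u. norm u = 1 \<Longrightarrow> (N p u)\<^sup>2 < inverse (real (Suc m)) * global_pot E d p" by blast
    define p' where "p' = (\<chi> i. p $ i - p $ a)"
    have "2 * global_pot E d p' = 2 * global_pot E d p"
      unfolding sum_local_pot[OF E, symmetric] by (simp add: p'_def local_pot_def)
    moreover have "N p' u = N p u" for u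
      by (simp add: N_def local_pot_d1_def length_err_def p'_def)
    ultimately show ?thesis using p by (intro exI[of _ p']) (simp add: p'_def)
  qed
  then obtain p :: "nat \<Rightarrow> real^'n^'v" where p: "\<And>m. p m $ a = 0"
    "\<And>m. global_pot E d (p m) \<le> inverse (real (Suc m))"
    "\<And>m u. norm u = 1 \<Longrightarrow> (N (p m) u)\<^sup>2 < inverse (real (Suc m)) * global_pot E d (p m)"
    by metis
  have "\<forall>m. \<exists>q\<in>realizations E d. \<forall>y\<in>realizations E d. dist (p m) q \<le> dist (p m) y"
    using distance_attains_inf[OF closed realizable] by metis
  then obtain q where q: "\<And>m. q m \<in> realizations E d"
    "\<And>m y. y \<in> realizations E d \<Longrightarrow> dist (p m) (q m) \<le> dist (p m) y" by metis
  define w where "w m = p m - q m" for m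
  define u where "u m = (1 / norm (w m)) *\<^sub>R w m" for m
  have w0: "w m \<noteq> 0" for m
  proof
    assume "w m = 0"
    then have "global_pot E d (p m) = 0"
      using q(1)[of m] realizations_iff_global_pot[OF E d, of "q m"] by (simp add: w_def)
    \<comment> \<open>The violated inequality is strict, and at a realization its right-hand side is
      0.\<close>
    then show False using p(3)[of "axis a (axis undefined 1)" m] by (simp add: norm_axis_1)
  qed
  have nu: "norm (u m) = 1" for m using w0 by (simp add: u_def)
  have wu: "w m = norm (w m) *\<^sub>R u m" for m using w0 by (simp add: u_def)
  have "p m \<in> cball 0 (real CARD('v) * K)" for m
  proof -
    have "global_pot E d (p m) \<le> 1"
      using p(2)[of m] by (rule order_trans) (simp add: field_simps)
    then have "norm (p m $ i) \<le> K" for i using K[of "p m" i a] p(1)[of m] by simp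
    then have "(\<Sum>i\<in>UNIV. norm (p m $ i)) \<le> of_nat (card (UNIV::'v set)) * K"
      by (intro sum_bounded_above) auto
    then show ?thesis using L2_set_le_sum[of UNIV "\<lambda>i. norm (p m $ i)"]
      by (simp add: norm_vec_def)
  qed
  then have "\<forall>m. (p m, u m) \<in> cball 0 (real CARD('v) * K) \<times> sphere 0 1"
    using nu by simp
  moreover have "seq_compact (cball 0 (real CARD('v) * K) \<times> sphere 0 1 :: ((real^'n^'v) \<times> (real^'n^'v)) set)"
    by (intro compact_imp_seq_compact compact_Times compact_cball compact_sphere)
  ultimately obtain l r where l: "strict_mono (r :: nat \<Rightarrow> nat)" "((\<lambda>m. (p m, u m)) \<circ> r) \<longlonglongrightarrow> l"
    "l \<in> cball 0 (real CARD('v) * K) \<times> sphere 0 1"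
    by (meson seq_compactE)
  obtain ps us where ls: "l = (ps, us)" by (cases l)
  have plim: "(\<lambda>m. p (r m)) \<longlonglongrightarrow> ps" and ulim: "(\<lambda>m. u (r m)) \<longlonglongrightarrow> us"
    using tendsto_fst[OF l(2)] tendsto_snd[OF l(2)] by (simp_all add: ls o_def)
  have nus: "norm us = 1" using l(3) ls by simp
  have inv_lim: "(\<lambda>m. inverse (real (Suc (r m)))) \<longlonglongrightarrow> 0"
    using LIMSEQ_subseq_LIMSEQ[OF LIMSEQ_inverse_real_of_nat l(1)] by (simp add: o_def)
  have "(\<lambda>m. global_pot E d (p (r m))) \<longlonglongrightarrow> global_pot E d ps"
    by (rule continuous_on_tendsto_compose[OF continuous_on_global_pot[OF E, of UNIV] plim]) auto
  moreover have "(\<lambda>m. global_pot E d (p (r m))) \<longlonglongrightarrow> 0"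
    by (rule tendsto_sandwich[OF _ _ tendsto_const inv_lim])
       (intro always_eventually allI global_pot_nonneg p(2))+
  ultimately have "global_pot E d ps = 0" using LIMSEQ_unique by blast
  then have ps: "ps \<in> realizations E d" by (simp add: realizations_iff_global_pot[OF E d])
  have wlim: "(\<lambda>m. w (r m)) \<longlonglongrightarrow> 0"
  proof (rule Lim_null_comparison)
    show "\<forall>\<^sub>F m in sequentially. norm (w (r m)) \<le> dist (p (r m)) ps"
      using q(2)[OF ps] by (simp add: w_def dist_norm)
    show "(\<lambda>m. dist (p (r m)) ps) \<longlonglongrightarrow> 0" using plim by (simp add: tendsto_dist_iff[symmetric])
  qed
  have qlim: "(\<lambda>m. q (r m)) \<longlonglongrightarrow> ps"
    using tendsto_diff[OF plim wlim] by (simp add: w_def)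
  \<comment> \<open>Blow-up at the nearest realization: on edges, \<open>T\<close> is the edge error
    divided by the distance \<open>norm (w m)\<close>, and \<open>\<rho>\<close> is its limit up to
    the factor 2.\<close>
  define T where "T m i j = 2 * ((q m $ j - q m $ i) \<bullet> (u m $ j - u m $ i))
      + norm (w m) * (norm (u m $ j - u m $ i))\<^sup>2" for m i j
  define \<rho> where "\<rho> i j = (ps $ j - ps $ i) \<bullet> (us $ j - us $ i)" for i j
  have T: "length_err d i j (p m) = norm (w m) * T m i j" if "{i, j} \<in> E" for m i j
  proof -
    have pq: "p m $ k = q m $ k + norm (w m) *\<^sub>R u m $ k" for k
      using wu[of m] unfolding w_def by (metis add_diff_cancel_left' diff_add_cancel vector_add_component vector_scaleR_component add.commute)
    have "norm (q m $ j - q m $ i) = d {i, j}"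
      using q(1)[of m] that by (simp add: realizations_def)
    then have "length_err d i j (p m) = (norm ((q m $ j - q m $ i) + norm (w m) *\<^sub>R (u m $ j - u m $ i)))\<^sup>2
       - (norm (q m $ j - q m $ i))\<^sup>2"
      by (simp add: length_err_def pq algebra_simps)
    also have "\<dots> = norm (w m) * T m i j"
    proof -
      have "(norm (x + c *\<^sub>R y))\<^sup>2 - (norm x)\<^sup>2 = c * (2 * (x \<bullet> y) + c * (norm y)\<^sup>2)"
        for c and x y :: "real^'n"
        by (simp add: power2_norm_eq_inner inner_add_left inner_add_right inner_commute algebra_simps)
      then show ?thesis unfolding T_def .
    qed
    finally show ?thesis .
  qed
  have ulim': "(\<lambda>m. u (r m) $ k) \<longlonglongrightarrow> us $ k" and qlim': "(\<lambda>m. q (r m) $ k) \<longlonglongrightarrow> ps $ k"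
    and plim': "(\<lambda>m. p (r m) $ k) \<longlonglongrightarrow> ps $ k" for k
    using ulim qlim plim by (auto intro: tendsto_vec_nth)
  have Tlim: "(\<lambda>m. T (r m) i j) \<longlonglongrightarrow> 2 * \<rho> i j" for i j
  proof -
    have "(\<lambda>m. T (r m) i j) \<longlonglongrightarrow> 2 * \<rho> i j + norm (0::real^'n^'v) * (norm (us $ j - us $ i))\<^sup>2"
      unfolding T_def \<rho>_def by (intro tendsto_intros ulim' qlim' wlim)
    then show ?thesis by simp
  qed
  \<comment> \<open>\<open>G\<close> and \<open>H\<close> are the derivative along
    \<open>u m\<close> and the potential, divided by the first and the second power of the distance.
    The square of \<open>G\<close> is at most \<open>H\<close> over m+1, while \<open>G\<close>
    tends to the sum of the squares of the \<open>\<rho>\<close>; so \<open>\<rho>\<close> vanishes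
    on all edges.\<close>
  define G where "G m = (\<Sum>i\<in>UNIV. \<Sum>j\<in>{j. {i, j} \<in> E}. T m i j * ((p m $ j - p m $ i) \<bullet> (u m $ j - u m $ i))) / 2" for m
  define H where "H m = (\<Sum>i\<in>UNIV. 1/4 * (\<Sum>j\<in>{j. {i, j} \<in> E}. (T m i j)\<^sup>2)) / 2" for m
  have G: "N (p m) (u m) = norm (w m) * G m" for m
    by (simp add: N_def G_def local_pot_d1_def T sum_distrib_left mult.assoc)
  have H: "global_pot E d (p m) = (norm (w m))\<^sup>2 * H m" for m
  proof -
    have "global_pot E d (p m) = (\<Sum>i\<in>UNIV. local_pot E d i (p m)) / 2"
      by (simp add: sum_local_pot[OF E])
    also have "\<dots> = (norm (w m))\<^sup>2 * H m"
      by (simp add: H_def local_pot_eq T sum_distrib_left power_mult_distrib)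
    finally show ?thesis .
  qed
  have Gle: "(G m)\<^sup>2 \<le> inverse (real (Suc m)) * H m" for m
  proof -
    have "(norm (w m))\<^sup>2 * (G m)\<^sup>2 \<le> (norm (w m))\<^sup>2 * (inverse (real (Suc m)) * H m)"
      using p(3)[OF nu, of m m] unfolding G H by (simp add: power_mult_distrib algebra_simps)
    then show ?thesis using w0 by (simp add: mult_le_cancel_left_pos)
  qed
  have Glim: "(\<lambda>m. (G (r m))\<^sup>2) \<longlonglongrightarrow> ((\<Sum>i\<in>UNIV. \<Sum>j\<in>{j. {i, j} \<in> E}. 2 * \<rho> i j * \<rho> i j) / 2)\<^sup>2"
  proof -
    have "(\<lambda>m. (p (r m) $ j - p (r m) $ i) \<bullet> (u (r m) $ j - u (r m) $ i)) \<longlonglongrightarrow> \<rho> i j" for i j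
      unfolding \<rho>_def by (intro tendsto_intros ulim' plim')
    then show ?thesis
      unfolding G_def by (intro tendsto_intros Tlim) auto
  qed
  have Hlim: "(\<lambda>m. inverse (real (Suc (r m))) * H (r m)) \<longlonglongrightarrow>
      0 * ((\<Sum>i\<in>UNIV. 1/4 * (\<Sum>j\<in>{j. {i, j} \<in> E}. (2 * \<rho> i j)\<^sup>2)) / 2)"
    unfolding H_def by (intro tendsto_mult[OF inv_lim]) (intro tendsto_intros Tlim, simp)
  have "((\<Sum>i\<in>UNIV. \<Sum>j\<in>{j. {i, j} \<in> E}. 2 * \<rho> i j * \<rho> i j) / 2)\<^sup>2 \<le> 0"
    using LIMSEQ_le[OF Glim Hlim] Gle by simp
  then have "(\<Sum>i\<in>UNIV. \<Sum>j\<in>{j. {i, j} \<in> E}. 2 * \<rho> i j * \<rho> i j) = 0" by simp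
  then have "\<rho> i j = 0" if "{i, j} \<in> E" for i j
    using that by (subst (asm) sum_nonneg_eq_0_iff; simp add: sum_nonneg sum_nonneg_eq_0_iff mult.assoc)
  then have "us \<in> tangent_space {q. edge_map complete_graph q = edge_map complete_graph ps} ps"
    by (intro inf_rigid_tangentI[OF E rigid[OF ps]]) (simp add: \<rho>_def)
  then obtain A x where A: "linear A" "\<And>z. A z \<bullet> z = 0" "\<And>i. us $ i = A (ps $ i) + x"
    by (rule tangent_congruent_skew) blast
  \<comment> \<open>The affine map that generates \<open>us\<close> at \<open>ps\<close> is now
    applied at \<open>q m\<close>. Since \<open>A\<close> is skew, the result is a flex there too,
    and it converges to \<open>us\<close>.\<close>
  define v where "v m = (\<chi> i. A (q m $ i) + x)" for m
  have "u m \<bullet> v m = 0" for m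
  proof -
    have "v m \<in> tangent_space {y. edge_map complete_graph y = edge_map complete_graph (q m)} (q m)"
      by (rule inf_rigid_tangentI[OF E rigid[OF q(1)]])
         (simp add: v_def linear_diff[OF A(1), symmetric] inner_commute[of _ "A _"] A(2))
    then obtain c :: "real \<Rightarrow> real^'n^'v" where c: "c 0 = q m" "\<And>t i j. norm (c t $ j - c t $ i) = norm (q m $ j - q m $ i)"
      "(c has_vector_derivative v m) (at 0)"
      unfolding tangent_space_def edge_map_complete_eq_iff by blast
    have "c t \<in> realizations E d" for t
      using q(1)[of m] c(2) by (simp add: realizations_def)
    \<comment> \<open>The curve stays among the realizations, so its distance from
      \<open>p m\<close> is minimal at time 0. The first-order condition makes \<open>v m\<close>
      orthogonal to \<open>w m\<close>.\<close>
    then have min: "norm (p m - c 0) \<le> norm (p m - c t)" for t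
      using q(2)[of "c t" m] by (simp add: c(1) dist_norm)
    have "((\<lambda>t. p m - c t) has_vector_derivative - v m) (at 0)"
      using has_vector_derivative_diff[OF has_vector_derivative_const c(3)] by simp
    then have "((\<lambda>t. (p m - c t) \<bullet> (p m - c t)) has_vector_derivative
        ((p m - c 0) \<bullet> (- v m) + (- v m) \<bullet> (p m - c 0))) (at 0)"
      by (rule bounded_bilinear.has_vector_derivative[OF bounded_bilinear_inner]) fact
    then have "((\<lambda>t. (p m - c t) \<bullet> (p m - c t)) has_real_derivative
        ((p m - c 0) \<bullet> (- v m) + (- v m) \<bullet> (p m - c 0))) (at 0)"
      by (simp add: has_real_derivative_iff_has_vector_derivative)
    then have "(p m - c 0) \<bullet> (- v m) + (- v m) \<bullet> (p m - c 0) = 0"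
      by (rule DERIV_local_min[where d = 1]) (use min in \<open>auto simp: norm_le\<close>)
    then have "w m \<bullet> v m = 0" by (simp add: c(1) w_def inner_commute)
    then show ?thesis by (simp add: u_def)
  qed
  moreover have "(\<lambda>m. v (r m)) \<longlonglongrightarrow> us"
  proof (rule vec_tendstoI)
    fix i
    have "(\<lambda>m. A (q (r m) $ i) + x) \<longlonglongrightarrow> A (ps $ i) + x"
      by (intro tendsto_add tendsto_const bounded_linear.tendsto[OF _ qlim'])
         (use A(1) in \<open>simp add: linear_conv_bounded_linear\<close>)
    then show "(\<lambda>m. v (r m) $ i) \<longlonglongrightarrow> us $ i" by (simp add: v_def A(3))
  qed
  then have "(\<lambda>m. u (r m) \<bullet> v (r m)) \<longlonglongrightarrow> us \<bullet> us"
    by (intro tendsto_inner ulim)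
  ultimately have "us \<bullet> us = 0" by (simp add: LIMSEQ_const_iff)
  then show False using nus by simp
qed

section \<open>Differential inequalities\<close>

text \<open>The reciprocal of \<open>V\<close> grows at rate at least \<open>k\<close>. The bound is
  stated multiplied out because \<open>V\<close> may vanish; since \<open>V\<close> is
  nonincreasing, a positive final value makes it positive throughout.\<close>

lemma riccati_decay:
  fixes V :: "real \<Rightarrow> real"
  assumes "t0 \<le> t1" "k \<ge> 0"
    and deriv: "\<And>t. t0 \<le> t \<Longrightarrow> t \<le> t1 \<Longrightarrow> (V has_real_derivative V' t) (at t)"
    and V': "\<And>t. t0 \<le> t \<Longrightarrow> t \<le> t1 \<Longrightarrow> V' t \<le> - k * (V t)\<^sup>2"
    and nonneg: "\<And>t. t0 \<le> t \<Longrightarrow> t \<le> t1 \<Longrightarrow> V t \<ge> 0"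
  shows "V t1 \<le> V t0" "V t1 * (1 + k * V t0 * (t1 - t0)) \<le> V t0"
proof -
  have anti: "V s \<ge> V t" if "t0 \<le> s" "s \<le> t" "t \<le> t1" for s t
  proof (rule DERIV_nonpos_imp_nonincreasing[OF \<open>s \<le> t\<close>])
    fix x assume "s \<le> x" "x \<le> t"
    then have "(V has_real_derivative V' x) (at x)" "V' x \<le> - k * (V x)\<^sup>2"
      using deriv V' that by auto
    moreover have "0 \<le> k * (V x)\<^sup>2" using \<open>k \<ge> 0\<close> by simp
    ultimately show "\<exists>y. DERIV V x :> y \<and> y \<le> 0" by (intro exI[of _ "V' x"]) auto
  qed
  show "V t1 \<le> V t0" using anti[of t0 t1] \<open>t0 \<le> t1\<close> by simp
  show "V t1 * (1 + k * V t0 * (t1 - t0)) \<le> V t0"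
  proof (cases "V t1 = 0")
    case True
    then show ?thesis using nonneg \<open>t0 \<le> t1\<close> by simp
  next
    case False
    have pos: "V t > 0" if "t0 \<le> t" "t \<le> t1" for t
      using anti[of t t1] that nonneg[of t1] False \<open>t0 \<le> t1\<close> by simp
    have "inverse (V t0) - k * t0 \<le> inverse (V t1) - k * t1"
    proof (rule DERIV_nonneg_imp_nondecreasing[OF \<open>t0 \<le> t1\<close>, where f = "\<lambda>t. inverse (V t) - k * t"])
      fix x assume x: "t0 \<le> x" "x \<le> t1"
      have "((\<lambda>t. inverse (V t) - k * t) has_real_derivative - (V' x) / (V x)\<^sup>2 - k) (at x)"
        using pos[OF x] by (auto intro!: derivative_eq_intros deriv x simp: power2_eq_square field_simps)
      moreover have "- (V' x) / (V x)\<^sup>2 - k \<ge> 0"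
        using V'[OF x] pos[OF x] by (simp add: field_simps)
      ultimately show "\<exists>y. DERIV (\<lambda>t. inverse (V t) - k * t) x :> y \<and> y \<ge> 0" by blast
    qed
    then have "V t0 * V t1 * (inverse (V t0) + k * (t1 - t0)) \<le> V t0 * V t1 * inverse (V t1)"
      using pos[of t0] pos[of t1] \<open>t0 \<le> t1\<close> by (intro mult_left_mono) (auto simp: algebra_simps)
    moreover have "V t0 * V t1 * (inverse (V t0) + k * (t1 - t0)) = V t1 * (1 + k * V t0 * (t1 - t0))"
      "V t0 * V t1 * inverse (V t1) = V t0"
      using pos[of t0] pos[of t1] \<open>t0 \<le> t1\<close> by (simp_all add: field_simps)
    ultimately show ?thesis by simp
  qed
qed

text \<open>\<open>V\<close> need only satisfy its differential inequality while \<open>y\<close> is small: a first time at which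
  \<open>y\<close> reaches \<open>\<rho>\<close> is impossible because \<open>V\<close>, and with it \<open>y\<close> up to ten percent, decreases until then.\<close>

lemma perturbed_riccati_decay:
  fixes y V :: "real \<Rightarrow> real"
  assumes "\<rho> > 0" "k \<ge> 0"
    and cont: "continuous_on UNIV y" and nonneg: "\<And>t. y t \<ge> 0"
    and close: "\<And>t. y t \<le> \<rho> \<Longrightarrow> \<bar>V t - y t\<bar> \<le> y t / 10"
    and deriv: "\<And>t. y t \<le> \<rho> \<Longrightarrow> (V has_real_derivative V' t) (at t)"
    and V': "\<And>t. y t \<le> \<rho> \<Longrightarrow> V' t \<le> - k * (y t)\<^sup>2"
    and init: "y t0 \<le> \<rho> / 2" and t: "t0 \<le> t"
  shows "y t \<le> \<rho>" "y t \<le> 2 * y t0 / (1 + k / 2 * y t0 * (t - t0))"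
proof -
  \<comment> \<open>The factor 100/121 is the square of 10/11: as \<open>V\<close> is at most 11/10
    of \<open>y\<close>, the square of \<open>y\<close> is at least 100/121 of the square of
    \<open>V\<close>.\<close>
  have decay: "V t1 \<le> V t0" "V t1 * (1 + k * 100 / 121 * V t0 * (t1 - t0)) \<le> V t0"
    if small: "\<And>s. t0 \<le> s \<Longrightarrow> s \<le> t1 \<Longrightarrow> y s \<le> \<rho>" and "t0 \<le> t1" for t1
  proof -
    have V0: "V s \<ge> 0" if "t0 \<le> s" "s \<le> t1" for s
      using close[OF small[OF that]] nonneg[of s] by linarith
    have V2: "V' s \<le> - (k * 100 / 121) * (V s)\<^sup>2" if "t0 \<le> s" "s \<le> t1" for s
    proof -
      have "V s \<le> 11 / 10 * y s" using close[OF small[OF that]] by linarith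
      then have "(V s)\<^sup>2 \<le> (11 / 10 * y s)\<^sup>2" using V0[OF that] by (intro power_mono) auto
      then have "(V s)\<^sup>2 \<le> 121 / 100 * (y s)\<^sup>2" by (simp add: power_mult_distrib power2_eq_square)
      then have "k * (100 / 121 * (V s)\<^sup>2) \<le> k * (y s)\<^sup>2" using \<open>k \<ge> 0\<close> by (intro mult_left_mono) auto
      then show ?thesis using V'[OF small[OF that]] by simp
    qed
    show "V t1 \<le> V t0" "V t1 * (1 + k * 100 / 121 * V t0 * (t1 - t0)) \<le> V t0"
      using riccati_decay[OF \<open>t0 \<le> t1\<close>, of "k * 100 / 121" V V'] deriv small V0 V2 \<open>k \<ge> 0\<close> by auto
  qed
  have y_le: "y t1 \<le> \<rho>" if "t0 \<le> t1" for t1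
  proof (rule ccontr)
    assume "\<not> y t1 \<le> \<rho>"
    \<comment> \<open>The infimum of this closed set is the first time at which \<open>y\<close>
      equals \<open>\<rho>\<close>. By the intermediate value theorem, \<open>y\<close> cannot
      exceed \<open>\<rho>\<close> earlier.\<close>
    define S where "S = {t0..t1} \<inter> y -` {\<rho>}"
    have cl: "closed S" unfolding S_def
      by (rule continuous_closed_preimage[OF continuous_on_subset[OF cont]]) auto
    have "\<exists>s\<ge>t0. s \<le> t1 \<and> y s = \<rho>"
      by (rule IVT') (use \<open>\<not> y t1 \<le> \<rho>\<close> init \<open>\<rho> > 0\<close> that cont in \<open>auto intro: continuous_on_subset\<close>)
    then have ne: "S \<noteq> {}" unfolding S_def by auto
    have bdd: "bdd_below S" unfolding S_def by (rule bdd_belowI[of _ t0]) auto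
    define s where "s = Inf S"
    have s: "s \<in> S" unfolding s_def by (rule closed_contains_Inf[OF ne bdd cl])
    have small: "y x \<le> \<rho>" if x: "t0 \<le> x" "x \<le> s" for x
    proof (rule ccontr)
      assume gt: "\<not> y x \<le> \<rho>"
      have "\<exists>z\<ge>t0. z \<le> x \<and> y z = \<rho>"
        by (rule IVT') (use gt init \<open>\<rho> > 0\<close> x cont in \<open>auto intro: continuous_on_subset\<close>)
      then obtain z where z: "t0 \<le> z" "z \<le> x" "y z = \<rho>" by blast
      then have "z \<in> S" using x s by (auto simp: S_def)
      then have "s \<le> z" unfolding s_def by (rule cInf_lower[OF _ bdd])
      then have "x = z" using z x by simp
      then show False using gt z by simp
    qed
    have "V s \<le> V t0" using decay(1)[OF small] s by (auto simp: S_def)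
    moreover have "\<bar>V s - y s\<bar> \<le> y s / 10" "\<bar>V t0 - y t0\<bar> \<le> y t0 / 10" "y s = \<rho>"
      using close s small init \<open>\<rho> > 0\<close> by (auto simp: S_def)
    ultimately show False using init \<open>\<rho> > 0\<close> by (simp add: abs_if split: if_splits)
  qed
  show "y t \<le> \<rho>" by (rule y_le[OF t])
  have V1: "V t * (1 + k * 100 / 121 * V t0 * (t - t0)) \<le> V t0" by (rule decay(2)[OF y_le t])
  \<comment> \<open>The final constants: 100/121 times 9/10 is at least 1/2, which gives the rate
    \<open>k / 2\<close>, and 11/9 is at most 2.\<close>
  have Vt: "9 / 10 * y t \<le> V t" "9 / 10 * y t0 \<le> V t0" "V t0 \<le> 11 / 10 * y t0"
    using close[OF y_le[OF t]] close[OF y_le[of t0, OF order_refl]] by linarith+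
  have "k * (t - t0) * (y t0 / 2) \<le> k * (t - t0) * (100 / 121 * V t0)"
    using Vt(2) nonneg[of t0] \<open>k \<ge> 0\<close> t by (intro mult_left_mono) auto
  then have "1 + k / 2 * y t0 * (t - t0) \<le> 1 + k * 100 / 121 * V t0 * (t - t0)"
    by (simp add: mult_ac)
  moreover have pos: "1 + k / 2 * y t0 * (t - t0) > 0"
    using nonneg[of t0] \<open>k \<ge> 0\<close> t by (intro add_pos_nonneg mult_nonneg_nonneg) auto
  ultimately have "9 / 10 * y t * (1 + k / 2 * y t0 * (t - t0)) \<le> V t * (1 + k * 100 / 121 * V t0 * (t - t0))"
    using Vt nonneg[of t] by (intro mult_mono) auto
  also note V1
  finally have fin: "9 / 10 * y t * (1 + k / 2 * y t0 * (t - t0)) \<le> V t0" .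
  have "y t * (1 + k / 2 * y t0 * (t - t0)) \<le> 2 * y t0"
  proof -
    have "x \<le> 2 * y t0" if "9 / 10 * x \<le> V t0" for x
      using that Vt(3) nonneg[of t0] by linarith
    then show ?thesis
      using fin by (simp only: mult.assoc)
  qed
  then show "y t \<le> 2 * y t0 / (1 + k / 2 * y t0 * (t - t0))"
    using pos by (simp add: pos_le_divide_eq)
qed

text \<open>Increments of \<open>Z\<close> are bounded by those of \<open>g\<close>, which is
  nondecreasing and bounded, so the tails of \<open>g\<close> control those of
  \<open>Z\<close>.\<close>

lemma vector_derivative_le_imp_convergent:
  fixes Z :: "real \<Rightarrow> 'a::banach" and g :: "real \<Rightarrow> real"
  assumes Z: "\<And>t. t0 \<le> t \<Longrightarrow> (Z has_vector_derivative Z' t) (at t)"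
    and g: "\<And>t. t0 \<le> t \<Longrightarrow> (g has_real_derivative g' t) (at t)"
    and le: "\<And>t. t0 \<le> t \<Longrightarrow> norm (Z' t) \<le> g' t"
    and bd: "\<And>t. t0 \<le> t \<Longrightarrow> g t \<le> B"
  obtains q where "(Z \<longlongrightarrow> q) at_top"
proof -
  have diff: "norm (Z t - Z s) \<le> g t - g s" if "t0 \<le> s" "s \<le> t" for s t
  proof (cases "s = t")
    case False
    then have "s < t" using that by simp
    then show ?thesis
    proof (rule differentiable_bound_general[of s t Z g Z' g'])
      show "continuous_on {s..t} Z" "continuous_on {s..t} g"
        using that
        by (auto intro!: continuous_at_imp_continuous_on has_vector_derivative_continuous[OF Z] DERIV_isCont[OF g])
    qed (use Z g le that in \<open>auto simp: has_real_derivative_iff_has_vector_derivative\<close>)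
  qed simp
  define X where "X n = t0 + real n" for n
  have mono: "g s \<le> g t" if "t0 \<le> s" "s \<le> t" for s t
    using diff[OF that] norm_ge_zero[of "Z t - Z s"] by linarith
  have "incseq (\<lambda>n. g (X n))" unfolding incseq_def X_def by (auto intro: mono)
  then obtain L where L: "(\<lambda>n. g (X n)) \<longlonglongrightarrow> L" and gL: "\<And>n. g (X n) \<le> L"
    using incseq_convergent[of "\<lambda>n. g (X n)" B] bd by (auto simp: X_def)
  have gL': "g t \<le> L" if "t0 \<le> t" for t
  proof -
    obtain n where "t - t0 \<le> real n" using real_arch_simple by blast
    then have "g t \<le> g (X n)" using that by (intro mono) (auto simp: X_def)
    then show ?thesis using gL[of n] by simp
  qed
  have near: "\<exists>N. \<forall>t\<ge>X N. dist (Z t) (Z (X N)) < e" if "e > 0" for e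
  proof -
    have "\<forall>\<^sub>F n in sequentially. L - e < g (X n)" using L \<open>e > 0\<close> by (intro order_tendstoD) auto
    then obtain N where N: "L - e < g (X N)" by (auto simp: eventually_sequentially)
    have "dist (Z t) (Z (X N)) < e" if "t \<ge> X N" for t
      using diff[of "X N" t] gL'[of t] N that by (simp add: dist_norm X_def)
    then show ?thesis by blast
  qed
  have "Cauchy (\<lambda>n. Z (X n))"
    unfolding Cauchy_altdef2
  proof (intro allI impI)
    fix e :: real assume "e > 0"
    then obtain N where "\<forall>t\<ge>X N. dist (Z t) (Z (X N)) < e" using near by blast
    then show "\<exists>N. \<forall>n\<ge>N. dist (Z (X n)) (Z (X N)) < e"
      by (intro exI[of _ N]) (auto simp: X_def)
  qed
  then obtain q where q: "(\<lambda>n. Z (X n)) \<longlonglongrightarrow> q" using Cauchy_convergent_iff convergent_def by blast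
  have "(Z \<longlongrightarrow> q) at_top"
    unfolding tendsto_iff
  proof (intro allI impI)
    fix e :: real assume "e > 0"
    then obtain N where N: "\<forall>t\<ge>X N. dist (Z t) (Z (X N)) < e / 3" using near[of "e / 3"] by auto
    have "dist (Z (X N)) q \<le> e / 3"
    proof (rule LIMSEQ_le_const2[OF tendsto_dist[OF tendsto_const q]])
      show "\<exists>M. \<forall>n\<ge>M. dist (Z (X N)) (Z (X n)) \<le> e / 3"
        using N by (intro exI[of _ N]) (auto simp: X_def dist_commute less_imp_le)
    qed
    then have "dist (Z t) q < e" if "t \<ge> X N" for t
      using N that dist_triangle[of "Z t" q "Z (X N)"] \<open>e > 0\<close> by fastforce
    then show "\<forall>\<^sub>F t in at_top. dist (Z t) q < e"
      unfolding eventually_at_top_linorder by blast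
  qed
  then show thesis by (rule that)
qed

text \<open>The decay makes the derivative of \<open>Z\<close> of order (1 + \<kappa>(t -
  t0))^(-3/2) with \<kappa> = \<open>c * y t0\<close>. An antiderivative of this is a negative
  multiple of (1 + \<kappa>(t - t0))^(-1/2), hence bounded above by 0.\<close>

lemma cubic_decay_imp_convergent:
  fixes Z :: "real \<Rightarrow> 'a::banach" and y :: "real \<Rightarrow> real"
  assumes Z: "\<And>t. t0 \<le> t \<Longrightarrow> (Z has_vector_derivative Z' t) (at t)"
    and le: "\<And>t. t0 \<le> t \<Longrightarrow> norm (Z' t) \<le> M * (sqrt (y t)) ^ 3"
    and nonneg: "\<And>t. y t \<ge> 0" and "M \<ge> 0" "c > 0"
    and decay: "\<And>t. t0 \<le> t \<Longrightarrow> y t \<le> 2 * y t0 / (1 + c * y t0 * (t - t0))"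
  obtains q where "(Z \<longlongrightarrow> q) at_top"
proof (cases "y t0 = 0")
  \<comment> \<open>Here \<kappa> would be 0 and the majorant undefined, but \<open>y\<close> stays
    0 and \<open>Z\<close> is constant from \<open>t0\<close> on.\<close>
  case True
  then have "y t = 0" if "t0 \<le> t" for t using decay[OF that] nonneg[of t] by simp
  then have "norm (Z' t) \<le> 0" if "t0 \<le> t" for t using le[OF that] that by simp
  then show thesis
    using vector_derivative_le_imp_convergent[of t0 Z Z' "\<lambda>_. 0" "\<lambda>_. 0" 0] Z that by auto
next
  case False
  define \<kappa> where "\<kappa> = c * y t0"
  have \<kappa>: "\<kappa> > 0" using False nonneg[of t0] \<open>c > 0\<close> by (simp add: \<kappa>_def)
  define K where "K = M * (sqrt (2 * y t0)) ^ 3"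
  have K: "K \<ge> 0" using nonneg[of t0] \<open>M \<ge> 0\<close> by (simp add: K_def)
  define s where "s t = 1 + \<kappa> * (t - t0)" for t
  have s: "s t > 0" if "t0 \<le> t" for t
    using \<kappa> that by (simp add: s_def add_pos_nonneg)
  show thesis
  proof (rule vector_derivative_le_imp_convergent[OF Z])
    fix t assume t: "t0 \<le> t"
    have "(s has_real_derivative \<kappa>) (at t)"
      unfolding s_def by (auto intro!: derivative_eq_intros)
    then have "((\<lambda>t. sqrt (s t)) has_real_derivative inverse (sqrt (s t)) / 2 * \<kappa>) (at t)"
      by (rule DERIV_chain2[where f = sqrt and g = s, OF DERIV_real_sqrt[OF s[OF t]]])
    from DERIV_divide[OF DERIV_const this, of "- (2 * K / \<kappa>)"]
    have "((\<lambda>t. - (2 * K / \<kappa>) / sqrt (s t)) has_real_derivative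
        (0 * sqrt (s t) - - (2 * K / \<kappa>) * (inverse (sqrt (s t)) / 2 * \<kappa>)) / (sqrt (s t) * sqrt (s t))) (at t)"
      using s[OF t] by simp
    moreover have "(0 * x - - (2 * K / \<kappa>) * (inverse x / 2 * \<kappa>)) / (x * x) = K / x ^ 3" if "x > 0" for x
      using that \<kappa> by (simp add: field_simps power3_eq_cube)
    ultimately show "((\<lambda>t. - (2 * K / \<kappa>) / sqrt (s t)) has_real_derivative K / (sqrt (s t)) ^ 3) (at t)"
      using s[OF t] by (metis real_sqrt_gt_zero)
    have "sqrt (y t) \<le> sqrt (2 * y t0 / s t)"
      using decay[OF t] by (simp add: s_def \<kappa>_def)
    then have "(sqrt (y t)) ^ 3 \<le> (sqrt (2 * y t0) / sqrt (s t)) ^ 3"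
      using nonneg by (intro power_mono) (auto simp: real_sqrt_divide)
    then show "norm (Z' t) \<le> K / (sqrt (s t)) ^ 3"
      using le[OF t] \<open>M \<ge> 0\<close> mult_left_mono[of _ _ M]
      by (fastforce simp: K_def power_divide)
    show "- (2 * K / \<kappa>) / sqrt (s t) \<le> 0"
      using K \<kappa> s[OF t] by simp
  qed (use that in auto)
qed

section \<open>Second-order averaging\<close>

text \<open>The product splits into waves at the sum and at the difference of the frequencies. For
  equal frequencies the second one degenerates to a constant, the mean value that is subtracted; a
  wave of nonzero frequency has a bounded antiderivative.\<close>

lemma sinusoid_product_antiderivative:
  fixes \<alpha> \<beta> \<phi> \<theta> :: real
  assumes "\<alpha> > 0" "\<beta> > 0"
  obtains W M where
    "\<And>t. (W has_real_derivative sin (\<alpha> * t + \<phi>) * cos (\<beta> * t + \<theta>)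
        - (if \<alpha> = \<beta> then sin (\<phi> - \<theta>) / 2 else 0)) (at t)"
    "\<And>t. \<bar>W t\<bar> \<le> M"
proof
  define W1 where "W1 t = - cos ((\<alpha> + \<beta>) * t + (\<phi> + \<theta>)) / (2 * (\<alpha> + \<beta>))" for t
  define W2 where "W2 t = (if \<alpha> = \<beta> then 0 else - cos ((\<alpha> - \<beta>) * t + (\<phi> - \<theta>)) / (2 * (\<alpha> - \<beta>)))" for t
  have W: "((\<lambda>t. - cos (a * t + x) / (2 * a)) has_real_derivative sin (a * t + x) / 2) (at t)"
    if "a \<noteq> 0" for a x t :: real
    using that by (auto intro!: derivative_eq_intros simp: field_simps)
  have "(W1 has_real_derivative sin ((\<alpha> + \<beta>) * t + (\<phi> + \<theta>)) / 2) (at t)" for t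
    unfolding W1_def using assms by (intro W) simp
  moreover have "(W2 has_real_derivative (if \<alpha> = \<beta> then 0 else sin ((\<alpha> - \<beta>) * t + (\<phi> - \<theta>)) / 2)) (at t)" for t
    unfolding W2_def using W[of "\<alpha> - \<beta>"] by simp
  ultimately have "((\<lambda>t. W1 t + W2 t) has_real_derivative sin ((\<alpha> + \<beta>) * t + (\<phi> + \<theta>)) / 2
     + (if \<alpha> = \<beta> then 0 else sin ((\<alpha> - \<beta>) * t + (\<phi> - \<theta>)) / 2)) (at t)" for t
    by (rule DERIV_add)
  moreover have "sin ((\<alpha> + \<beta>) * t + (\<phi> + \<theta>)) / 2
     + (if \<alpha> = \<beta> then 0 else sin ((\<alpha> - \<beta>) * t + (\<phi> - \<theta>)) / 2)
     = sin (\<alpha> * t + \<phi>) * cos (\<beta> * t + \<theta>) - (if \<alpha> = \<beta> then sin (\<phi> - \<theta>) / 2 else 0)" for t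
  proof -
    have 1: "(\<alpha> + \<beta>) * t + (\<phi> + \<theta>) = (\<alpha> * t + \<phi>) + (\<beta> * t + \<theta>)"
      and 2: "(\<alpha> - \<beta>) * t + (\<phi> - \<theta>) = (\<alpha> * t + \<phi>) - (\<beta> * t + \<theta>)" by (simp_all add: algebra_simps)
    have 3: "\<phi> - \<theta> = (\<alpha> * t + \<phi>) - (\<beta> * t + \<theta>)" if "\<alpha> = \<beta>" using that by simp
    show ?thesis
      unfolding 1 2 sin_times_cos using 3 by (cases "\<alpha> = \<beta>") (simp_all add: add_divide_distrib)
  qed
  ultimately show "((\<lambda>t. W1 t + W2 t) has_real_derivative sin (\<alpha> * t + \<phi>) * cos (\<beta> * t + \<theta>)
        - (if \<alpha> = \<beta> then sin (\<phi> - \<theta>) / 2 else 0)) (at t)" for t by simp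
  have b: "\<bar>- cos x / a\<bar> \<le> \<bar>1 / a\<bar>" for x a :: real
    by (simp add: abs_divide divide_right_mono)
  have "\<bar>W1 t\<bar> \<le> \<bar>1 / (2 * (\<alpha> + \<beta>))\<bar>" for t unfolding W1_def by (rule b)
  moreover have "\<bar>W2 t\<bar> \<le> \<bar>1 / (2 * (\<alpha> - \<beta>))\<bar>" for t unfolding W2_def using b by simp
  ultimately show "\<bar>W1 t + W2 t\<bar> \<le> \<bar>1 / (2 * (\<alpha> + \<beta>))\<bar> + \<bar>1 / (2 * (\<alpha> - \<beta>))\<bar>" for t
    by (meson abs_triangle_ineq add_mono order_trans)
qed

lemma has_real_derivative_along:
  fixes \<gamma> :: "real \<Rightarrow> 'x::real_normed_vector" and g :: "'x \<Rightarrow> real"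
  assumes \<gamma>: "(\<gamma> has_vector_derivative (\<Sum>a\<in>A. r a *\<^sub>R e a)) (at t)"
    and g: "(g has_derivative g') (at (\<gamma> t))"
  shows "((\<lambda>t. g (\<gamma> t)) has_real_derivative (\<Sum>a\<in>A. r a * g' (e a))) (at t)"
proof -
  have lin: "linear g'" using g by (rule has_derivative_linear)
  have "((\<lambda>t. g (\<gamma> t)) has_derivative (\<lambda>h. g' (h *\<^sub>R (\<Sum>a\<in>A. r a *\<^sub>R e a)))) (at t)"
    using has_derivative_compose[OF \<gamma>[unfolded has_vector_derivative_def] g] .
  moreover have "(\<lambda>h. g' (h *\<^sub>R (\<Sum>a\<in>A. r a *\<^sub>R e a))) = (*) (\<Sum>a\<in>A. r a * g' (e a))"
    by (rule ext) (simp add: linear_scale[OF lin] linear_sum[OF lin] mult.commute)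
  ultimately show ?thesis
    unfolding has_field_derivative_def by simp
qed

text \<open>Integrating the oscillating terms by parts twice leaves the averaged second-order term and a
  third-order remainder.\<close>

lemma second_order_averaging:
  fixes \<gamma> :: "real \<Rightarrow> 'x::real_normed_vector" and f :: "'a \<Rightarrow> 'x \<Rightarrow> real"
  assumes \<gamma>: "(\<gamma> has_vector_derivative (\<Sum>a\<in>A. (u a t * f a (\<gamma> t)) *\<^sub>R e a)) (at t)"
    and U: "\<And>a. (U a has_real_derivative u a t) (at t)"
    and W: "\<And>a b. (W a b has_real_derivative (U a t * u b t - m a b)) (at t)"
    and V: "(V has_derivative V') (at (\<gamma> t))" "\<And>a. f a (\<gamma> t) * V' (e a) = F a (\<gamma> t)"
    and F: "\<And>a. (F a has_derivative F' a) (at (\<gamma> t))" "\<And>a b. f b (\<gamma> t) * F' a (e b) = G a b (\<gamma> t)"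
    and G: "\<And>a b. (G a b has_derivative G' a b) (at (\<gamma> t))"
  shows "((\<lambda>t. V (\<gamma> t) - (\<Sum>a\<in>A. U a t * F a (\<gamma> t)) + (\<Sum>a\<in>A. \<Sum>b\<in>A. W a b t * G a b (\<gamma> t)))
     has_real_derivative
       (\<Sum>a\<in>A. \<Sum>b\<in>A. W a b t * (\<Sum>c\<in>A. u c t * f c (\<gamma> t) * G' a b (e c)))
       - (\<Sum>a\<in>A. \<Sum>b\<in>A. m a b * G a b (\<gamma> t))) (at t)"
proof -
  have V1: "((\<lambda>t. V (\<gamma> t)) has_real_derivative (\<Sum>a\<in>A. u a t * F a (\<gamma> t))) (at t)"
    using has_real_derivative_along[OF \<gamma> V(1)] by (simp add: mult.assoc V(2))
  have F1: "((\<lambda>t. F a (\<gamma> t)) has_real_derivative (\<Sum>b\<in>A. u b t * G a b (\<gamma> t))) (at t)" for a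
    using has_real_derivative_along[OF \<gamma> F(1), of a] by (simp add: mult.assoc F(2))
  note G1 = has_real_derivative_along[OF \<gamma> G]
  have "((\<lambda>t. V (\<gamma> t) - (\<Sum>a\<in>A. U a t * F a (\<gamma> t)) + (\<Sum>a\<in>A. \<Sum>b\<in>A. W a b t * G a b (\<gamma> t)))
     has_real_derivative (\<Sum>a\<in>A. u a t * F a (\<gamma> t))
       - (\<Sum>a\<in>A. u a t * F a (\<gamma> t) + (\<Sum>b\<in>A. u b t * G a b (\<gamma> t)) * U a t)
       + (\<Sum>a\<in>A. \<Sum>b\<in>A. (U a t * u b t - m a b) * G a b (\<gamma> t)
           + (\<Sum>c\<in>A. u c t * f c (\<gamma> t) * G' a b (e c)) * W a b t)) (at t)"
    by (intro DERIV_add DERIV_diff DERIV_sum DERIV_mult U V1 F1 G1 W)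
  moreover have "(\<Sum>a\<in>A. u a t * F a (\<gamma> t))
       - (\<Sum>a\<in>A. u a t * F a (\<gamma> t) + (\<Sum>b\<in>A. u b t * G a b (\<gamma> t)) * U a t)
       + (\<Sum>a\<in>A. \<Sum>b\<in>A. (U a t * u b t - m a b) * G a b (\<gamma> t)
           + (\<Sum>c\<in>A. u c t * f c (\<gamma> t) * G' a b (e c)) * W a b t)
     = (\<Sum>a\<in>A. \<Sum>b\<in>A. W a b t * (\<Sum>c\<in>A. u c t * f c (\<gamma> t) * G' a b (e c)))
       - (\<Sum>a\<in>A. \<Sum>b\<in>A. m a b * G a b (\<gamma> t))"
  proof -
    have "(\<Sum>a\<in>A. \<Sum>b\<in>A. (U a t * u b t - m a b) * G a b (\<gamma> t))
        = (\<Sum>a\<in>A. U a t * (\<Sum>b\<in>A. u b t * G a b (\<gamma> t))) - (\<Sum>a\<in>A. \<Sum>b\<in>A. m a b * G a b (\<gamma> t))"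
      by (simp add: sum_subtractf sum_distrib_left left_diff_distrib mult.assoc)
    then show ?thesis by (simp add: sum.distrib mult.commute)
  qed
  ultimately show ?thesis by simp
qed

text \<open>One integration by parts for the position itself. In the velocity that remains, each
  field is multiplied by a derivative of another one, which gains an order of smallness.\<close>

lemma first_order_averaging:
  fixes \<gamma> :: "real \<Rightarrow> 'x::real_normed_vector" and f :: "'a \<Rightarrow> 'x \<Rightarrow> real"
  assumes \<gamma>: "(\<gamma> has_vector_derivative (\<Sum>a\<in>A. (u a t * f a (\<gamma> t)) *\<^sub>R e a)) (at t)"
    and U: "\<And>a. (U a has_real_derivative u a t) (at t)"
    and f: "\<And>a. (f a has_derivative f' a) (at (\<gamma> t))"
  shows "((\<lambda>t. \<gamma> t - (\<Sum>a\<in>A. (U a t * f a (\<gamma> t)) *\<^sub>R e a)) has_vector_derivative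
      - (\<Sum>a\<in>A. (U a t * (\<Sum>b\<in>A. u b t * f b (\<gamma> t) * f' a (e b))) *\<^sub>R e a)) (at t)"
proof -
  note f1 = has_real_derivative_along[OF \<gamma> f]
  have "((\<lambda>t. \<gamma> t - (\<Sum>a\<in>A. (U a t * f a (\<gamma> t)) *\<^sub>R e a)) has_vector_derivative
      (\<Sum>a\<in>A. (u a t * f a (\<gamma> t)) *\<^sub>R e a)
      - (\<Sum>a\<in>A. (u a t * f a (\<gamma> t) + (\<Sum>b\<in>A. u b t * f b (\<gamma> t) * f' a (e b)) * U a t) *\<^sub>R e a)) (at t)"
  proof (intro has_vector_derivative_diff \<gamma> has_vector_derivative_sum)
    fix a
    show "((\<lambda>t. (U a t * f a (\<gamma> t)) *\<^sub>R e a) has_vector_derivative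
      (u a t * f a (\<gamma> t) + (\<Sum>b\<in>A. u b t * f b (\<gamma> t) * f' a (e b)) * U a t) *\<^sub>R e a) (at t)"
      using has_vector_derivative_scaleR[OF DERIV_mult[OF U f1] has_vector_derivative_const, of a a "e a"]
      by simp
  qed
  then show ?thesis
    by (simp add: scaleR_add_left sum.distrib mult.commute)
qed

section \<open>The vector fields near the realizations\<close>

text \<open>Turns the one-sided conditions at 0 into bounds with one constant on one interval;
  halving the radius closes it on the right. The point 0 is included for \<open>h\<close>, since
  \<open>h 0 = 0\<close>, but not for the derivatives.\<close>

lemma admissible_h_bounds:
  assumes "admissible_h h"
  obtains K r where "K > 0" "r > 0" "\<And>y. 0 \<le> y \<Longrightarrow> y \<le> r \<Longrightarrow> \<bar>h y\<bar> \<le> K * y"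
    "\<And>y. 0 < y \<Longrightarrow> y \<le> r \<Longrightarrow> \<bar>deriv h y\<bar> \<le> K"
    "\<And>y. 0 < y \<Longrightarrow> y \<le> r \<Longrightarrow> \<bar>deriv (deriv h) y\<bar> * y \<le> K"
proof -
  have ev: "\<exists>K>0. \<exists>r>0. \<forall>y>0. y < r \<longrightarrow> \<bar>g y\<bar> \<le> K" if "Bfun g (at_right 0)" for g :: "real \<Rightarrow> real"
    using that unfolding Bfun_def eventually_at_right_field by auto
  obtain K1 r1 where 1: "K1 > 0" "r1 > 0" "\<And>y. y > 0 \<Longrightarrow> y < r1 \<Longrightarrow> \<bar>h y / y\<bar> \<le> K1"
    using ev[of "\<lambda>y. h y / y"] assms unfolding admissible_h_def by blast
  obtain K2 r2 where 2: "K2 > 0" "r2 > 0" "\<And>y. y > 0 \<Longrightarrow> y < r2 \<Longrightarrow> \<bar>deriv h y\<bar> \<le> K2"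
    using ev[of "deriv h"] assms unfolding admissible_h_def by blast
  obtain K3 r3 where 3: "K3 > 0" "r3 > 0" "\<And>y. y > 0 \<Longrightarrow> y < r3 \<Longrightarrow> \<bar>deriv (deriv h) y * y\<bar> \<le> K3"
    using ev[of "\<lambda>y. deriv (deriv h) y * y"] assms unfolding admissible_h_def by blast
  show thesis
  proof (rule that[of "K1 + K2 + K3" "min r1 (min r2 r3) / 2"])
    show "\<bar>h y\<bar> \<le> (K1 + K2 + K3) * y" if "0 \<le> y" "y \<le> min r1 (min r2 r3) / 2" for y
    proof (cases "y = 0")
      case True
      then show ?thesis using assms by (simp add: admissible_h_def)
    next
      case False
      then have "\<bar>h y / y\<bar> \<le> K1 + K2 + K3" using 1(3)[of y] 1(1,2) 2(1,2) 3(1,2) that by force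
      then show ?thesis using False that by (simp add: abs_divide pos_divide_le_eq)
    qed
    show "\<bar>deriv h y\<bar> \<le> K1 + K2 + K3" if "0 < y" "y \<le> min r1 (min r2 r3) / 2" for y
      using 2(3)[of y] 1(1,2) 2(1,2) 3(1,2) that by force
    show "\<bar>deriv (deriv h) y\<bar> * y \<le> K1 + K2 + K3" if "0 < y" "y \<le> min r1 (min r2 r3) / 2" for y
      using 3(3)[of y] 1(1,2) 2(1,2) 3(1,2) that by (force simp: abs_mult)
  qed (use 1 2 3 in auto)
qed

text \<open>The nonnegative \<open>Y\<close> has a minimum at \<open>p\<close>, so its derivative
  vanishes there and \<open>Y q\<close> is of smaller order than \<open>norm (q - p)\<close>;
  \<open>Q\<close> inherits this. It replaces the chain rule where \<open>h\<close> is not known to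
  be smooth.\<close>

lemma has_derivative_zero_dominated:
  fixes Q Y :: "'a::real_normed_vector \<Rightarrow> real"
  assumes Y: "(Y has_derivative Y') (at p)" and nonneg: "\<And>q. Y q \<ge> 0" and "Y p = 0"
    and dom: "\<forall>\<^sub>F q in nhds p. \<bar>Q q\<bar> \<le> C * Y q"
  shows "(Q has_derivative (\<lambda>_. 0)) (at p)"
proof -
  have "Y' = (\<lambda>_. 0)"
    by (rule differential_zero_maxmin[OF UNIV_I open_UNIV Y]) (use nonneg \<open>Y p = 0\<close> in auto)
  then have lim: "((\<lambda>q. norm (Y q) / norm (q - p)) \<longlongrightarrow> 0) (at p)"
    using Y \<open>Y p = 0\<close> by (simp add: has_derivative_iff_norm)
  have Q0: "Q p = 0" using eventually_nhds_x_imp_x[OF dom] \<open>Y p = 0\<close> by simp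
  have "((\<lambda>q. norm (Q q) / norm (q - p)) \<longlongrightarrow> 0) (at p)"
  proof (rule Lim_null_comparison)
    show "((\<lambda>q. C * (norm (Y q) / norm (q - p))) \<longlongrightarrow> 0) (at p)"
      using tendsto_mult_right_zero[OF lim] .
    have "\<forall>\<^sub>F q in at p. \<bar>Q q\<bar> \<le> C * Y q"
      using dom by (simp add: eventually_nhds_conv_at)
    then show "\<forall>\<^sub>F q in at p. norm (norm (Q q) / norm (q - p)) \<le> C * (norm (Y q) / norm (q - p))"
      by eventually_elim (use nonneg in \<open>simp add: divide_right_mono\<close>)
  qed
  then show ?thesis by (simp add: has_derivative_iff_norm Q0)
qed

text \<open>At a zero of \<open>Y\<close> the value \<open>deriv h 0\<close> may be junk, but it is multiplied by \<open>Y' = 0\<close>.\<close>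

lemma admissible_h_comp_has_derivative:
  fixes Y :: "'a::real_normed_vector \<Rightarrow> real"
  assumes h: "admissible_h h" and Y: "(Y has_derivative Y') (at p)" and nonneg: "\<And>q. Y q \<ge> 0"
  shows "((\<lambda>q. h (Y q)) has_derivative (\<lambda>v. deriv h (Y p) * Y' v)) (at p)"
proof (cases "Y p = 0")
  case False
  then have "Y p > 0" using nonneg[of p] by simp
  then have "(h has_real_derivative deriv h (Y p)) (at (Y p))"
    using h by (simp add: admissible_h_def field_differentiable_derivI)
  then show ?thesis
    using has_derivative_compose[OF Y] by (simp add: has_field_derivative_def)
next
  case True
  have Y'0: "Y' = (\<lambda>_. 0)"
    by (rule differential_zero_maxmin[OF UNIV_I open_UNIV Y]) (use nonneg True in auto)
  obtain K r where K: "r > 0" "\<And>y. 0 \<le> y \<Longrightarrow> y \<le> r \<Longrightarrow> \<bar>h y\<bar> \<le> K * y"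
    using admissible_h_bounds[OF h] by metis
  have "(Y \<longlongrightarrow> Y p) (at p)" using has_derivative_continuous[OF Y] by (simp add: isCont_def)
  then have "\<forall>\<^sub>F q in at p. Y q < r" using K(1) True by (intro order_tendstoD) auto
  then have "\<forall>\<^sub>F q in nhds p. Y q < r" using K(1) True by (simp add: eventually_nhds_conv_at)
  then have "\<forall>\<^sub>F q in nhds p. \<bar>h (Y q)\<bar> \<le> K * Y q"
    by eventually_elim (use K(2) nonneg in simp)
  from has_derivative_zero_dominated[OF Y nonneg True this]
  show ?thesis by (simp add: Y'0)
qed

text \<open>With \<open>X\<^bsub>i,v\<^esub> = h(\<psi>\<^sub>i) v\<close>, where \<open>v\<close> moves agent \<open>i\<close> only, \<open>scaled_d1\<close> is the Lie derivative of
  the global potential along \<open>X\<^bsub>i,v\<^esub>\<close>; \<open>scaled_d2\<close> and \<open>scaled_d3\<close> are its first two derivatives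
  (the second at points where it exists).\<close>

definition scaled_d1 where
  "scaled_d1 h E d i v (p::real^'n^'v::finite) = h (local_pot E d i p) * local_pot_d1 E d i p v"

definition scaled_d2 where
  "scaled_d2 h E d i v w (p::real^'n^'v::finite) =
     deriv h (local_pot E d i p) * local_pot_d1 E d i p w * local_pot_d1 E d i p v
     + h (local_pot E d i p) * local_pot_d2 E d i p v w"

definition scaled_d3 where
  "scaled_d3 h E d i v w (p::real^'n^'v::finite) x =
     deriv (deriv h) (local_pot E d i p) * local_pot_d1 E d i p x * local_pot_d1 E d i p w * local_pot_d1 E d i p v
     + deriv h (local_pot E d i p) *
         (local_pot_d2 E d i p w x * local_pot_d1 E d i p v + local_pot_d1 E d i p w * local_pot_d2 E d i p v x)
     + deriv h (local_pot E d i p) * local_pot_d1 E d i p x * local_pot_d2 E d i p v w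
     + h (local_pot E d i p) * local_pot_d3 E i p v w x"

lemma scaled_d1_has_derivative:
  fixes p :: "real^'n^'v::finite"
  assumes "admissible_h h"
  shows "(scaled_d1 h E d i v has_derivative (\<lambda>w. scaled_d2 h E d i v w p)) (at p)"
proof -
  note comp = admissible_h_comp_has_derivative[OF assms local_pot_has_derivative local_pot_nonneg]
  show ?thesis
    unfolding scaled_d1_def[abs_def] scaled_d2_def[abs_def]
    using has_derivative_mult[OF comp local_pot_d1_has_derivative]
    by (rule has_derivative_eq_rhs) (auto simp: algebra_simps)
qed

section \<open>Orders of magnitude of the Lie derivatives near the realizations\<close>

lemma local_pot_derivative_bounds:
  fixes E :: "'v::finite set set"
  assumes E: "\<forall>e\<in>E. card e = 2" and con: "\<And>a b. (a, b) \<in> {(i, j). {i, j} \<in> E}\<^sup>*"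
  obtains C where "C > 0" "\<And>i (p::real^'n^'v) v w x. global_pot E d p \<le> 1 \<Longrightarrow> norm v \<le> 1 \<Longrightarrow> norm w \<le> 1 \<Longrightarrow> norm x \<le> 1
     \<Longrightarrow> \<bar>local_pot_d1 E d i p v\<bar> \<le> C * sqrt (local_pot E d i p) \<and> \<bar>local_pot_d2 E d i p v w\<bar> \<le> C \<and>
         \<bar>local_pot_d3 E i p v w x\<bar> \<le> C"
proof -
  obtain K where K: "\<And>(p::real^'n^'v) i j. global_pot E d p \<le> 1 \<Longrightarrow> norm (p $ j - p $ i) \<le> K"
    using bounded_diff_of_connected[OF E con] by blast
  define N where "N = real CARD('v)"
  have N: "N \<ge> 1" by (simp add: N_def Suc_le_eq)
  define K' where "K' = \<bar>K\<bar> + 1"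
  define C where "C = N * (4 * K' + (8 * K' * K' + 16) + 48 * K')"
  have K': "K' \<ge> 1" by (simp add: K'_def)
  show thesis
  proof (rule that[of C])
    show "C > 0" using N K' unfolding C_def by (intro mult_pos_pos add_pos_pos add_nonneg_pos) auto
    fix i and p v w x :: "real^'n^'v"
    assume p: "global_pot E d p \<le> 1" and n: "norm v \<le> 1" "norm w \<le> 1" "norm x \<le> 1"
    have comp: "norm (y $ j - y $ i) \<le> 2" if "norm y \<le> 1" for y :: "real^'n^'v" and j
      using norm_triangle_ineq4[of "y $ j" "y $ i"] Finite_Cartesian_Product.norm_nth_le[of y j] Finite_Cartesian_Product.norm_nth_le[of y i] that by linarith
    have inn: "\<bar>a \<bullet> b\<bar> \<le> A * B" if "norm a \<le> A" "norm b \<le> B" for a b :: "real^'n" and A B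
      using Cauchy_Schwarz_ineq2[of a b] mult_mono[OF that] norm_ge_zero
      by (smt (verit) that)
    have pd: "norm (p $ j - p $ i) \<le> K'" for j using K[OF p, of j i] by (simp add: K'_def)
    have pi: "\<bar>(p $ j - p $ i) \<bullet> (y $ j - y $ i)\<bar> \<le> 2 * K'" if "norm y \<le> 1" for y :: "real^'n^'v" and j
      using inn[OF pd[of j] comp[OF that, of j]] by simp
    have ii: "\<bar>(y $ j - y $ i) \<bullet> (z $ j - z $ i)\<bar> \<le> 4" if "norm y \<le> 1" "norm z \<le> 1" for y z :: "real^'n^'v" and j
      using inn[OF comp[OF that(1), of j] comp[OF that(2), of j]] by simp
    have mm: "\<bar>a * b\<bar> \<le> A * B" if "\<bar>a\<bar> \<le> A" "\<bar>b\<bar> \<le> B" for a b A B :: real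
      unfolding abs_mult using that by (intro mult_mono) auto
    have sb: "\<bar>\<Sum>j\<in>S. g j\<bar> \<le> N * c" if "\<And>j. j \<in> S \<Longrightarrow> \<bar>g j\<bar> \<le> c" "c \<ge> 0" for S :: "'v set" and g and c :: real
    proof -
      have "\<bar>\<Sum>j\<in>S. g j\<bar> \<le> (\<Sum>j\<in>S. \<bar>g j\<bar>)" by (rule sum_abs)
      also have "\<dots> \<le> of_nat (card S) * c" using that by (intro sum_bounded_above) auto
      also have "\<dots> \<le> N * c" unfolding N_def using that(2) by (intro mult_right_mono) (auto intro: card_mono)
      finally show ?thesis .
    qed
    have Pi: "local_pot E d i p \<le> 2" using local_pot_le_global_pot[OF E, of d i p] p by linarith
    have le4: "\<bar>length_err d i j p\<bar> \<le> 4" if "{i, j} \<in> E" for j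
    proof -
      have "sqrt (local_pot E d i p) \<le> sqrt 4" using Pi by (intro real_sqrt_le_mono) simp
      then show ?thesis using abs_length_err_le[OF that, of d p] by simp
    qed
    \<comment> \<open>The square root comes from \<open>length_err\<close>. Higher derivatives
      contain terms that have lost this factor and are merely bounded.\<close>
    have "\<bar>local_pot_d1 E d i p v\<bar> \<le> N * (2 * sqrt (local_pot E d i p) * (2 * K'))"
      unfolding local_pot_d1_def using K' local_pot_nonneg[of E d i p]
      by (intro sb mm pi n abs_length_err_le mult_nonneg_nonneg) auto
    also have "\<dots> = (N * (4 * K')) * sqrt (local_pot E d i p)" by simp
    also have "\<dots> \<le> C * sqrt (local_pot E d i p)"
      unfolding C_def using N K' local_pot_nonneg[of E d i p] by (intro mult_right_mono mult_left_mono) auto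
    finally have 1: "\<bar>local_pot_d1 E d i p v\<bar> \<le> C * sqrt (local_pot E d i p)" .
    have "\<bar>local_pot_d2 E d i p v w\<bar> \<le> N * (2 * (2 * K') * (2 * K') + 4 * 4)"
      unfolding local_pot_d2_def using K'
      by (intro sb order_trans[OF abs_triangle_ineq] add_mono mm pi ii n le4) auto
    also have "\<dots> \<le> C" unfolding C_def using N K' by (intro mult_left_mono) (auto simp: algebra_simps)
    finally have 2: "\<bar>local_pot_d2 E d i p v w\<bar> \<le> C" .
    have "\<bar>local_pot_d3 E i p v w x\<bar> \<le> N * (2 * 4 * (2 * K') + 2 * (2 * K') * 4 + 2 * (2 * K') * 4)"
      unfolding local_pot_d3_def using K'
      by (intro sb order_trans[OF abs_triangle_ineq] add_mono mm pi ii n) auto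
    also have "\<dots> \<le> C" unfolding C_def using N K' by (intro mult_left_mono) (auto simp: algebra_simps)
    finally show "\<bar>local_pot_d1 E d i p v\<bar> \<le> C * sqrt (local_pot E d i p) \<and> \<bar>local_pot_d2 E d i p v w\<bar> \<le> C \<and>
         \<bar>local_pot_d3 E i p v w x\<bar> \<le> C" using 1 2 by simp
  qed
qed

text \<open>Order counting in z = \<open>sqrt (local_pot E d i p)\<close>: \<open>h\<close> has
  order 2, its first two derivatives have orders 0 and -2, the first derivative of the local
  potential has order 1, and the higher ones have order 0. The critical term of
  \<open>scaled_d3\<close>, with the second derivative of \<open>h\<close> and three first
  derivatives, has order -2 + 3 = 1.\<close>

lemma scaled_bounds:
  fixes E :: "'v::finite set set"
  assumes E: "\<forall>e\<in>E. card e = 2" and con: "\<And>a b. (a, b) \<in> {(i, j). {i, j} \<in> E}\<^sup>*"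
    and h: "admissible_h h"
  obtains M \<rho> where "M > 0" "\<rho> > 0" "\<rho> < 1"
    "\<And>i (p::real^'n^'v) v w x. global_pot E d p \<le> \<rho> \<Longrightarrow> norm v \<le> 1 \<Longrightarrow> norm w \<le> 1 \<Longrightarrow> norm x \<le> 1 \<Longrightarrow>
       \<bar>h (local_pot E d i p)\<bar> \<le> M * local_pot E d i p \<and>
       \<bar>deriv h (local_pot E d i p) * local_pot_d1 E d i p v\<bar> \<le> M * sqrt (local_pot E d i p) \<and>
       \<bar>scaled_d1 h E d i v p\<bar> \<le> M * (sqrt (local_pot E d i p)) ^ 3 \<and>
       \<bar>scaled_d2 h E d i v w p\<bar> \<le> M * local_pot E d i p \<and>
       \<bar>scaled_d3 h E d i v w p x\<bar> \<le> M * sqrt (local_pot E d i p)"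
proof -
  obtain C where C: "C > 0" "\<And>i (p::real^'n^'v) v w x. global_pot E d p \<le> 1 \<Longrightarrow> norm v \<le> 1 \<Longrightarrow> norm w \<le> 1 \<Longrightarrow> norm x \<le> 1
     \<Longrightarrow> \<bar>local_pot_d1 E d i p v\<bar> \<le> C * sqrt (local_pot E d i p) \<and> \<bar>local_pot_d2 E d i p v w\<bar> \<le> C \<and>
         \<bar>local_pot_d3 E i p v w x\<bar> \<le> C"
    using local_pot_derivative_bounds[OF E con] by blast
  obtain K r where K: "K > 0" "r > 0" "\<And>y. 0 \<le> y \<Longrightarrow> y \<le> r \<Longrightarrow> \<bar>h y\<bar> \<le> K * y"
    "\<And>y. 0 < y \<Longrightarrow> y \<le> r \<Longrightarrow> \<bar>deriv h y\<bar> \<le> K"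
    "\<And>y. 0 < y \<Longrightarrow> y \<le> r \<Longrightarrow> \<bar>deriv (deriv h) y\<bar> * y \<le> K"
    using admissible_h_bounds[OF h] by blast
  define M where "M = K + K * C + K * C * C + (K * C * C * C + (K * (C * C + C * C) + K * C * C)) + 2 * (K * C)"
  show thesis
  proof (rule that[of M "min (1/2) (r / 2)"])
    have KC: "K * C > 0" "K * C * C > 0" "K * C * C * C > 0" using K(1) C(1) by simp_all
    have Mle: "K \<le> M" "K * C \<le> M" "K * C * C + K * C \<le> M"
      "K * C * C * C + (K * (C * C + C * C) + K * C * C) + 2 * (K * C) \<le> M"
      unfolding M_def using KC K(1) by (simp_all add: algebra_simps)
    show "M > 0" using Mle(1) K(1) by simp
    show "min (1/2) (r / 2) > 0" "min (1/2) (r / 2) < 1" using K(2) by auto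
    fix i and p v w x :: "real^'n^'v"
    assume p: "global_pot E d p \<le> min (1/2) (r / 2)" and n: "norm v \<le> 1" "norm w \<le> 1" "norm x \<le> 1"
    have p1: "global_pot E d p \<le> 1" using p by simp
    define y where "y = local_pot E d i p"
    define z where "z = sqrt y"
    have y: "0 \<le> y" "y \<le> r" "y \<le> 1"
      using local_pot_nonneg local_pot_le_global_pot[OF E, of d i p] p by (auto simp: y_def)
    have z: "0 \<le> z" "z \<le> 1" "y = z * z" using y by (simp_all add: z_def)
    have n0: "norm (0 :: real^'n^'v) \<le> 1" by simp
    define v1 w1 x1 where "v1 = local_pot_d1 E d i p v" and "w1 = local_pot_d1 E d i p w" and "x1 = local_pot_d1 E d i p x"
    define vw vx wx where "vw = local_pot_d2 E d i p v w" and "vx = local_pot_d2 E d i p v x" and "wx = local_pot_d2 E d i p w x"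
    define vwx where "vwx = local_pot_d3 E i p v w x"
    have d1: "\<bar>v1\<bar> \<le> C * z" "\<bar>w1\<bar> \<le> C * z" "\<bar>x1\<bar> \<le> C * z"
      using C(2)[OF p1 n(1) n0 n0] C(2)[OF p1 n(2) n0 n0] C(2)[OF p1 n(3) n0 n0]
      by (auto simp: v1_def w1_def x1_def z_def y_def)
    have d2: "\<bar>vw\<bar> \<le> C" "\<bar>vx\<bar> \<le> C" "\<bar>wx\<bar> \<le> C"
      using C(2)[OF p1 n(1) n(2) n0] C(2)[OF p1 n(1) n(3) n0] C(2)[OF p1 n(2) n(3) n0]
      by (auto simp: vw_def vx_def wx_def)
    have d3: "\<bar>vwx\<bar> \<le> C" using C(2)[OF p1 n] by (auto simp: vwx_def)
    have h0: "\<bar>h y\<bar> \<le> K * (z * z)" using K(3)[OF y(1,2)] z(3) by simp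
    have mm: "\<bar>a * b\<bar> \<le> A * B" if "\<bar>a\<bar> \<le> A" "\<bar>b\<bar> \<le> B" for a b A B :: real
      unfolding abs_mult using that by (intro mult_mono) auto
    have goals: "\<bar>h y\<bar> \<le> M * y \<and> \<bar>deriv h y * v1\<bar> \<le> M * z \<and> \<bar>h y * v1\<bar> \<le> M * z ^ 3 \<and>
      \<bar>deriv h y * w1 * v1 + h y * vw\<bar> \<le> M * y \<and>
      \<bar>deriv (deriv h) y * x1 * w1 * v1 + deriv h y * (wx * v1 + w1 * vx) + deriv h y * x1 * vw + h y * vwx\<bar> \<le> M * z"
    proof (cases "y = 0")
      \<comment> \<open>The derivatives of \<open>h\<close> at 0 are unknown, but each of them is
        multiplied by a first derivative of the local potential, which is 0 here.\<close>
      case True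
      then have "z = 0" by (simp add: z_def)
      then show ?thesis using d1 h0 True by simp
    next
      case False
      then have y0: "y > 0" and z0: "z > 0" using y(1) by (simp_all add: z_def)
      have h1: "\<bar>deriv h y\<bar> \<le> K" by (rule K(4)[OF y0 y(2)])
      have h2: "\<bar>deriv (deriv h) y\<bar> \<le> K / (z * z)"
        using K(5)[OF y0 y(2)] z(3) z0 by (simp add: pos_le_divide_eq)
      have "\<bar>h y\<bar> \<le> M * y"
        using h0 z(3) mult_right_mono[OF Mle(1) y(1)] by simp
      moreover have "\<bar>deriv h y * v1\<bar> \<le> M * z"
        using mm[OF h1 d1(1)] mult_right_mono[OF Mle(2) z(1)] by (simp add: mult.assoc)
      moreover have "\<bar>h y * v1\<bar> \<le> M * z ^ 3"
      proof -
        have "\<bar>h y * v1\<bar> \<le> K * (z * z) * (C * z)" by (rule mm[OF h0 d1(1)])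
        also have "\<dots> = K * C * z ^ 3" by (simp add: power3_eq_cube)
        also have "\<dots> \<le> M * z ^ 3" using Mle(2) z(1) by (intro mult_right_mono) auto
        finally show ?thesis .
      qed
      moreover have "\<bar>deriv h y * w1 * v1 + h y * vw\<bar> \<le> M * y"
      proof -
        have "\<bar>deriv h y * w1 * v1 + h y * vw\<bar> \<le> K * (C * z) * (C * z) + K * (z * z) * C"
          by (intro order_trans[OF abs_triangle_ineq] add_mono mm h1 h0 d1 d2)
        also have "\<dots> = (K * C * C + K * C) * y" by (simp add: z(3) algebra_simps)
        also have "\<dots> \<le> M * y" using Mle(3) y(1) by (intro mult_right_mono) auto
        finally show ?thesis .
      qed
      moreover have "\<bar>deriv (deriv h) y * x1 * w1 * v1 + deriv h y * (wx * v1 + w1 * vx) + deriv h y * x1 * vw + h y * vwx\<bar> \<le> M * z"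
      proof -
        have "\<bar>deriv (deriv h) y * x1 * w1 * v1 + deriv h y * (wx * v1 + w1 * vx) + deriv h y * x1 * vw + h y * vwx\<bar>
          \<le> K / (z * z) * (C * z) * (C * z) * (C * z) + K * (C * (C * z) + (C * z) * C) + K * (C * z) * C + K * (z * z) * C"
          by (intro order_trans[OF abs_triangle_ineq] add_mono mm h2 h1 h0 d1 d2 d3)
        also have "\<dots> = (K * C * C * C + (K * (C * C + C * C) + K * C * C)) * z + K * C * (z * z)"
          using z0 by (simp add: field_simps)
        also have "\<dots> \<le> (K * C * C * C + (K * (C * C + C * C) + K * C * C)) * z + K * C * (2 * z)"
          using z KC by (intro add_left_mono mult_left_mono) (auto intro: order_trans[OF mult_left_le])
        also have "\<dots> = (K * C * C * C + (K * (C * C + C * C) + K * C * C) + 2 * (K * C)) * z"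
          by (simp add: algebra_simps)
        also have "\<dots> \<le> M * z" using Mle(4) z(1) by (intro mult_right_mono) auto
        finally show ?thesis .
      qed
      ultimately show ?thesis by blast
    qed
    then show "\<bar>h (local_pot E d i p)\<bar> \<le> M * local_pot E d i p \<and>
       \<bar>deriv h (local_pot E d i p) * local_pot_d1 E d i p v\<bar> \<le> M * sqrt (local_pot E d i p) \<and>
       \<bar>scaled_d1 h E d i v p\<bar> \<le> M * (sqrt (local_pot E d i p)) ^ 3 \<and>
       \<bar>scaled_d2 h E d i v w p\<bar> \<le> M * local_pot E d i p \<and>
       \<bar>scaled_d3 h E d i v w p x\<bar> \<le> M * sqrt (local_pot E d i p)"
      unfolding scaled_d1_def scaled_d2_def scaled_d3_def y_def z_def v1_def w1_def x1_def vw_def vx_def wx_def vwx_def .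
  qed
qed

lemma scaled_d2_has_derivative:
  fixes p :: "real^'n^'v::finite"
  assumes E: "\<forall>e\<in>E. card e = 2" and h: "admissible_h h"
    and dom: "\<And>q. global_pot E d q \<le> \<rho> \<Longrightarrow> \<bar>scaled_d2 h E d i v w q\<bar> \<le> M * local_pot E d i q"
    and p: "global_pot E d p < \<rho>"
  shows "(scaled_d2 h E d i v w has_derivative scaled_d3 h E d i v w p) (at p)"
proof (cases "local_pot E d i p = 0")
  case True
  have "continuous (at p) (global_pot E d)"
    by (rule has_derivative_continuous[OF global_pot_has_derivative[OF E]])
  then have "(global_pot E d \<longlongrightarrow> global_pot E d p) (nhds p)"
    by (simp add: isCont_def tendsto_at_iff_tendsto_nhds)
  then have "\<forall>\<^sub>F q in nhds p. global_pot E d q < \<rho>" using p by (rule order_tendstoD)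
  then have "\<forall>\<^sub>F q in nhds p. \<bar>scaled_d2 h E d i v w q\<bar> \<le> M * local_pot E d i q"
    by eventually_elim (use dom in simp)
  from has_derivative_zero_dominated[OF local_pot_has_derivative local_pot_nonneg True this]
  have "(scaled_d2 h E d i v w has_derivative (\<lambda>_. 0)) (at p)" .
  moreover have "scaled_d3 h E d i v w p = (\<lambda>_. 0)"
    using h True by (simp add: fun_eq_iff scaled_d3_def local_pot_d1_eq_0 admissible_h_def)
  ultimately show ?thesis by simp
next
  case False
  then have pos: "local_pot E d i p > 0" using local_pot_nonneg[of E d i p] by simp
  have h': "(deriv h has_real_derivative deriv (deriv h) (local_pot E d i p)) (at (local_pot E d i p))"
    using h pos by (simp add: admissible_h_def field_differentiable_derivI)
  have d: "((\<lambda>q. deriv h (local_pot E d i q)) has_derivative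
       (\<lambda>x. deriv (deriv h) (local_pot E d i p) * local_pot_d1 E d i p x)) (at p)"
    using has_derivative_compose[OF local_pot_has_derivative h'[unfolded has_field_derivative_def]] .
  note c = admissible_h_comp_has_derivative[OF h local_pot_has_derivative local_pot_nonneg]
  show ?thesis
    unfolding scaled_d2_def[abs_def] scaled_d3_def[abs_def]
    using has_derivative_add[OF has_derivative_mult[OF has_derivative_mult[OF d local_pot_d1_has_derivative] local_pot_d1_has_derivative]
        has_derivative_mult[OF c local_pot_d2_has_derivative]]
    by (rule has_derivative_eq_rhs) (auto simp: algebra_simps)
qed

lemma orthonormal_expansion:
  fixes b :: "'n::finite \<Rightarrow> real^'n"
  assumes b: "\<And>k l. b k \<bullet> b l = (if k = l then 1 else 0)"
  shows "(\<Sum>k\<in>UNIV. (x \<bullet> b k) *\<^sub>R b k) = x"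
proof -
  have inj: "inj b"
  proof (rule injI)
    fix k l assume "b k = b l"
    then have "b k \<bullet> b l = 1" using b[of l l] by simp
    then show "k = l" using b[of k l] by (simp split: if_splits)
  qed
  have orth: "pairwise orthogonal (range b)"
    unfolding pairwise_def orthogonal_def using b by auto
  have n1: "norm y = 1" if "y \<in> range b" for y using that b by (auto simp: norm_eq_1)
  then have "0 \<notin> range b" using norm_zero zero_neq_one by metis
  then have "independent (range b)" by (rule pairwise_orthogonal_independent[OF orth])
  then have "span (range b) = UNIV"
    using card_eq_dim[of "range b" UNIV] card_image[OF inj] by (simp add: dim_UNIV) blast
  then have "(\<Sum>y\<in>range b. (x \<bullet> y) *\<^sub>R y) = x"
    using orthonormal_basis_expand[OF orth n1, of x] by simp
  then show ?thesis by (simp add: sum.reindex[OF inj])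
qed

section \<open>Convergence of the closed-loop system\<close>

lemma norm_axis_eq [simp]: "norm (axis i x :: ('a::real_normed_vector)^'v::finite) = norm x"
proof -
  have "norm (axis i x :: 'a^'v) = L2_set (\<lambda>j. if j = i then norm x else 0) UNIV"
    unfolding norm_vec_def by (rule L2_set_cong) (auto simp: axis_def)
  then show ?thesis by (simp add: L2_set_def if_distrib[of "\<lambda>x. x\<^sup>2"] cong: if_cong)
qed

lemma sum_abs_le_card:
  fixes g :: "'a::finite \<Rightarrow> real"
  assumes "\<And>a. \<bar>g a\<bar> \<le> c"
  shows "\<bar>\<Sum>a\<in>UNIV. g a\<bar> \<le> real CARD('a) * c"
  using order_trans[OF sum_abs sum_bounded_above[of UNIV "\<lambda>a. \<bar>g a\<bar>" c]] assms by simp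

lemma sum_UNIV_prod:
  fixes g :: "'a::finite \<times> 'b::finite \<Rightarrow> 'c::comm_monoid_add"
  shows "(\<Sum>x\<in>UNIV. g x) = (\<Sum>a\<in>UNIV. \<Sum>b\<in>UNIV. g (a, b))"
  by (simp add: sum.cartesian_product)

text \<open>Cauchy-Schwarz is applied twice. With \<open>D\<close> running over the N partial
  derivatives, the square of c times the potential is at most (N times the sum of D^2)^2, hence at
  most N^3 times the sum of D^4, and one factor D^2 is at most C^2 times the local potential. This
  explains the constant c^2 / (N^3 C^2).\<close>

lemma weighted_gradient_lower_bound:
  fixes E :: "'v::finite set set" and b :: "'v \<Rightarrow> 'n::finite \<Rightarrow> real^'n"
  assumes E: "\<forall>e\<in>E. card e = 2" and d: "\<forall>e\<in>E. d e \<ge> 0"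
    and b: "\<And>i k l. b i k \<bullet> b i l = (if k = l then 1 else 0)"
    and realizable: "realizations E d \<noteq> ({} :: (real^'n^'v) set)"
    and rigid: "\<And>p::real^'n^'v. p \<in> realizations E d \<Longrightarrow> inf_rigid E p"
    and con: "\<And>a b. (a, b) \<in> {(i, j). {i, j} \<in> E}\<^sup>*"
  obtains c r where "c > 0" "r > 0"
    "\<And>p::real^'n^'v. global_pot E d p \<le> r \<Longrightarrow> c * (global_pot E d p)\<^sup>2
       \<le> (\<Sum>(i, k)\<in>UNIV. local_pot E d i p * (local_pot_d1 E d i p (axis i (b i k)))\<^sup>2)"
proof -
  obtain c r where c: "c > 0" "r > 0" "\<And>p::real^'n^'v. global_pot E d p \<le> r \<Longrightarrow>
       \<exists>u. norm u = 1 \<and> c * global_pot E d p \<le> ((\<Sum>i\<in>UNIV. local_pot_d1 E d i p u) / 2)\<^sup>2"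
    using global_pot_gradient_lower_bound[OF E d realizable rigid] by blast
  obtain C where C: "C > 0" "\<And>i (p::real^'n^'v) v w x. global_pot E d p \<le> 1 \<Longrightarrow> norm v \<le> 1 \<Longrightarrow> norm w \<le> 1 \<Longrightarrow> norm x \<le> 1
     \<Longrightarrow> \<bar>local_pot_d1 E d i p v\<bar> \<le> C * sqrt (local_pot E d i p) \<and> \<bar>local_pot_d2 E d i p v w\<bar> \<le> C \<and>
         \<bar>local_pot_d3 E i p v w x\<bar> \<le> C"
    using local_pot_derivative_bounds[OF E con] by blast
  define N where "N = real CARD('v \<times> 'n)"
  have N: "N > 0" by (simp add: N_def)
  have nb: "norm (b i k) = 1" for i k by (simp add: norm_eq_1 b)
  show thesis
  proof (rule that[of "c\<^sup>2 / (N ^ 3 * C\<^sup>2)" "min r 1"])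
    show "c\<^sup>2 / (N ^ 3 * C\<^sup>2) > 0" "min r 1 > 0" using c C N by simp_all
    fix p :: "real^'n^'v"
    assume p: "global_pot E d p \<le> min r 1"
    define D where "D x = local_pot_d1 E d (fst x) p (axis (fst x) (b (fst x) (snd x)))" for x :: "'v \<times> 'n"
    obtain u :: "real^'n^'v" where u: "norm u = 1"
      "c * global_pot E d p \<le> ((\<Sum>i\<in>UNIV. local_pot_d1 E d i p u) / 2)\<^sup>2"
      using c(3)[of p] p by auto
    have u_eq: "u = (\<Sum>x\<in>UNIV. (u $ fst x \<bullet> b (fst x) (snd x)) *\<^sub>R axis (fst x) (b (fst x) (snd x)))"
    proof (rule vec_eq_iff[THEN iffD2], rule allI)
      fix j
      have "(\<Sum>x\<in>UNIV. (u $ fst x \<bullet> b (fst x) (snd x)) *\<^sub>R axis (fst x) (b (fst x) (snd x))) $ j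
        = (\<Sum>i\<in>UNIV. if i = j then (\<Sum>k\<in>UNIV. (u $ j \<bullet> b j k) *\<^sub>R b j k) else 0)"
        unfolding sum_UNIV_prod sum_component by (intro sum.cong refl) (auto simp: axis_def)
      then show "u $ j = (\<Sum>x\<in>UNIV. (u $ fst x \<bullet> b (fst x) (snd x)) *\<^sub>R axis (fst x) (b (fst x) (snd x))) $ j"
        by (simp add: orthonormal_expansion[OF b])
    qed
    note lin = has_derivative_linear[OF global_pot_has_derivative[OF E, of d p]]
    \<comment> \<open>In a direction that moves one agent only, the derivative of the global
      potential is that of this agent's local potential, so the derivative along \<open>u\<close>
      expands in the \<open>D x\<close>.\<close>
    have Du: "(\<Sum>i\<in>UNIV. local_pot_d1 E d i p u) / 2 = (\<Sum>x\<in>UNIV. (u $ fst x \<bullet> b (fst x) (snd x)) * D x)"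
      by (subst u_eq, subst linear_sum[OF lin])
         (simp add: linear_scale[OF lin] sum_local_pot_d1_axis[OF E] D_def)
    have "c * global_pot E d p \<le> (\<Sum>x\<in>UNIV. ((u $ fst x \<bullet> b (fst x) (snd x)) * D x)\<^sup>2) * N"
      using u(2) sum_squared_le_sum_of_squares[of "\<lambda>x. (u $ fst x \<bullet> b (fst x) (snd x)) * D x" UNIV]
      unfolding Du N_def by simp
    also have "\<dots> \<le> (\<Sum>x\<in>UNIV. (D x)\<^sup>2) * N"
    proof (intro mult_right_mono sum_mono)
      fix x
      have "\<bar>u $ fst x \<bullet> b (fst x) (snd x)\<bar> \<le> norm (u $ fst x) * norm (b (fst x) (snd x))"
        by (rule Cauchy_Schwarz_ineq2)
      also have "\<dots> \<le> 1" using Finite_Cartesian_Product.norm_nth_le[of u "fst x"] u(1) nb by simp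
      finally have "(u $ fst x \<bullet> b (fst x) (snd x))\<^sup>2 \<le> 1" by (simp add: abs_square_le_1)
      then show "((u $ fst x \<bullet> b (fst x) (snd x)) * D x)\<^sup>2 \<le> (D x)\<^sup>2"
        by (simp add: power_mult_distrib mult_left_le_one_le)
    qed (use N in auto)
    finally have "(c * global_pot E d p)\<^sup>2 \<le> ((\<Sum>x\<in>UNIV. (D x)\<^sup>2) * N)\<^sup>2"
      using c(1) global_pot_nonneg[of E d p] by (intro power_mono) auto
    also have "\<dots> = (\<Sum>x\<in>UNIV. (D x)\<^sup>2)\<^sup>2 * N\<^sup>2" by (simp add: power_mult_distrib)
    also have "\<dots> \<le> ((\<Sum>x\<in>UNIV. ((D x)\<^sup>2)\<^sup>2) * N) * N\<^sup>2"
      using sum_squared_le_sum_of_squares[of "\<lambda>x. (D x)\<^sup>2" "UNIV :: ('v \<times> 'n) set"]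
      unfolding N_def by (intro mult_right_mono) auto
    also have "\<dots> \<le> ((\<Sum>x\<in>UNIV. C\<^sup>2 * (local_pot E d (fst x) p * (D x)\<^sup>2)) * N) * N\<^sup>2"
    proof (intro mult_right_mono sum_mono)
      fix x
      have "\<bar>D x\<bar> \<le> C * sqrt (local_pot E d (fst x) p)"
        using C(2)[of p "axis (fst x) (b (fst x) (snd x))" 0 0] p nb by (simp add: D_def)
      then have "\<bar>D x\<bar>\<^sup>2 \<le> (C * sqrt (local_pot E d (fst x) p))\<^sup>2" by (intro power_mono) auto
      then have "(D x)\<^sup>2 \<le> C\<^sup>2 * local_pot E d (fst x) p"
        by (simp add: power_mult_distrib local_pot_nonneg)
      then have "(D x)\<^sup>2 * (D x)\<^sup>2 \<le> (C\<^sup>2 * local_pot E d (fst x) p) * (D x)\<^sup>2"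
        by (intro mult_right_mono) auto
      then show "((D x)\<^sup>2)\<^sup>2 \<le> C\<^sup>2 * (local_pot E d (fst x) p * (D x)\<^sup>2)"
        by (simp add: power2_eq_square mult.assoc)
    qed (use N in auto)
    also have "\<dots> = (N ^ 3 * C\<^sup>2) * (\<Sum>x\<in>UNIV. local_pot E d (fst x) p * (D x)\<^sup>2)"
      by (simp add: sum_distrib_left[symmetric] power2_eq_square power3_eq_cube)
    finally have "c\<^sup>2 / (N ^ 3 * C\<^sup>2) * (global_pot E d p)\<^sup>2
        \<le> (\<Sum>x\<in>UNIV. local_pot E d (fst x) p * (D x)\<^sup>2)"
      using N C(1) by (simp add: pos_divide_le_eq power_mult_distrib mult.commute)
    then show "c\<^sup>2 / (N ^ 3 * C\<^sup>2) * (global_pot E d p)\<^sup>2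
       \<le> (\<Sum>(i, k)\<in>UNIV. local_pot E d i p * (local_pot_d1 E d i p (axis i (b i k)))\<^sup>2)"
      by (simp add: D_def case_prod_unfold)
  qed
qed

text \<open>Injectivity of \<open>w\<close> leaves only pairs with the same \<open>x\<close>. Terms
  with equal phases contribute sin 0 = 0; the two mixed pairs have phase differences of plus and
  minus pi/2 and so enter with opposite signs.\<close>

lemma sum_quadrature_means:
  fixes w \<theta> :: "'x::finite \<Rightarrow> real" and \<Phi> :: "'x \<times> bool \<Rightarrow> real"
  assumes "inj w" "\<And>x. w x > 0"
    and \<Phi>: "\<And>x s. \<Phi> (x, s) = \<theta> x - (if s then pi / 2 else 0)"
  shows "(\<Sum>a\<in>UNIV. \<Sum>b\<in>UNIV. sqrt (w (fst b)) / sqrt (w (fst a))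
        * (if w (fst a) = w (fst b) then sin (\<Phi> a - \<Phi> b) / 2 else 0) * G a b)
     = (\<Sum>x\<in>UNIV. (G (x, False) (x, True) - G (x, True) (x, False)) / 2)"
proof -
  have "(\<Sum>a\<in>UNIV. \<Sum>b\<in>UNIV. sqrt (w (fst b)) / sqrt (w (fst a))
        * (if w (fst a) = w (fst b) then sin (\<Phi> a - \<Phi> b) / 2 else 0) * G a b)
     = (\<Sum>a\<in>UNIV. \<Sum>b\<in>UNIV. if fst b = fst a then sin (\<Phi> a - \<Phi> b) / 2 * G a b else 0)"
  proof (intro sum.cong refl)
    fix a b
    show "sqrt (w (fst b)) / sqrt (w (fst a)) * (if w (fst a) = w (fst b) then sin (\<Phi> a - \<Phi> b) / 2 else 0) * G a b
      = (if fst b = fst a then sin (\<Phi> a - \<Phi> b) / 2 * G a b else 0)"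
      using assms(2)[of "fst a"] injD[OF assms(1), of "fst a" "fst b"] by auto
  qed
  also have "\<dots> = (\<Sum>x\<in>UNIV. \<Sum>s\<in>UNIV. \<Sum>y\<in>UNIV. if y = x then
       (\<Sum>s'\<in>UNIV. sin (\<Phi> (x, s) - \<Phi> (x, s')) / 2 * G (x, s) (x, s')) else 0)"
    unfolding sum_UNIV_prod by (intro sum.cong refl) (simp only: fst_conv split: if_split, simp)
  also have "\<dots> = (\<Sum>x\<in>UNIV. \<Sum>s\<in>UNIV. \<Sum>s'\<in>UNIV. sin (\<Phi> (x, s) - \<Phi> (x, s')) / 2 * G (x, s) (x, s'))"
    by simp
  also have "\<dots> = (\<Sum>x\<in>UNIV. (G (x, False) (x, True) - G (x, True) (x, False)) / 2)"
    by (simp add: UNIV_bool \<Phi> diff_divide_distrib)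
  finally show ?thesis .
qed

text \<open>The averaging lemmas require this form: a finite sum of scalar oscillations times scalar
  functions of the position times constant vectors.\<close>

lemma closed_loop_eq_sum:
  fixes b :: "'v::finite \<Rightarrow> 'n::finite \<Rightarrow> real^'n" and p :: "real^'n^'v"
  shows "closed_loop b \<omega> \<phi> h1 h2 E d t p =
    (\<Sum>((i, k), s)\<in>UNIV. (sqrt (\<omega> i k) * cos (\<omega> i k * t + (\<phi> i k - (if s then pi / 2 else 0)))
        * (if s then h2 else h1) (local_pot E d i p)) *\<^sub>R axis i (b i k))"
proof -
  have cos_shift: "cos (x + (y - pi / 2)) = sin (x + y)" for x y :: real
    using cos_diff[of "x + y" "pi / 2"] by (simp add: add_diff_eq)
  have "(\<Sum>((i, k), s)\<in>UNIV. (sqrt (\<omega> i k) * cos (\<omega> i k * t + (\<phi> i k - (if s then pi / 2 else 0)))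
        * (if s then h2 else h1) (local_pot E d i p)) *\<^sub>R axis i (b i k))
    = (\<Sum>i\<in>UNIV. \<Sum>k\<in>UNIV. control \<omega> \<phi> h1 h2 E d i k t p *\<^sub>R axis i (b i k))"
    unfolding sum_UNIV_prod UNIV_bool
    by (simp add: control_def cos_shift scaleR_add_left add.commute)
  also have "\<dots> = closed_loop b \<omega> \<phi> h1 h2 E d t p"
  proof (rule vec_eq_iff[THEN iffD2], rule allI)
    fix j
    have "(\<Sum>i\<in>UNIV. \<Sum>k\<in>UNIV. control \<omega> \<phi> h1 h2 E d i k t p *\<^sub>R axis i (b i k)) $ j
      = (\<Sum>i\<in>UNIV. if i = j then (\<Sum>k\<in>UNIV. control \<omega> \<phi> h1 h2 E d j k t p *\<^sub>R b j k) else 0)"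
      unfolding sum_component by (intro sum.cong refl) (auto simp: axis_def)
    then show "(\<Sum>i\<in>UNIV. \<Sum>k\<in>UNIV. control \<omega> \<phi> h1 h2 E d i k t p *\<^sub>R axis i (b i k)) $ j
      = closed_loop b \<omega> \<phi> h1 h2 E d t p $ j"
      by (simp add: closed_loop_def)
  qed
  finally show ?thesis ..
qed

lemma scaled_bounds_uniform:
  fixes E :: "'v::finite set set" and H :: "bool \<Rightarrow> real \<Rightarrow> real"
  assumes E: "\<forall>e\<in>E. card e = 2" and con: "\<And>a b. (a, b) \<in> {(i, j). {i, j} \<in> E}\<^sup>*"
    and H: "\<And>s. admissible_h (H s)"
  obtains M \<rho> where "M > 0" "\<rho> > 0" "\<rho> < 1"
    "\<And>s i (p::real^'n^'v). global_pot E d p \<le> \<rho> \<Longrightarrow> \<bar>H s (local_pot E d i p)\<bar> \<le> M * (sqrt (global_pot E d p))\<^sup>2"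
    "\<And>s i (p::real^'n^'v) v. global_pot E d p \<le> \<rho> \<Longrightarrow> norm v \<le> 1 \<Longrightarrow>
       \<bar>deriv (H s) (local_pot E d i p) * local_pot_d1 E d i p v\<bar> \<le> M * sqrt (global_pot E d p)"
    "\<And>s i (p::real^'n^'v) v. global_pot E d p \<le> \<rho> \<Longrightarrow> norm v \<le> 1 \<Longrightarrow>
       \<bar>scaled_d1 (H s) E d i v p\<bar> \<le> M * (sqrt (global_pot E d p)) ^ 3"
    "\<And>s i (p::real^'n^'v) v w. global_pot E d p \<le> \<rho> \<Longrightarrow> norm v \<le> 1 \<Longrightarrow> norm w \<le> 1 \<Longrightarrow>
       \<bar>scaled_d2 (H s) E d i v w p\<bar> \<le> M * (sqrt (global_pot E d p))\<^sup>2"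
    "\<And>s i (p::real^'n^'v) v w x. global_pot E d p \<le> \<rho> \<Longrightarrow> norm v \<le> 1 \<Longrightarrow> norm w \<le> 1 \<Longrightarrow> norm x \<le> 1 \<Longrightarrow>
       \<bar>scaled_d3 (H s) E d i v w p x\<bar> \<le> M * sqrt (global_pot E d p)"
    "\<And>s i (p::real^'n^'v) v w. global_pot E d p < \<rho> \<Longrightarrow> norm v \<le> 1 \<Longrightarrow> norm w \<le> 1 \<Longrightarrow>
       (scaled_d2 (H s) E d i v w has_derivative scaled_d3 (H s) E d i v w p) (at p)"
proof -
  let ?B = "\<lambda>h M \<rho> i (p::real^'n^'v) v w x.
       \<bar>h (local_pot E d i p)\<bar> \<le> M * local_pot E d i p \<and>
       \<bar>deriv h (local_pot E d i p) * local_pot_d1 E d i p v\<bar> \<le> M * sqrt (local_pot E d i p) \<and>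
       \<bar>scaled_d1 h E d i v p\<bar> \<le> M * (sqrt (local_pot E d i p)) ^ 3 \<and>
       \<bar>scaled_d2 h E d i v w p\<bar> \<le> M * local_pot E d i p \<and>
       \<bar>scaled_d3 h E d i v w p x\<bar> \<le> M * sqrt (local_pot E d i p)"
  have "\<exists>M \<rho>. M > 0 \<and> \<rho> > 0 \<and> \<rho> < 1 \<and> (\<forall>i p v w x. global_pot E d p \<le> \<rho> \<longrightarrow> norm v \<le> 1 \<longrightarrow> norm w \<le> 1 \<longrightarrow> norm x \<le> 1 \<longrightarrow>
      ?B (H s) M \<rho> i p v w x)" for s
    by (rule scaled_bounds[OF E con H[of s], where ?'n = 'n and d = d]) blast
  then obtain M0 \<rho>0 where B: "\<And>s. M0 s > 0" "\<And>s. \<rho>0 s > 0" "\<And>s. \<rho>0 s < 1"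
    "\<And>s i p v w x. global_pot E d p \<le> \<rho>0 s \<Longrightarrow> norm v \<le> 1 \<Longrightarrow> norm w \<le> 1 \<Longrightarrow> norm x \<le> 1 \<Longrightarrow>
      ?B (H s) (M0 s) (\<rho>0 s) i p v w x"
    by metis
  \<comment> \<open>The square root of a local potential is at most twice that of the global one.
    The worst case is its cube, which costs the factor 8.\<close>
  define M where "M = 8 * (M0 False + M0 True)"
  define \<rho> where "\<rho> = min (\<rho>0 False) (\<rho>0 True)"
  have \<rho>: "\<rho> \<le> \<rho>0 s" for s by (cases s) (auto simp: \<rho>_def)
  have M: "8 * M0 s \<le> M" for s using B(1)[of True] B(1)[of False] by (cases s) (auto simp: M_def)
  have n0: "norm (0 :: real^'n^'v) \<le> 1" by simp
  have P: "local_pot E d i p \<le> 2 * (sqrt (global_pot E d p))\<^sup>2" "sqrt (local_pot E d i p) \<le> 2 * sqrt (global_pot E d p)"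
    for i and p :: "real^'n^'v"
  proof -
    show 1: "local_pot E d i p \<le> 2 * (sqrt (global_pot E d p))\<^sup>2"
      using local_pot_le_global_pot[OF E] global_pot_nonneg[of E d p] by simp
    have "sqrt (local_pot E d i p) \<le> sqrt (4 * global_pot E d p)"
      using 1 global_pot_nonneg[of E d p] by (intro real_sqrt_le_mono) simp
    then show "sqrt (local_pot E d i p) \<le> 2 * sqrt (global_pot E d p)" by (simp add: real_sqrt_mult)
  qed
  have up: "a \<le> M * y" if "a \<le> M0 s * x" "x \<le> 8 * y" "0 \<le> y" for a x y s
  proof -
    have "M0 s * x \<le> M0 s * (8 * y)" using that B(1)[of s] by (intro mult_left_mono) auto
    also have "\<dots> \<le> M * y" using M[of s] that(3) mult_right_mono[of "8 * M0 s" M y] by simp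
    finally show ?thesis using that(1) by simp
  qed
  have s0: "sqrt (global_pot E d p) \<ge> 0" for p :: "real^'n^'v" by (simp add: global_pot_nonneg)
  show thesis
  proof (rule that[of M \<rho>])
    show "M > 0" "\<rho> > 0" "\<rho> < 1" using B(1)[of True] B(1)[of False] B(2,3) by (auto simp: M_def \<rho>_def min_less_iff_disj)
    fix s i and p v w x :: "real^'n^'v"
    {
      assume p: "global_pot E d p \<le> \<rho>"
      then have p': "global_pot E d p \<le> \<rho>0 s" using \<rho>[of s] by simp
      show "\<bar>H s (local_pot E d i p)\<bar> \<le> M * (sqrt (global_pot E d p))\<^sup>2"
        using B(4)[OF p' n0 n0 n0, of i] P(1)[of i p] zero_le_power2[of "sqrt (global_pot E d p)"]
        by (intro up[of _ s "local_pot E d i p"]) linarith+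
      assume v: "norm v \<le> 1"
      show "\<bar>deriv (H s) (local_pot E d i p) * local_pot_d1 E d i p v\<bar> \<le> M * sqrt (global_pot E d p)"
        using B(4)[OF p' v n0 n0, of i] P(2)[of i p] s0[of p]
        by (intro up[of _ s "sqrt (local_pot E d i p)"]) linarith+
      have "(sqrt (local_pot E d i p)) ^ 3 \<le> (2 * sqrt (global_pot E d p)) ^ 3"
        using P(2) by (intro power_mono) (auto simp: local_pot_nonneg)
      then have "(sqrt (local_pot E d i p)) ^ 3 \<le> 8 * (sqrt (global_pot E d p)) ^ 3"
        by (simp add: power_mult_distrib)
      then show "\<bar>scaled_d1 (H s) E d i v p\<bar> \<le> M * (sqrt (global_pot E d p)) ^ 3"
        using B(4)[OF p' v n0 n0, of i] s0[of p]
        by (intro up[of _ s "(sqrt (local_pot E d i p)) ^ 3"]) auto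
      assume w: "norm w \<le> 1"
      show "\<bar>scaled_d2 (H s) E d i v w p\<bar> \<le> M * (sqrt (global_pot E d p))\<^sup>2"
        using B(4)[OF p' v w n0, of i] P(1)[of i p] zero_le_power2[of "sqrt (global_pot E d p)"]
        by (intro up[of _ s "local_pot E d i p"]) linarith+
      assume x: "norm x \<le> 1"
      show "\<bar>scaled_d3 (H s) E d i v w p x\<bar> \<le> M * sqrt (global_pot E d p)"
        using B(4)[OF p' v w x, of i] P(2)[of i p] s0[of p]
        by (intro up[of _ s "sqrt (local_pot E d i p)"]) linarith+
    }
    assume p: "global_pot E d p < \<rho>" and n: "norm v \<le> 1" "norm w \<le> 1"
    show "(scaled_d2 (H s) E d i v w has_derivative scaled_d3 (H s) E d i v w p) (at p)"
    proof (rule scaled_d2_has_derivative[OF E H _ p])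
      fix q :: "real^'n^'v" assume "global_pot E d q \<le> \<rho>"
      then have "global_pot E d q \<le> \<rho>0 s" using \<rho>[of s] by simp
      from B(4)[OF this n n0, of i] show "\<bar>scaled_d2 (H s) E d i v w q\<bar> \<le> M0 s * local_pot E d i q" by simp
    qed
  qed
qed

lemma uniform_bound_finite_family:
  fixes g :: "'a::finite \<Rightarrow> 'b \<Rightarrow> real"
  assumes "\<And>a. \<exists>B. \<forall>t. \<bar>g a t\<bar> \<le> B"
  shows "\<exists>B>0. \<forall>a t. \<bar>g a t\<bar> \<le> B"
proof -
  obtain B where B: "\<And>a t. \<bar>g a t\<bar> \<le> B a" using assms by metis
  have "\<bar>g a t\<bar> \<le> max 1 (Max (range B))" for a t
    using B[of a t] Max_ge[of "range B" "B a"] by (simp add: le_max_iff_disj order_trans)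
  then show ?thesis by (intro exI[of _ "max 1 (Max (range B))"]) auto
qed

lemma tendsto_zero_of_decay:
  fixes y :: "real \<Rightarrow> real"
  assumes nonneg: "\<And>t. y t \<ge> 0" and "c > 0"
    and decay: "\<And>t. t0 \<le> t \<Longrightarrow> y t \<le> 2 * y t0 / (1 + c * y t0 * (t - t0))"
  shows "(y \<longlongrightarrow> 0) at_top"
proof (rule tendsto_sandwich[OF _ _ tendsto_const])
  have "filterlim (\<lambda>t. c * (- t0 + t)) at_top at_top"
    by (rule filterlim_tendsto_pos_mult_at_top[OF tendsto_const \<open>c > 0\<close>])
       (rule filterlim_tendsto_add_at_top[OF tendsto_const filterlim_ident])
  then show "((\<lambda>t. 2 / (c * (- t0 + t))) \<longlongrightarrow> 0) at_top"
    by (intro tendsto_divide_0[OF tendsto_const] filterlim_at_top_imp_at_infinity)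
  have "y t \<le> 2 / (c * (- t0 + t))" if "t > t0" for t
  proof (cases "y t0 = 0")
    case True
    then have "y t \<le> 0" using decay[of t] that by simp
    also have "0 \<le> 2 / (c * (- t0 + t))" using that \<open>c > 0\<close> by simp
    finally show ?thesis .
  next
    case False
    then have "y t0 > 0" using nonneg[of t0] by simp
    have "y t \<le> 2 * y t0 / (1 + c * y t0 * (t - t0))" using decay that by simp
    also have "\<dots> \<le> 2 * y t0 / (c * y t0 * (t - t0))"
      using \<open>y t0 > 0\<close> \<open>c > 0\<close> that by (intro divide_left_mono mult_pos_pos add_pos_pos) auto
    also have "\<dots> = 2 / (c * (- t0 + t))" using False by simp
    finally show ?thesis .
  qed
  then show "\<forall>\<^sub>F t in at_top. y t \<le> 2 / (c * (- t0 + t))"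
    using eventually_gt_at_top[of t0] by (rule eventually_mono[rotated])
qed (use nonneg in auto)


section \<open>The closed-loop system as a sum of oscillating vector fields\<close>

locale formation =
  fixes E :: "'v::finite set set"
    and d :: "'v set \<Rightarrow> real"
    and b :: "'v \<Rightarrow> 'n::finite \<Rightarrow> real^'n"
    and \<omega> \<phi> :: "'v \<Rightarrow> 'n \<Rightarrow> real"
    and h1 h2 :: "real \<Rightarrow> real"
  assumes E_edges: "\<forall>e\<in>E. card e = 2"
    and d_nonneg: "\<forall>e\<in>E. d e \<ge> 0"
    and realizable: "\<exists>p::real^'n^'v. \<forall>i j. {i, j} \<in> E \<longrightarrow> norm (p $ j - p $ i) = d {i, j}"
    and b_orthonormal: "\<forall>i k l. b i k \<bullet> b i l = (if k = l then 1 else 0)"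
    and \<omega>_pos: "\<forall>i k. \<omega> i k > 0"
    and \<omega>_distinct: "inj (\<lambda>(i, k). \<omega> i k)"
    and h1_adm: "admissible_h h1"
    and h2_adm: "admissible_h h2"
    and h_cond: "\<exists>r' c'. r' > 0 \<and> c' > 0 \<and>
       (\<forall>y\<in>{0<..r'}. deriv h2 y * h1 y - deriv h1 y * h2 y \<le> - c' * y)"
    and rigid: "\<forall>p::real^'n^'v. p \<in> realizations E d \<longrightarrow> inf_rigid E p"
begin

abbreviation \<psi> :: "real^'n^'v \<Rightarrow> real" where "\<psi> \<equiv> global_pot E d"

text \<open>An index \<open>((i, k), s)\<close> stands for the term of \<open>u\<^bsub>i,k\<^esub>\<close> containing \<open>h\<^sub>1\<close> if \<open>s\<close> is false and
  \<open>h\<^sub>2\<close> if \<open>s\<close> is true; both become cosines after shifting the phase of the second by \<open>pi / 2\<close>.\<close>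

definition H :: "bool \<Rightarrow> real \<Rightarrow> real" where "H s = (if s then h2 else h1)"

definition freq :: "'v \<times> 'n \<Rightarrow> real" where "freq = (\<lambda>(i, k). \<omega> i k)"

definition phase :: "('v \<times> 'n) \<times> bool \<Rightarrow> real" where
  "phase a = (case fst a of (i, k) \<Rightarrow> \<phi> i k) - (if snd a then pi / 2 else 0)"

definition osc :: "('v \<times> 'n) \<times> bool \<Rightarrow> real \<Rightarrow> real" where
  "osc a t = sqrt (freq (fst a)) * cos (freq (fst a) * t + phase a)"

definition osc_int :: "('v \<times> 'n) \<times> bool \<Rightarrow> real \<Rightarrow> real" where
  "osc_int a t = sin (freq (fst a) * t + phase a) / sqrt (freq (fst a))"

text \<open>The time average of \<open>osc_int a t * osc a' t\<close>, which must be subtracted to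
  obtain a bounded antiderivative.\<close>

definition osc_mean :: "('v \<times> 'n) \<times> bool \<Rightarrow> ('v \<times> 'n) \<times> bool \<Rightarrow> real" where
  "osc_mean a a' = sqrt (freq (fst a')) / sqrt (freq (fst a))
      * (if freq (fst a) = freq (fst a') then sin (phase a - phase a') / 2 else 0)"

definition agent :: "('v \<times> 'n) \<times> bool \<Rightarrow> 'v" where "agent a = fst (fst a)"

definition dir :: "('v \<times> 'n) \<times> bool \<Rightarrow> real^'n^'v" where
  "dir a = axis (agent a) (b (agent a) (snd (fst a)))"

definition gain :: "('v \<times> 'n) \<times> bool \<Rightarrow> real^'n^'v \<Rightarrow> real" where
  "gain a p = H (snd a) (local_pot E d (agent a) p)"

definition gain_d :: "('v \<times> 'n) \<times> bool \<Rightarrow> real^'n^'v \<Rightarrow> real^'n^'v \<Rightarrow> real" where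
  "gain_d a p v = deriv (H (snd a)) (local_pot E d (agent a) p) * local_pot_d1 E d (agent a) p v"

definition lie1 :: "('v \<times> 'n) \<times> bool \<Rightarrow> real^'n^'v \<Rightarrow> real" where
  "lie1 a = scaled_d1 (H (snd a)) E d (agent a) (dir a)"

definition lie1_dir :: "('v \<times> 'n) \<times> bool \<Rightarrow> ('v \<times> 'n) \<times> bool \<Rightarrow> real^'n^'v \<Rightarrow> real" where
  "lie1_dir a a' = scaled_d2 (H (snd a)) E d (agent a) (dir a) (dir a')"

definition lie1_dir_d :: "('v \<times> 'n) \<times> bool \<Rightarrow> ('v \<times> 'n) \<times> bool \<Rightarrow> real^'n^'v \<Rightarrow> real^'n^'v \<Rightarrow> real" where
  "lie1_dir_d a a' = scaled_d3 (H (snd a)) E d (agent a) (dir a) (dir a')"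

text \<open>The Lie derivative of \<open>lie1 a\<close> along the field \<open>gain a'\<close> times
  the constant vector \<open>dir a'\<close>; the second index belongs to the field applied
  last.\<close>

definition lie2 :: "('v \<times> 'n) \<times> bool \<Rightarrow> ('v \<times> 'n) \<times> bool \<Rightarrow> real^'n^'v \<Rightarrow> real" where
  "lie2 a a' p = gain a' p * lie1_dir a a' p"

definition lie2_d :: "('v \<times> 'n) \<times> bool \<Rightarrow> ('v \<times> 'n) \<times> bool \<Rightarrow> real^'n^'v \<Rightarrow> real^'n^'v \<Rightarrow> real" where
  "lie2_d a a' p v = gain a' p * lie1_dir_d a a' p v + gain_d a' p v * lie1_dir a a' p"

definition solution :: "(real \<Rightarrow> real^'n^'v) \<Rightarrow> bool" where
  "solution \<gamma> \<longleftrightarrow> (\<forall>t. (\<gamma> has_vector_derivative closed_loop b \<omega> \<phi> h1 h2 E d t (\<gamma> t)) (at t))"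

lemma H_adm: "admissible_h (H s)"
  using h1_adm h2_adm by (simp add: H_def)

lemma b_inner: "b i k \<bullet> b i l = (if k = l then 1 else 0)"
  using b_orthonormal by blast

lemma freq_pos: "freq x > 0"
  using \<omega>_pos by (simp add: freq_def case_prod_unfold)

lemma realizations_nonempty: "realizations E d \<noteq> ({} :: (real^'n^'v) set)"
  using realizable by (auto simp: realizations_def)

lemma rigid_realization: "p \<in> realizations E d \<Longrightarrow> inf_rigid E (p :: real^'n^'v)"
  using rigid by blast

lemma connected: "(x, y) \<in> {(i, j). {i, j} \<in> E}\<^sup>*"
  using inf_rigid_connected[OF E_edges] rigid realizations_nonempty by blast

lemma norm_dir_le: "norm (dir a) \<le> 1"
  by (simp add: dir_def norm_eq_1 b_inner norm_le_square)

lemma osc_int_deriv: "(osc_int a has_real_derivative osc a t) (at t)"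
  unfolding osc_int_def[abs_def] osc_def using freq_pos[of "fst a"]
  by (auto intro!: derivative_eq_intros simp: field_simps)

lemma solution_deriv:
  assumes "solution \<gamma>"
  shows "(\<gamma> has_vector_derivative (\<Sum>a\<in>UNIV. (osc a t * gain a (\<gamma> t)) *\<^sub>R dir a)) (at t)"
  using assms unfolding solution_def closed_loop_eq_sum
  by (simp add: osc_def gain_def dir_def agent_def freq_def phase_def H_def case_prod_unfold)

lemma gain_deriv: "(gain a has_derivative gain_d a p) (at p)"
  unfolding gain_def[abs_def] gain_d_def[abs_def]
  by (rule admissible_h_comp_has_derivative[OF H_adm local_pot_has_derivative local_pot_nonneg])

lemma lie1_deriv: "(lie1 a has_derivative (\<lambda>v. scaled_d2 (H (snd a)) E d (agent a) (dir a) v p)) (at p)"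
  unfolding lie1_def by (rule scaled_d1_has_derivative[OF H_adm])

lemma sum_le_card:
  fixes g :: "('v \<times> 'n) \<times> bool \<Rightarrow> real"
  shows "(\<And>a. \<bar>g a\<bar> \<le> c) \<Longrightarrow> \<bar>\<Sum>a\<in>UNIV. g a\<bar> \<le> real CARD(('v \<times> 'n) \<times> bool) * c"
  by (rule sum_abs_le_card)

lemma abs_mult_le: "\<bar>x\<bar> \<le> X \<Longrightarrow> \<bar>y\<bar> \<le> Y \<Longrightarrow> \<bar>x * y\<bar> \<le> X * Y" for x y X Y :: real
  unfolding abs_mult by (intro mult_mono) auto

lemma osc_product_antiderivative:
  obtains C W where "\<And>t. (W has_real_derivative (osc_int a t * osc a' t - osc_mean a a')) (at t)"
    "\<And>t. \<bar>W t\<bar> \<le> C"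
proof -
  let ?q = "sqrt (freq (fst a')) / sqrt (freq (fst a))"
  obtain W C where W: "\<And>t. (W has_real_derivative sin (freq (fst a) * t + phase a) * cos (freq (fst a') * t + phase a')
      - (if freq (fst a) = freq (fst a') then sin (phase a - phase a') / 2 else 0)) (at t)" "\<And>t. \<bar>W t\<bar> \<le> C"
    using sinusoid_product_antiderivative[OF freq_pos freq_pos] by metis
  have "((\<lambda>t. ?q * W t) has_real_derivative (osc_int a t * osc a' t - osc_mean a a')) (at t)" for t
    using DERIV_cmult[OF W(1), of ?q t] by (simp add: osc_int_def osc_def osc_mean_def right_diff_distrib mult_ac)
  moreover have "\<bar>?q * W t\<bar> \<le> \<bar>?q\<bar> * C" for t
    unfolding abs_mult by (intro mult_left_mono W(2)) simp
  ultimately show thesis by (rule that)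
qed

lemma osc_bounds:
  obtains B W where "B > 0" "\<And>a t. \<bar>osc a t\<bar> \<le> B" "\<And>a t. \<bar>osc_int a t\<bar> \<le> B"
    "\<And>a a' t. \<bar>W a a' t\<bar> \<le> B"
    "\<And>a a' t. (W a a' has_real_derivative (osc_int a t * osc a' t - osc_mean a a')) (at t)"
proof -
  have "\<exists>C W. (\<forall>t. (W has_real_derivative (osc_int a t * osc a' t - osc_mean a a')) (at t)) \<and> (\<forall>t. \<bar>W t\<bar> \<le> C)"
    for a a'
    by (rule osc_product_antiderivative[of a a']) blast
  then obtain C W where W_deriv: "\<And>a a' t. (W a a' has_real_derivative (osc_int a t * osc a' t - osc_mean a a')) (at t)"
    and W_le: "\<And>a a' t. \<bar>W a a' t\<bar> \<le> C a a'"
    by metis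
  have "\<exists>B. \<forall>t. \<bar>osc a t\<bar> \<le> B" for a
    using freq_pos[of "fst a"] by (intro exI[of _ "sqrt (freq (fst a))"]) (simp add: osc_def abs_mult mult_left_le)
  from uniform_bound_finite_family[of osc, OF this]
  obtain B1 where 1: "B1 > 0" "\<And>a t. \<bar>osc a t\<bar> \<le> B1" by blast
  have "\<exists>B. \<forall>t. \<bar>osc_int a t\<bar> \<le> B" for a
    using freq_pos[of "fst a"] by (intro exI[of _ "1 / sqrt (freq (fst a))"]) (simp add: osc_int_def abs_divide divide_right_mono)
  from uniform_bound_finite_family[of osc_int, OF this]
  obtain B2 where 2: "B2 > 0" "\<And>a t. \<bar>osc_int a t\<bar> \<le> B2" by blast
  have "\<exists>B. \<forall>t. \<bar>W (fst x) (snd x) t\<bar> \<le> B" for x using W_le by blast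
  from uniform_bound_finite_family[of "\<lambda>x. W (fst x) (snd x)", OF this]
  obtain B3 where 3: "B3 > 0" "\<And>x t. \<bar>W (fst x) (snd x) t\<bar> \<le> B3" by blast
  show thesis
  proof (rule that[of "B1 + B2 + B3" W])
    show "B1 + B2 + B3 > 0" using 1 2 3 by simp
    show "\<bar>osc a t\<bar> \<le> B1 + B2 + B3" for a t using 1(2)[of a t] 2(1) 3(1) by simp
    show "\<bar>osc_int a t\<bar> \<le> B1 + B2 + B3" for a t using 2(2)[of a t] 1(1) 3(1) by simp
    show "\<bar>W a a' t\<bar> \<le> B1 + B2 + B3" for a a' t using 3(2)[of "(a, a')" t] 1(1) 2(1) by simp
    show "(W a a' has_real_derivative (osc_int a t * osc a' t - osc_mean a a')) (at t)" for a a' t by (rule W_deriv)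
  qed
qed

text \<open>In powers of \<open>sqrt (\<psi> p)\<close> the fields have order 2 and the Lie
  derivatives of the potential order 3; each further differentiation along a direction
  \<open>dir\<close> lowers the order by one.\<close>

lemma field_bounds:
  obtains M \<rho> where "M > 0" "\<rho> > 0" "\<rho> < 1"
    "\<And>a p. \<psi> p \<le> \<rho> \<Longrightarrow> \<bar>gain a p\<bar> \<le> M * (sqrt (\<psi> p))\<^sup>2"
    "\<And>a a' p. \<psi> p \<le> \<rho> \<Longrightarrow> \<bar>gain_d a p (dir a')\<bar> \<le> M * sqrt (\<psi> p)"
    "\<And>a p. \<psi> p \<le> \<rho> \<Longrightarrow> \<bar>lie1 a p\<bar> \<le> M * (sqrt (\<psi> p)) ^ 3"
    "\<And>a a' p. \<psi> p \<le> \<rho> \<Longrightarrow> \<bar>lie1_dir a a' p\<bar> \<le> M * (sqrt (\<psi> p))\<^sup>2"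
    "\<And>a a' a'' p. \<psi> p \<le> \<rho> \<Longrightarrow> \<bar>lie1_dir_d a a' p (dir a'')\<bar> \<le> M * sqrt (\<psi> p)"
    "\<And>a a' p. \<psi> p < \<rho> \<Longrightarrow> (lie1_dir a a' has_derivative lie1_dir_d a a' p) (at p)"
  by (rule scaled_bounds_uniform[of E H, OF E_edges connected H_adm, where ?'n = 'n and d = d])
     (rule that, assumption, assumption, assumption,
       simp_all add: gain_def gain_d_def lie1_def lie1_dir_def lie1_dir_d_def norm_dir_le)

section \<open>The corrected potential and its decay\<close>

definition lyap :: "(('v \<times> 'n) \<times> bool \<Rightarrow> ('v \<times> 'n) \<times> bool \<Rightarrow> real \<Rightarrow> real) \<Rightarrow> real \<Rightarrow> real^'n^'v \<Rightarrow> real" where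
  "lyap W t p = \<psi> p - (\<Sum>a\<in>UNIV. osc_int a t * lie1 a p) + (\<Sum>a\<in>UNIV. \<Sum>a'\<in>UNIV. W a a' t * lie2 a a' p)"

text \<open>The rate of change of \<open>lyap\<close> along solutions. The first double sum is the
  fifth-order remainder; the second is the averaged term, whose coefficients no longer depend on
  time.\<close>

definition lyap_d :: "(('v \<times> 'n) \<times> bool \<Rightarrow> ('v \<times> 'n) \<times> bool \<Rightarrow> real \<Rightarrow> real) \<Rightarrow> real \<Rightarrow> real^'n^'v \<Rightarrow> real" where
  "lyap_d W t p = (\<Sum>a\<in>UNIV. \<Sum>a'\<in>UNIV. W a a' t * (\<Sum>a''\<in>UNIV. osc a'' t * gain a'' p * lie2_d a a' p (dir a'')))
       - (\<Sum>a\<in>UNIV. \<Sum>a'\<in>UNIV. osc_mean a a' * lie2 a a' p)"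

lemma lyap_deriv:
  assumes \<gamma>: "solution \<gamma>"
    and W: "\<And>a a'. (W a a' has_real_derivative (osc_int a t * osc a' t - osc_mean a a')) (at t)"
    and Q: "\<And>a a'. (lie1_dir a a' has_derivative lie1_dir_d a a' (\<gamma> t)) (at (\<gamma> t))"
  shows "((\<lambda>t. lyap W t (\<gamma> t)) has_real_derivative lyap_d W t (\<gamma> t)) (at t)"
  unfolding lyap_def lyap_d_def
proof (rule second_order_averaging[where \<gamma> = \<gamma> and A = UNIV and u = osc and f = gain and e = dir and t = t
          and U = osc_int and W = W and m = osc_mean and V = \<psi> and F = lie1 and G = lie2
          and G' = "\<lambda>a a'. lie2_d a a' (\<gamma> t)", OF solution_deriv[OF \<gamma>] osc_int_deriv W])
  show "(\<psi> has_derivative (\<lambda>v. (\<Sum>i\<in>UNIV. local_pot_d1 E d i (\<gamma> t) v) / 2)) (at (\<gamma> t))"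
    by (rule global_pot_has_derivative[OF E_edges])
  show "gain a (\<gamma> t) * ((\<Sum>i\<in>UNIV. local_pot_d1 E d i (\<gamma> t) (dir a)) / 2) = lie1 a (\<gamma> t)" for a
    by (simp add: lie1_def gain_def scaled_d1_def dir_def sum_local_pot_d1_axis[OF E_edges])
  show "(lie1 a has_derivative (\<lambda>v. scaled_d2 (H (snd a)) E d (agent a) (dir a) v (\<gamma> t))) (at (\<gamma> t))" for a
    by (rule lie1_deriv)
  show "gain a' (\<gamma> t) * scaled_d2 (H (snd a)) E d (agent a) (dir a) (dir a') (\<gamma> t) = lie2 a a' (\<gamma> t)" for a a'
    by (simp add: lie2_def lie1_dir_def)
  from has_derivative_mult[OF gain_deriv Q]
  show "(lie2 a a' has_derivative lie2_d a a' (\<gamma> t)) (at (\<gamma> t))" for a a'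
    unfolding lie2_def[abs_def] lie2_d_def[abs_def] .
qed

text \<open>In the surviving antisymmetric combinations the second derivatives of the local
  potential cancel. What remains is minus the Wronskian of \<open>h1\<close> and \<open>h2\<close>
  times the squared first derivative, and \<open>h_cond\<close> bounds this from below.\<close>

lemma mean_term_lower_bound:
  obtains c r where "c > 0" "r > 0"
    "\<And>p. \<psi> p \<le> r \<Longrightarrow> c * (\<psi> p)\<^sup>2 \<le> (\<Sum>a\<in>UNIV. \<Sum>a'\<in>UNIV. osc_mean a a' * lie2 a a' p)"
proof -
  obtain r' c' where h_neg: "r' > 0" "c' > 0"
    "\<And>y. 0 < y \<Longrightarrow> y \<le> r' \<Longrightarrow> deriv h2 y * h1 y - deriv h1 y * h2 y \<le> - c' * y"
    using h_cond by auto
  obtain cL rL where L: "cL > 0" "rL > 0"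
    "\<And>p::real^'n^'v. \<psi> p \<le> rL \<Longrightarrow> cL * (\<psi> p)\<^sup>2
       \<le> (\<Sum>(i, k)\<in>UNIV. local_pot E d i p * (local_pot_d1 E d i p (axis i (b i k)))\<^sup>2)"
    by (rule weighted_gradient_lower_bound[of E d b, OF E_edges d_nonneg b_inner realizations_nonempty rigid_realization connected])
       (assumption | (rule that; assumption))+
  show thesis
  \<comment> \<open>The radius \<open>r'\<close> is halved because a local potential can be twice
    the global one.\<close>
  proof (rule that[of "c' / 2 * cL" "min rL (r' / 2)"])
    show "c' / 2 * cL > 0" "min rL (r' / 2) > 0" using h_neg L by simp_all
    fix p :: "real^'n^'v"
    assume p: "\<psi> p \<le> min rL (r' / 2)"
    have bracket: "c' * (local_pot E d i p * (local_pot_d1 E d i p (axis i (b i l)))\<^sup>2)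
       \<le> lie2 ((i, l), False) ((i, l), True) p - lie2 ((i, l), True) ((i, l), False) p" for i l
    proof -
      define D where "D = local_pot_d1 E d i p (axis i (b i l))"
      have "lie2 ((i, l), False) ((i, l), True) p - lie2 ((i, l), True) ((i, l), False) p
         = - (deriv h2 (local_pot E d i p) * h1 (local_pot E d i p) - deriv h1 (local_pot E d i p) * h2 (local_pot E d i p)) * D\<^sup>2"
        by (simp add: lie2_def gain_def lie1_dir_def H_def dir_def agent_def scaled_d2_def D_def power2_eq_square algebra_simps)
      moreover have "c' * (local_pot E d i p * D\<^sup>2) \<le> - (deriv h2 (local_pot E d i p) * h1 (local_pot E d i p) - deriv h1 (local_pot E d i p) * h2 (local_pot E d i p)) * D\<^sup>2"
      proof (cases "local_pot E d i p = 0")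
        \<comment> \<open>At 0 the condition \<open>h_cond\<close> says nothing, but both sides
          contain the factor \<open>D = 0\<close>.\<close>
        case True
        then show ?thesis by (simp add: D_def local_pot_d1_eq_0)
      next
        case False
        then have "0 < local_pot E d i p" using local_pot_nonneg[of E d i p] by simp
        moreover have "local_pot E d i p \<le> r'"
          using local_pot_le_global_pot[OF E_edges, of d i p] p by simp
        ultimately have "c' * local_pot E d i p \<le> - (deriv h2 (local_pot E d i p) * h1 (local_pot E d i p) - deriv h1 (local_pot E d i p) * h2 (local_pot E d i p))"
          using h_neg(3)[of "local_pot E d i p"] by simp
        then show ?thesis unfolding mult.assoc[symmetric] by (intro mult_right_mono) auto
      qed
      ultimately show ?thesis by (simp add: D_def)
    qed
    have "(\<Sum>a\<in>UNIV. \<Sum>a'\<in>UNIV. osc_mean a a' * lie2 a a' p)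
        = (\<Sum>x\<in>UNIV. (lie2 (x, False) (x, True) p - lie2 (x, True) (x, False) p) / 2)"
      unfolding osc_mean_def
      by (rule sum_quadrature_means[of freq phase "\<lambda>(i, k). \<phi> i k" "\<lambda>a a'. lie2 a a' p"])
         (use \<omega>_distinct freq_pos in \<open>auto simp: freq_def phase_def\<close>)
    also have "\<dots> \<ge> (\<Sum>(i, l)\<in>UNIV. c' * (local_pot E d i p * (local_pot_d1 E d i p (axis i (b i l)))\<^sup>2) / 2)"
      by (intro sum_mono) (use bracket in \<open>auto intro: divide_right_mono\<close>)
    also have "(\<Sum>(i, l)\<in>UNIV. c' * (local_pot E d i p * (local_pot_d1 E d i p (axis i (b i l)))\<^sup>2) / 2)
       = c' / 2 * (\<Sum>(i, l)\<in>UNIV. local_pot E d i p * (local_pot_d1 E d i p (axis i (b i l)))\<^sup>2)"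
      by (simp add: sum_distrib_left case_prod_unfold)
    also have "\<dots> \<ge> c' / 2 * (cL * (\<psi> p)\<^sup>2)"
      using h_neg(2) L(3)[of p] p by (intro mult_left_mono) auto
    finally show "c' / 2 * cL * (\<psi> p)\<^sup>2 \<le> (\<Sum>a\<in>UNIV. \<Sum>a'\<in>UNIV. osc_mean a a' * lie2 a a' p)"
      by (simp only: mult.assoc)
  qed
qed

lemma lyapunov_estimates:
  obtains W k \<rho> where "k > 0" "\<rho> > 0"
    "\<And>t p. \<psi> p \<le> \<rho> \<Longrightarrow> \<bar>lyap W t p - \<psi> p\<bar> \<le> \<psi> p / 10"
    "\<And>t p. \<psi> p \<le> \<rho> \<Longrightarrow> lyap_d W t p \<le> - k * (\<psi> p)\<^sup>2"
    "\<And>\<gamma> t. solution \<gamma> \<Longrightarrow> \<psi> (\<gamma> t) \<le> \<rho> \<Longrightarrow>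
       ((\<lambda>t. lyap W t (\<gamma> t)) has_real_derivative lyap_d W t (\<gamma> t)) (at t)"
proof -
  obtain B W where B: "B > 0" and osc_le: "\<And>a t. \<bar>osc a t\<bar> \<le> B" and osc_int_le: "\<And>a t. \<bar>osc_int a t\<bar> \<le> B"
    and W_le: "\<And>a a' t. \<bar>W a a' t\<bar> \<le> B"
    and W_deriv: "\<And>a a' t. (W a a' has_real_derivative (osc_int a t * osc a' t - osc_mean a a')) (at t)"
    by (rule osc_bounds) (rule that; assumption)
  obtain M \<rho>0 where M: "M > 0" "\<rho>0 > 0" "\<rho>0 < 1"
    and bounds: "\<And>a p. \<psi> p \<le> \<rho>0 \<Longrightarrow> \<bar>gain a p\<bar> \<le> M * (sqrt (\<psi> p))\<^sup>2"
    "\<And>a a' p. \<psi> p \<le> \<rho>0 \<Longrightarrow> \<bar>gain_d a p (dir a')\<bar> \<le> M * sqrt (\<psi> p)"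
    "\<And>a p. \<psi> p \<le> \<rho>0 \<Longrightarrow> \<bar>lie1 a p\<bar> \<le> M * (sqrt (\<psi> p)) ^ 3"
    "\<And>a a' p. \<psi> p \<le> \<rho>0 \<Longrightarrow> \<bar>lie1_dir a a' p\<bar> \<le> M * (sqrt (\<psi> p))\<^sup>2"
    "\<And>a a' a'' p. \<psi> p \<le> \<rho>0 \<Longrightarrow> \<bar>lie1_dir_d a a' p (dir a'')\<bar> \<le> M * sqrt (\<psi> p)"
    and Q_deriv: "\<And>a a' p. \<psi> p < \<rho>0 \<Longrightarrow> (lie1_dir a a' has_derivative lie1_dir_d a a' p) (at p)"
    by (rule field_bounds) (rule that; assumption)
  obtain c r where c: "c > 0" "r > 0"
    "\<And>p. \<psi> p \<le> r \<Longrightarrow> c * (\<psi> p)\<^sup>2 \<le> (\<Sum>a\<in>UNIV. \<Sum>a'\<in>UNIV. osc_mean a a' * lie2 a a' p)"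
    by (rule mean_term_lower_bound) (rule that; assumption)
  define N where "N = real CARD(('v \<times> 'n) \<times> bool)"
  have N: "N > 0" by (simp add: N_def)
  \<comment> \<open>With \<delta> = \<open>sqrt (\<psi> p)\<close>, these are the coefficients of
    \<delta>^3 in the distance of \<open>lyap\<close> from the potential and of \<delta>^5 in the
    remainder. Each sum over indices costs a factor \<open>N\<close>, and the \<delta>^4 terms are
    absorbed by \<delta> \<le> 1.\<close>
  define C3 where "C3 = N * (B * M) + N * (N * (B * (M * M)))"
  define C5 where "C5 = N * (N * (B * (N * (B * M * (2 * M * M)))))"
  have C3: "C3 > 0" and C5: "C5 > 0" using N B M by (simp_all add: C3_def C5_def add_pos_pos)
  \<comment> \<open>Half of the averaged decay rate is kept; the other half absorbs the
    remainder.\<close>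
  define k where "k = c / 2"
  have k: "k > 0" using c by (simp add: k_def)
  define \<eta> where "\<eta> = min (1 / (10 * C3)) (k / C5)"
  have \<eta>: "\<eta> > 0" "C3 * \<eta> \<le> 1 / 10" "C5 * \<eta> \<le> k"
  proof -
    show "\<eta> > 0" using C3 C5 k by (simp add: \<eta>_def)
    have "\<eta> \<le> 1 / (10 * C3)" "\<eta> \<le> k / C5" by (simp_all add: \<eta>_def)
    then show "C3 * \<eta> \<le> 1 / 10" "C5 * \<eta> \<le> k" using C3 C5 by (simp_all add: pos_le_divide_eq mult_ac)
  qed
  \<comment> \<open>The threshold \<open>\<eta>\<close> is for the square root of the potential,
    hence the square. Halving \<open>\<rho>0\<close> gives the strict inequality under which
    \<open>lie1_dir\<close> is known to be differentiable.\<close>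
  define \<rho> where "\<rho> = min (min (\<rho>0 / 2) r) (\<eta>\<^sup>2)"
  have \<rho>: "\<rho> > 0" using M c \<eta> by (simp add: \<rho>_def)
  have small: "\<psi> p < \<rho>0" "\<psi> p \<le> r" "sqrt (\<psi> p) \<le> \<eta>" "sqrt (\<psi> p) \<le> 1" if "\<psi> p \<le> \<rho>" for p
  proof -
    show "\<psi> p < \<rho>0" "\<psi> p \<le> r" using that M by (auto simp: \<rho>_def)
    then show "sqrt (\<psi> p) \<le> 1" using M by simp
    have "sqrt (\<psi> p) \<le> sqrt (\<eta>\<^sup>2)" using that by (intro real_sqrt_le_mono) (simp add: \<rho>_def)
    then show "sqrt (\<psi> p) \<le> \<eta>" using \<eta>(1) by simp
  qed
  note sum_le = sum_le_card[folded N_def]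

  have V_close: "\<bar>lyap W t p - \<psi> p\<bar> \<le> \<psi> p / 10" if p: "\<psi> p \<le> \<rho>" for t p
  proof -
    define \<delta> where "\<delta> = sqrt (\<psi> p)"
    have \<delta>: "0 \<le> \<delta>" "\<delta> \<le> 1" "\<delta> \<le> \<eta>" "\<psi> p = \<delta>\<^sup>2" using global_pot_nonneg[of E d p] small[OF p] by (simp_all add: \<delta>_def)
    note bd = bounds[OF less_imp_le[OF small(1)[OF p]], folded \<delta>_def]
    have "\<bar>lyap W t p - \<psi> p\<bar> \<le> \<bar>\<Sum>a\<in>UNIV. osc_int a t * lie1 a p\<bar> + \<bar>\<Sum>a\<in>UNIV. \<Sum>a'\<in>UNIV. W a a' t * lie2 a a' p\<bar>"
      unfolding lyap_def by linarith
    also have "\<dots> \<le> N * (B * (M * \<delta> ^ 3)) + N * (N * (B * ((M * \<delta>\<^sup>2) * (M * \<delta>\<^sup>2))))"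
      unfolding lie2_def by (intro add_mono sum_le abs_mult_le osc_int_le W_le bd)
    also have "\<dots> = N * (B * M) * \<delta> ^ 3 + N * (N * (B * (M * M))) * (\<delta> ^ 3 * \<delta>)"
      by (simp add: power2_eq_square power3_eq_cube)
    also have "\<dots> \<le> N * (B * M) * \<delta> ^ 3 + N * (N * (B * (M * M))) * (\<delta> ^ 3 * 1)"
      using N B M \<delta> by (intro add_left_mono mult_left_mono) auto
    also have "\<dots> = C3 * \<delta> * \<delta>\<^sup>2" by (simp add: C3_def power2_eq_square power3_eq_cube algebra_simps)
    also have "\<dots> \<le> 1 / 10 * \<delta>\<^sup>2"
    proof (rule mult_right_mono)
      have "C3 * \<delta> \<le> C3 * \<eta>" using C3 \<delta>(3) by (intro mult_left_mono) auto
      then show "C3 * \<delta> \<le> 1 / 10" using \<eta>(2) by simp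
    qed simp
    finally show ?thesis by (simp add: \<delta>(4))
  qed

  have lyap_d_le: "lyap_d W t p \<le> - k * (\<psi> p)\<^sup>2" if p: "\<psi> p \<le> \<rho>" for t p
  proof -
    define \<delta> where "\<delta> = sqrt (\<psi> p)"
    have \<delta>: "0 \<le> \<delta>" "\<delta> \<le> 1" "\<delta> \<le> \<eta>" "\<psi> p = \<delta>\<^sup>2" using global_pot_nonneg[of E d p] small[OF p] by (simp_all add: \<delta>_def)
    note bd = bounds[OF less_imp_le[OF small(1)[OF p]], folded \<delta>_def]
    have "\<bar>\<Sum>a\<in>UNIV. \<Sum>a'\<in>UNIV. W a a' t * (\<Sum>a''\<in>UNIV. osc a'' t * gain a'' p * lie2_d a a' p (dir a''))\<bar>
      \<le> N * (N * (B * (N * (B * (M * \<delta>\<^sup>2) * ((M * \<delta>\<^sup>2) * (M * \<delta>) + (M * \<delta>) * (M * \<delta>\<^sup>2))))))"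
      unfolding lie2_d_def
      by (intro sum_le abs_mult_le W_le osc_le bd order_trans[OF abs_triangle_ineq] add_mono)
    also have "\<dots> = C5 * \<delta> * (\<delta>\<^sup>2)\<^sup>2"
      by (simp add: C5_def power2_eq_square algebra_simps)
    also have "\<dots> \<le> k * (\<delta>\<^sup>2)\<^sup>2"
    proof (rule mult_right_mono)
      have "C5 * \<delta> \<le> C5 * \<eta>" using C5 \<delta>(3) by (intro mult_left_mono) auto
      then show "C5 * \<delta> \<le> k" using \<eta>(3) by simp
    qed simp
    finally have rem: "\<bar>\<Sum>a\<in>UNIV. \<Sum>a'\<in>UNIV. W a a' t * (\<Sum>a''\<in>UNIV. osc a'' t * gain a'' p * lie2_d a a' p (dir a''))\<bar>
        \<le> k * (\<psi> p)\<^sup>2" by (simp add: \<delta>(4))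
    have "2 * k * (\<psi> p)\<^sup>2 \<le> (\<Sum>a\<in>UNIV. \<Sum>a'\<in>UNIV. osc_mean a a' * lie2 a a' p)"
      using c(3)[OF small(2)[OF p]] by (simp add: k_def)
    then show ?thesis using rem unfolding lyap_d_def by simp
  qed

  show thesis
    using k \<rho> V_close lyap_d_le lyap_deriv[OF _ W_deriv Q_deriv] small(1) by (intro that) blast+
qed

section \<open>Convergence of the positions\<close>

lemma norm_sum_dir_le:
  assumes "\<And>a. \<bar>g a\<bar> \<le> c"
  shows "norm (\<Sum>a\<in>UNIV. g a *\<^sub>R dir a) \<le> real CARD(('v \<times> 'n) \<times> bool) * c"
proof -
  have "norm (\<Sum>a\<in>UNIV. g a *\<^sub>R dir a) \<le> (\<Sum>a\<in>UNIV. \<bar>g a\<bar>)"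
    by (rule sum_norm_le) (use norm_dir_le in \<open>simp add: mult_left_le\<close>)
  also have "\<dots> \<le> real CARD(('v \<times> 'n) \<times> bool) * c" using sum_le_card[of "\<lambda>a. \<bar>g a\<bar>" c] assms by simp
  finally show ?thesis .
qed

text \<open>The velocity itself is bounded only by a multiple of the potential, hence of 1/t, which
  is not integrable. The correction \<open>R\<close> tends to 0 with the potential, and removing it
  raises the order to the power 3/2 of the potential.\<close>

lemma drift_estimates:
  obtains R Z' :: "real \<Rightarrow> real^'n^'v \<Rightarrow> real^'n^'v" and M \<rho> where "M > 0" "\<rho> > 0"
    "\<And>t p. \<psi> p \<le> \<rho> \<Longrightarrow> norm (R t p) \<le> M * \<psi> p"
    "\<And>t p. \<psi> p \<le> \<rho> \<Longrightarrow> norm (Z' t p) \<le> M * (sqrt (\<psi> p)) ^ 3"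
    "\<And>\<gamma> t. solution \<gamma> \<Longrightarrow> ((\<lambda>t. \<gamma> t - R t (\<gamma> t)) has_vector_derivative Z' t (\<gamma> t)) (at t)"
proof -
  obtain B W where B: "B > 0" and osc_le: "\<And>a t. \<bar>osc a t\<bar> \<le> B" and osc_int_le: "\<And>a t. \<bar>osc_int a t\<bar> \<le> B"
    and "\<And>a a' t. \<bar>W a a' t :: real\<bar> \<le> B"
    by (rule osc_bounds) blast
  obtain M \<rho> where M: "M > 0" "\<rho> > 0"
    and gain_le: "\<And>a p. \<psi> p \<le> \<rho> \<Longrightarrow> \<bar>gain a p\<bar> \<le> M * (sqrt (\<psi> p))\<^sup>2"
    and gain_d_le: "\<And>a a' p. \<psi> p \<le> \<rho> \<Longrightarrow> \<bar>gain_d a p (dir a')\<bar> \<le> M * sqrt (\<psi> p)"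
    by (rule field_bounds) (rule that; assumption)
  define N where "N = real CARD(('v \<times> 'n) \<times> bool)"
  have N: "N > 0" by (simp add: N_def)
  note sum_le = sum_le_card[folded N_def] and norm_sum_le = norm_sum_dir_le[folded N_def]
  define R where "R t p = (\<Sum>a\<in>UNIV. (osc_int a t * gain a p) *\<^sub>R dir a)" for t p
  define Z' where "Z' t p = - (\<Sum>a\<in>UNIV. (osc_int a t * (\<Sum>a'\<in>UNIV. osc a' t * gain a' p * gain_d a p (dir a'))) *\<^sub>R dir a)" for t p
  define K where "K = N * (B * M) + N * (B * (N * (B * (M * M))))"
  show thesis
  proof (rule that[of K \<rho> R Z'])
    show "K > 0" "\<rho> > 0" using N B M by (simp_all add: K_def add_pos_pos)
    fix t and p :: "real^'n^'v"
    assume p: "\<psi> p \<le> \<rho>"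
    have "norm (R t p) \<le> N * (B * (M * (sqrt (\<psi> p))\<^sup>2))"
      unfolding R_def using p by (intro norm_sum_le abs_mult_le osc_int_le gain_le)
    also have "\<dots> = N * (B * M) * \<psi> p" by (simp add: global_pot_nonneg)
    also have "\<dots> \<le> K * \<psi> p"
      using N B M by (intro mult_right_mono) (simp_all add: K_def global_pot_nonneg)
    finally show "norm (R t p) \<le> K * \<psi> p" .
    have "norm (Z' t p) \<le> N * (B * (N * (B * (M * (sqrt (\<psi> p))\<^sup>2) * (M * sqrt (\<psi> p)))))"
      unfolding Z'_def norm_minus_cancel using p
      by (intro norm_sum_le sum_le abs_mult_le osc_int_le osc_le gain_le gain_d_le)
    also have "\<dots> = N * (B * (N * (B * (M * M)))) * (sqrt (\<psi> p)) ^ 3"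
      by (simp add: power2_eq_square power3_eq_cube)
    also have "\<dots> \<le> K * (sqrt (\<psi> p)) ^ 3"
      using N B M by (intro mult_right_mono) (simp_all add: K_def global_pot_nonneg)
    finally show "norm (Z' t p) \<le> K * (sqrt (\<psi> p)) ^ 3" .
  next
    fix \<gamma> t assume "solution \<gamma>"
    then show "((\<lambda>t. \<gamma> t - R t (\<gamma> t)) has_vector_derivative Z' t (\<gamma> t)) (at t)"
      unfolding R_def Z'_def
      by (intro first_order_averaging[where \<gamma> = \<gamma> and A = UNIV and u = osc and f = gain and e = dir and t = t
            and U = osc_int and f' = "\<lambda>a. gain_d a (\<gamma> t)"] solution_deriv osc_int_deriv gain_deriv)
  qed
qed

lemma local_stability:
  obtains c r where "c > 0" "r > 0"
    "\<And>\<gamma> t0. solution \<gamma> \<Longrightarrow> \<psi> (\<gamma> t0) \<le> r \<Longrightarrow> (\<exists>q\<in>realizations E d. (\<gamma> \<longlongrightarrow> q) at_top) \<and>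
       (\<forall>t\<ge>t0. \<psi> (\<gamma> t) \<le> 2 * \<psi> (\<gamma> t0) / (1 + c * \<psi> (\<gamma> t0) * (t - t0)))"
proof -
  obtain W k \<rho>1 where k: "k > 0" and "\<rho>1 > 0"
    and close: "\<And>t p. \<psi> p \<le> \<rho>1 \<Longrightarrow> \<bar>lyap W t p - \<psi> p\<bar> \<le> \<psi> p / 10"
    and lyap_d_le: "\<And>t p. \<psi> p \<le> \<rho>1 \<Longrightarrow> lyap_d W t p \<le> - k * (\<psi> p)\<^sup>2"
    and lyap_deriv: "\<And>\<gamma> t. solution \<gamma> \<Longrightarrow> \<psi> (\<gamma> t) \<le> \<rho>1 \<Longrightarrow>
       ((\<lambda>t. lyap W t (\<gamma> t)) has_real_derivative lyap_d W t (\<gamma> t)) (at t)"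
    by (rule lyapunov_estimates) (rule that; assumption)
  obtain R Z' :: "real \<Rightarrow> real^'n^'v \<Rightarrow> real^'n^'v" and M \<rho>2 where M: "M > 0" and "\<rho>2 > 0"
    and R_le: "\<And>t p. \<psi> p \<le> \<rho>2 \<Longrightarrow> norm (R t p) \<le> M * \<psi> p"
    and Z'_le: "\<And>t p. \<psi> p \<le> \<rho>2 \<Longrightarrow> norm (Z' t p) \<le> M * (sqrt (\<psi> p)) ^ 3"
    and Z_deriv: "\<And>\<gamma> t. solution \<gamma> \<Longrightarrow> ((\<lambda>t. \<gamma> t - R t (\<gamma> t)) has_vector_derivative Z' t (\<gamma> t)) (at t)"
    by (rule drift_estimates) (rule that; assumption)
  define \<rho> where "\<rho> = min \<rho>1 \<rho>2"
  have \<rho>: "\<rho> > 0" "\<rho> \<le> \<rho>1" "\<rho> \<le> \<rho>2" using \<open>\<rho>1 > 0\<close> \<open>\<rho>2 > 0\<close> by (auto simp: \<rho>_def)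
  show thesis
  \<comment> \<open>Rate and initial threshold are those of \<open>perturbed_riccati_decay\<close>;
    starting below half of \<open>\<rho>\<close> keeps the trajectory in the region where all
    estimates hold.\<close>
  proof (rule that[of "k / 2" "\<rho> / 2"])
    show "k / 2 > 0" "\<rho> / 2 > 0" using k \<rho> by simp_all
    fix \<gamma> t0
    assume \<gamma>: "solution \<gamma>" and init: "\<psi> (\<gamma> t0) \<le> \<rho> / 2"
    define y where "y t = \<psi> (\<gamma> t)" for t
    have y_nonneg: "y t \<ge> 0" for t by (simp add: y_def global_pot_nonneg)
    have "continuous_on UNIV \<gamma>"
      using \<gamma> unfolding solution_def
      by (intro continuous_at_imp_continuous_on ballI) (blast intro: has_vector_derivative_continuous)
    then have y_cont: "continuous_on UNIV y"
      unfolding y_def by (intro continuous_on_compose2[OF continuous_on_global_pot[OF E_edges, of UNIV]]) auto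
    note decay = perturbed_riccati_decay[of \<rho> k y "\<lambda>t. lyap W t (\<gamma> t)" "\<lambda>t. lyap_d W t (\<gamma> t)" t0,
        OF \<rho>(1) less_imp_le[OF k] y_cont y_nonneg]
    have y_small: "y t \<le> \<rho>" and y_decay: "y t \<le> 2 * y t0 / (1 + k / 2 * y t0 * (t - t0))" if "t0 \<le> t" for t
      using decay[OF _ _ _ _ that] close lyap_d_le lyap_deriv[OF \<gamma>] init \<rho>(2) by (simp_all add: y_def)
    have y_lim: "(y \<longlongrightarrow> 0) at_top"
      using tendsto_zero_of_decay[OF y_nonneg _ y_decay] k by simp
    have "norm (R t (\<gamma> t)) \<le> M * y t" if "t0 \<le> t" for t
      using R_le[of "\<gamma> t" t] y_small[OF that] \<rho>(3) by (simp add: y_def)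
    then have "\<forall>\<^sub>F t in at_top. norm (R t (\<gamma> t)) \<le> M * y t"
      unfolding eventually_at_top_linorder by (intro exI[of _ t0]) simp
    then have R_lim: "((\<lambda>t. R t (\<gamma> t)) \<longlongrightarrow> 0) at_top"
      by (rule Lim_null_comparison) (use tendsto_mult_right_zero[OF y_lim] in auto)
    have "norm (Z' t (\<gamma> t)) \<le> M * (sqrt (y t)) ^ 3" if "t0 \<le> t" for t
      using Z'_le[of "\<gamma> t" t] y_small[OF that] \<rho>(3) by (simp add: y_def)
    then obtain q where q: "((\<lambda>t. \<gamma> t - R t (\<gamma> t)) \<longlongrightarrow> q) at_top"
      using cubic_decay_imp_convergent[of t0 "\<lambda>t. \<gamma> t - R t (\<gamma> t)" "\<lambda>t. Z' t (\<gamma> t)" M y "k / 2",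
          OF Z_deriv[OF \<gamma>] _ y_nonneg less_imp_le[OF M] _ y_decay] k by auto
    then have \<gamma>_lim: "(\<gamma> \<longlongrightarrow> q) at_top" using tendsto_add[OF q R_lim] by simp
    have "(y \<longlongrightarrow> \<psi> q) at_top"
      unfolding y_def
      by (rule continuous_on_tendsto_compose[OF continuous_on_global_pot[OF E_edges, of UNIV] \<gamma>_lim]) auto
    then have "\<psi> q = 0" using y_lim tendsto_unique trivial_limit_at_top_linorder by blast
    then have "q \<in> realizations E d"
      by (simp add: realizations_iff_global_pot[OF E_edges d_nonneg])
    then show "(\<exists>q\<in>realizations E d. (\<gamma> \<longlongrightarrow> q) at_top) \<and>
       (\<forall>t\<ge>t0. \<psi> (\<gamma> t) \<le> 2 * \<psi> (\<gamma> t0) / (1 + k / 2 * \<psi> (\<gamma> t0) * (t - t0)))"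
      using \<gamma>_lim y_decay by (auto simp: y_def)
  qed
qed

end

theorem theorem4p7:
  fixes E :: "('v::finite) set set"
    and d :: "'v set \<Rightarrow> real"
    and b :: "'v \<Rightarrow> ('n::finite) \<Rightarrow> real^'n"
    and \<omega> \<phi> :: "'v \<Rightarrow> 'n \<Rightarrow> real"
    and h1 h2 :: "real \<Rightarrow> real"
  assumes E_nonempty: "E \<noteq> {}"
    and E_edges: "\<forall>e\<in>E. card e = 2"
    and d_nonneg: "\<forall>e\<in>E. d e \<ge> 0"
    and realizable: "\<exists>p::real^'n^'v. \<forall>i j. {i, j} \<in> E \<longrightarrow> norm (p $ j - p $ i) = d {i, j}"
    and b_orthonormal: "\<forall>i k l. b i k \<bullet> b i l = (if k = l then 1 else 0)"
    and \<omega>_pos: "\<forall>i k. \<omega> i k > 0"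
    and \<omega>_distinct: "inj (\<lambda>(i, k). \<omega> i k)"
    and h1_adm: "admissible_h h1"
    and h2_adm: "admissible_h h2"
    and h_cond: "\<exists>r' c'. r' > 0 \<and> c' > 0 \<and>
       (\<forall>y\<in>{0<..r'}. deriv h2 y * h1 y - deriv h1 y * h2 y \<le> - c' * y)"
    and rigid: "\<forall>p::real^'n^'v. p \<in> realizations E d \<longrightarrow> inf_rigid E p"
  shows "\<exists>c r. c > 0 \<and> r > 0 \<and>
     (\<forall>t0 (p0::real^'n^'v) (\<gamma>::real \<Rightarrow> real^'n^'v).
        global_pot E d p0 \<le> r \<and> \<gamma> t0 = p0 \<and>
        (\<forall>t. (\<gamma> has_vector_derivative closed_loop b \<omega> \<phi> h1 h2 E d t (\<gamma> t)) (at t))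
        \<longrightarrow> (\<exists>q\<in>realizations E d. (\<gamma> \<longlongrightarrow> q) at_top) \<and>
            (\<forall>t\<ge>t0. global_pot E d (\<gamma> t)
                 \<le> 2 * global_pot E d p0 / (1 + c * global_pot E d p0 * (t - t0))))"
proof -
  interpret formation E d b \<omega> \<phi> h1 h2
    by unfold_locales (fact assms)+
  obtain c r where cr: "c > 0" "r > 0"
    "\<And>\<gamma> t0. solution \<gamma> \<Longrightarrow> global_pot E d (\<gamma> t0) \<le> r \<Longrightarrow> (\<exists>q\<in>realizations E d. (\<gamma> \<longlongrightarrow> q) at_top) \<and>
       (\<forall>t\<ge>t0. global_pot E d (\<gamma> t) \<le> 2 * global_pot E d (\<gamma> t0) / (1 + c * global_pot E d (\<gamma> t0) * (t - t0)))"
    by (rule local_stability) (rule that; assumption)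
  show ?thesis
  proof (rule exI[of _ c], rule exI[of _ r], intro conjI allI impI)
    fix t0 p0 and \<gamma> :: "real \<Rightarrow> real^'n^'v"
    assume "global_pot E d p0 \<le> r \<and> \<gamma> t0 = p0 \<and>
        (\<forall>t. (\<gamma> has_vector_derivative closed_loop b \<omega> \<phi> h1 h2 E d t (\<gamma> t)) (at t))"
    then have "solution \<gamma>" "global_pot E d (\<gamma> t0) \<le> r" and p0: "\<gamma> t0 = p0"
      by (simp_all add: solution_def)
    note * = cr(3)[OF this(1,2)]
    show "\<exists>q\<in>realizations E d. (\<gamma> \<longlongrightarrow> q) at_top" using * by blast
    show "global_pot E d (\<gamma> t) \<le> 2 * global_pot E d p0 / (1 + c * global_pot E d p0 * (t - t0))" if "t \<ge> t0" for t
      using * that p0 by blast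
  qed (fact cr)+
qed

end
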